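(* Let $p:E\to B$ be a fibre bundle with base $B$ a finite 2-complex, and let $\ast_B\in B$ and $\ast_E\in E$ be base points such that $p(\ast_E)=\ast_B$. Then there is a map $s:B\to E$ such that $p\circ s=\mathrm{id}_B$ if and only if the inclusion of the fibre $F=p^{-1}(\ast_B)$ into $E$ induces a monomorphism from $\pi_1F$ to $\pi_1E$ and there is a homomorphism $\mathfrak{s}:\pi_1B\to\pi_1E$ such that $p_*\circ\mathfrak{s}=\mathrm{id}_{\pi_1B}$. If so, we may assume that $s_*=\mathfrak{s}$.
   Context: A finite 2-complex is a finite CW complex of dimension at most 2. Maps are continuous. Fundamental groups are taken with respect to the base points $\ast_B$ (for $B$) and $\ast_E$ (for $E$ and $F$); $p_*$ and $s_*$ denote the homomorphisms induced on fundamental groups.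
   Formalization: B is assumed path-connected, and E is assumed path-connected for the equivalence (not for realising a given splitting by a section); without these the claim fails, e.g. S¹⊔S³ over pt⊔S², or S¹ plus its connected double cover over S¹. *)

theory Defs
  imports "HOL-Analysis.Analysis" "HOL-Algebra.Group"
begin

text \<open>Spaces are subsets of types of class \<open>topological_space\<close>, with the subspace topology.\<close>

section \<open>The fundamental group\<close>

definition loops_at :: "'a::topological_space set \<Rightarrow> 'a \<Rightarrow> (real \<Rightarrow> 'a) set" where
  "loops_at X x = {g. path g \<and> path_image g \<subseteq> X \<and> pathstart g = x \<and> pathfinish g = x}"

definition loop_class :: "'a::topological_space set \<Rightarrow> (real \<Rightarrow> 'a) \<Rightarrow> (real \<Rightarrow> 'a) set" where
  "loop_class X g = {h. homotopic_paths X g h}"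

definition fundamental_group ::
    "'a::topological_space set \<Rightarrow> 'a \<Rightarrow> (real \<Rightarrow> 'a) set monoid" where
  "fundamental_group X x =
     \<lparr>carrier = loop_class X ` loops_at X x,
      monoid.mult = (\<lambda>a b. {r. \<exists>g\<in>a. \<exists>h\<in>b. homotopic_paths X (g +++ h) r}),
      one = loop_class X (\<lambda>_. x)\<rparr>"

text \<open>The map of fundamental groups induced by a map \<open>f\<close> into the space \<open>Y\<close>.\<close>

definition induced_map ::
    "'b::topological_space set \<Rightarrow> ('a::topological_space \<Rightarrow> 'b)
     \<Rightarrow> (real \<Rightarrow> 'a) set \<Rightarrow> (real \<Rightarrow> 'b) set" where
  "induced_map Y f a = {r. \<exists>g\<in>a. homotopic_paths Y (f \<circ> g) r}"

lemma loop_class_eq_iff: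
  assumes "g \<in> loops_at X x"
  shows "loop_class X g = loop_class X h \<longleftrightarrow> homotopic_paths X g h"
proof
  assume eq: "loop_class X g = loop_class X h"
  have "g \<in> loop_class X g" using assms by (simp add: loop_class_def loops_at_def)
  with eq show "homotopic_paths X g h"
    by (simp add: loop_class_def homotopic_paths_sym)
next
  assume "homotopic_paths X g h"
  then show "loop_class X g = loop_class X h"
    unfolding loop_class_def by (blast intro: homotopic_paths_trans homotopic_paths_sym)
qed

lemma loops_at_const: "x \<in> X \<Longrightarrow> (\<lambda>_. x) \<in> loops_at X x"
  by (auto simp: loops_at_def path_def path_image_def pathstart_def pathfinish_def)

lemma loops_at_join: "\<lbrakk>g \<in> loops_at X x; h \<in> loops_at X x\<rbrakk> \<Longrightarrow> g +++ h \<in> loops_at X x"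
  by (auto simp: loops_at_def path_image_join)

lemma loops_at_reversepath: "g \<in> loops_at X x \<Longrightarrow> reversepath g \<in> loops_at X x"
  by (auto simp: loops_at_def)

lemma fundamental_group_mult:
  assumes "g \<in> loops_at X x" "h \<in> loops_at X x"
  shows "loop_class X g \<otimes>\<^bsub>fundamental_group X x\<^esub> loop_class X h = loop_class X (g +++ h)"
proof -
  have fs: "pathfinish g = pathstart h" "path g" "path_image g \<subseteq> X" "path h" "path_image h \<subseteq> X"
    using assms by (auto simp: loops_at_def)
  have "homotopic_paths X (g +++ h) r"
    if "homotopic_paths X g g'" "homotopic_paths X h h'" "homotopic_paths X (g' +++ h') r" for g' h' r
    using homotopic_paths_join [OF that(1,2) fs(1)] that(3) by (rule homotopic_paths_trans)
  moreover have "homotopic_paths X g g" "homotopic_paths X h h"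
    using fs by auto
  ultimately have "{r. \<exists>g'\<in>loop_class X g. \<exists>h'\<in>loop_class X h. homotopic_paths X (g' +++ h') r}
      = loop_class X (g +++ h)"
    unfolding loop_class_def by blast
  then show ?thesis by (simp add: fundamental_group_def)
qed

lemma homotopic_const_join:
  assumes "g \<in> loops_at X x"
  shows "homotopic_paths X ((\<lambda>_. x) +++ g) g"
proof (rule homotopic_paths_sym, rule homotopic_paths_reparametrize
    [where f = "\<lambda>t. if t \<le> 1/2 then 0 else 2 * t - 1"])
  show "continuous_on {0..1} (\<lambda>t::real. if t \<le> 1/2 then 0 else 2 * t - 1)"
    unfolding split_01
    by (rule continuous_on_cases continuous_intros | force)+
qed (use assms in \<open>auto simp: loops_at_def joinpaths_def pathstart_def pathfinish_def\<close>)

lemma homotopic_reversepath_join: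
  assumes "g \<in> loops_at X x"
  shows "homotopic_paths X (reversepath g +++ g) (\<lambda>_. x)"
proof -
  have g: "path g" "path_image g \<subseteq> X" "g 0 = x" "g 1 = x"
    using assms by (auto simp: loops_at_def pathstart_def pathfinish_def)
  have cont: "continuous_on {0..1} g" and im: "g ` {0..1} \<subseteq> X"
    using g by (auto simp: path_def path_image_def)
  let ?u = "\<lambda>z::real\<times>real. max (1 - fst z) \<bar>2 * snd z - 1\<bar>"
  have rng: "?u z \<in> {0..1}" if "z \<in> {0..1} \<times> {0..1}" for z
    using that by (auto simp: max_def abs_if)
  have cu: "continuous_on ({0..1} \<times> {0..1}) (\<lambda>z. g (?u z))"
    by (rule continuous_on_compose2 [OF cont]) (use rng in \<open>auto intro!: continuous_intros\<close>)
  have "homotopic_paths X (\<lambda>_. x) (reversepath g +++ g)"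
    unfolding homotopic_paths
    by (rule exI [where x = "\<lambda>z. g (?u z)"])
      (use cu rng im g in \<open>auto simp: image_subset_iff joinpaths_def reversepath_def
         pathstart_def pathfinish_def abs_if max_def algebra_simps\<close>)
  then show ?thesis by (rule homotopic_paths_sym)
qed

lemma group_fundamental_group:
  assumes "x \<in> X"
  shows "group (fundamental_group X x)"
proof (rule groupI)
  let ?G = "fundamental_group X x"
  have carr: "carrier ?G = loop_class X ` loops_at X x" and one: "\<one>\<^bsub>?G\<^esub> = loop_class X (\<lambda>_. x)"
    by (simp_all add: fundamental_group_def)
  note c = loops_at_const [OF assms]
  show "\<one>\<^bsub>?G\<^esub> \<in> carrier ?G" using c by (simp add: carr one)
  fix a assume "a \<in> carrier ?G"
  then obtain g where g: "g \<in> loops_at X x" "a = loop_class X g" by (auto simp: carr)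
  show "\<one>\<^bsub>?G\<^esub> \<otimes>\<^bsub>?G\<^esub> a = a"
    by (simp add: one g fundamental_group_mult c loop_class_eq_iff [OF loops_at_join [OF c g(1)]]
        homotopic_const_join)
  show "\<exists>b\<in>carrier ?G. b \<otimes>\<^bsub>?G\<^esub> a = \<one>\<^bsub>?G\<^esub>"
  proof (rule bexI [where x = "loop_class X (reversepath g)"])
    note r = loops_at_reversepath [OF g(1)]
    show "loop_class X (reversepath g) \<otimes>\<^bsub>?G\<^esub> a = \<one>\<^bsub>?G\<^esub>"
      by (simp add: one g fundamental_group_mult r loop_class_eq_iff [OF loops_at_join [OF r g(1)]]
          homotopic_reversepath_join)
    show "loop_class X (reversepath g) \<in> carrier ?G" using r by (simp add: carr)
  qed
  fix b assume "b \<in> carrier ?G"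
  then obtain h where h: "h \<in> loops_at X x" "b = loop_class X h" by (auto simp: carr)
  show "a \<otimes>\<^bsub>?G\<^esub> b \<in> carrier ?G"
    using g h by (simp add: carr fundamental_group_mult loops_at_join)
  fix d assume "d \<in> carrier ?G"
  then obtain k where k: "k \<in> loops_at X x" "d = loop_class X k" by (auto simp: carr)
  have "homotopic_paths X (g +++ (h +++ k)) ((g +++ h) +++ k)"
    using g h k by (intro homotopic_paths_assoc) (auto simp: loops_at_def)
  then show "a \<otimes>\<^bsub>?G\<^esub> b \<otimes>\<^bsub>?G\<^esub> d = a \<otimes>\<^bsub>?G\<^esub> (b \<otimes>\<^bsub>?G\<^esub> d)"
    using g h k
    by (simp add: fundamental_group_mult loops_at_join loop_class_eq_iff [of _ X x] homotopic_paths_sym)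
qed

lemma loops_at_compose:
  assumes "continuous_on X f" "f ` X \<subseteq> Y" "g \<in> loops_at X x"
  shows "f \<circ> g \<in> loops_at Y (f x)"
  using assms
  by (auto simp: loops_at_def path_image_compose pathstart_compose pathfinish_compose
      intro!: path_continuous_image intro: continuous_on_subset)

lemma induced_map_loop_class:
  assumes f: "continuous_on X f" "f ` X \<subseteq> Y" and g: "g \<in> loops_at X x"
  shows "induced_map Y f (loop_class X g) = loop_class Y (f \<circ> g)"
proof -
  have "homotopic_paths Y (f \<circ> g) (f \<circ> h)" if "homotopic_paths X g h" for h
    using that f by (intro homotopic_paths_continuous_image) auto
  moreover have "homotopic_paths X g g" using g by (auto simp: loops_at_def)
  ultimately show ?thesis
    unfolding induced_map_def loop_class_def by (blast intro: homotopic_paths_trans)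
qed

lemma induced_map_hom:
  assumes f: "continuous_on X f" "f ` X \<subseteq> Y"
  shows "induced_map Y f \<in> hom (fundamental_group X x) (fundamental_group Y (f x))"
proof (rule homI)
  fix a assume "a \<in> carrier (fundamental_group X x)"
  then obtain g where g: "g \<in> loops_at X x" "a = loop_class X g"
    by (auto simp: fundamental_group_def)
  show "induced_map Y f a \<in> carrier (fundamental_group Y (f x))"
    using loops_at_compose [OF f g(1)] g
    by (simp add: induced_map_loop_class [OF f g(1)] fundamental_group_def)
  fix b assume "b \<in> carrier (fundamental_group X x)"
  then obtain h where h: "h \<in> loops_at X x" "b = loop_class X h"
    by (auto simp: fundamental_group_def)
  show "induced_map Y f (a \<otimes>\<^bsub>fundamental_group X x\<^esub> b)
      = induced_map Y f a \<otimes>\<^bsub>fundamental_group Y (f x)\<^esub> induced_map Y f b"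
    using g h loops_at_compose [OF f g(1)] loops_at_compose [OF f h(1)]
    by (simp add: fundamental_group_mult induced_map_loop_class [OF f loops_at_join [OF g(1) h(1)]]
        induced_map_loop_class [OF f g(1)] induced_map_loop_class [OF f h(1)] path_compose_join)
qed

section \<open>Finite CW complexes\<close>

text \<open>Euclidean \<open>n\<close>-space is realised as the set of sequences vanishing from index \<open>n\<close> on, whose
  subspace topology in the product topology on \<^typ>\<open>nat \<Rightarrow> real\<close> is the usual one (compare
  \<^const>\<open>Euclidean_space\<close>). The 0-disc is a point, equal to its own interior, with empty boundary.\<close>

definition closed_disc :: "nat \<Rightarrow> (nat \<Rightarrow> real) set" where
  "closed_disc n = {x. (\<forall>i\<ge>n. x i = 0) \<and> (\<Sum>i<n. (x i)\<^sup>2) \<le> 1}"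

definition open_disc :: "nat \<Rightarrow> (nat \<Rightarrow> real) set" where
  "open_disc n = {x. (\<forall>i\<ge>n. x i = 0) \<and> (\<Sum>i<n. (x i)\<^sup>2) < 1}"

definition disc_boundary :: "nat \<Rightarrow> (nat \<Rightarrow> real) set" where
  "disc_boundary n = {x. (\<forall>i\<ge>n. x i = 0) \<and> (\<Sum>i<n. (x i)\<^sup>2) = 1}"

text \<open>\<open>I\<close> indexes the cells, \<open>d i\<close> is the dimension and \<open>\<Phi> i\<close> the characteristic map of the
  \<open>i\<close>-th cell. As there are finitely many cells, the weak topology condition and the condition
  that \<open>\<Phi> i\<close> is a homeomorphism on the open disc follow by compactness from those listed.\<close>

definition finite_CW_structure ::
    "'b::topological_space set \<Rightarrow> 'i set \<Rightarrow> ('i \<Rightarrow> nat) \<Rightarrow> ('i \<Rightarrow> (nat \<Rightarrow> real) \<Rightarrow> 'b) \<Rightarrow> bool" where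
  "finite_CW_structure X I d \<Phi> \<longleftrightarrow>
     finite I \<and> Hausdorff_space (top_of_set X) \<and>
     (\<forall>i\<in>I. continuous_on (closed_disc (d i)) (\<Phi> i) \<and> \<Phi> i ` closed_disc (d i) \<subseteq> X \<and>
            inj_on (\<Phi> i) (open_disc (d i)) \<and>
            \<Phi> i ` disc_boundary (d i) \<subseteq> (\<Union>j\<in>{j\<in>I. d j < d i}. \<Phi> j ` open_disc (d j))) \<and>
     disjoint_family_on (\<lambda>i. \<Phi> i ` open_disc (d i)) I \<and>
     (\<Union>i\<in>I. \<Phi> i ` open_disc (d i)) = X"

definition finite_2_complex :: "'b::topological_space set \<Rightarrow> bool" where
  "finite_2_complex X \<longleftrightarrow>
     (\<exists>(I::nat set) d \<Phi>. finite_CW_structure X I d \<Phi> \<and> (\<forall>i\<in>I. d i \<le> 2))"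

section \<open>Fibre bundles\<close>

definition fibre_bundle ::
    "'e::topological_space set \<Rightarrow> ('e \<Rightarrow> 'b::topological_space) \<Rightarrow> 'b set
     \<Rightarrow> 'f::topological_space set \<Rightarrow> bool" where
  "fibre_bundle E p B F \<longleftrightarrow>
     continuous_on E p \<and> p ` E \<subseteq> B \<and>
     (\<forall>b\<in>B. \<exists>U. openin (top_of_set B) U \<and> b \<in> U \<and>
        (\<exists>\<phi> \<psi>. homeomorphism {x\<in>E. p x \<in> U} (U \<times> F) \<phi> \<psi> \<and>
               (\<forall>x\<in>E. p x \<in> U \<longrightarrow> fst (\<phi> x) = p x)))"

definition is_section ::
    "'e::topological_space set \<Rightarrow> ('e \<Rightarrow> 'b::topological_space) \<Rightarrow> 'b set \<Rightarrow> ('b \<Rightarrow> 'e) \<Rightarrow> bool" where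
  "is_section E p B s \<longleftrightarrow> continuous_on B s \<and> s ` B \<subseteq> E \<and> (\<forall>b\<in>B. p (s b) = b)"

text \<open>Homomorphisms \<open>\<pi>\<^sub>1 B \<rightarrow> \<pi>\<^sub>1 E\<close> splitting \<open>p\<^sub>*\<close>.\<close>

definition splits_on_pi1 ::
    "'e::topological_space set \<Rightarrow> 'e \<Rightarrow> ('e \<Rightarrow> 'b::topological_space) \<Rightarrow> 'b set \<Rightarrow> 'b
     \<Rightarrow> ((real \<Rightarrow> 'b) set \<Rightarrow> (real \<Rightarrow> 'e) set) \<Rightarrow> bool" where
  "splits_on_pi1 E e\<^sub>0 p B b\<^sub>0 \<sigma> \<longleftrightarrow>
     \<sigma> \<in> hom (fundamental_group B b\<^sub>0) (fundamental_group E e\<^sub>0) \<and>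
     (\<forall>a\<in>carrier (fundamental_group B b\<^sub>0). induced_map B p (\<sigma> a) = a)"

end

theory Submission
  imports Defs
begin

text \<open>Let \<open>\<sigma>\<close> be a splitting of \<open>p\<^sub>*\<close>. The covering of \<open>E\<close> belonging to the image of \<open>\<sigma>\<close> has the
  same fundamental group as \<open>B\<close>; its fibres over \<open>B\<close> are path connected because \<open>\<sigma>\<close> splits \<open>p\<^sub>*\<close>, and
  simply connected because \<open>\<pi>\<^sub>1 F \<rightarrow> \<pi>\<^sub>1 E\<close> is injective. Hence a lift into this covering extends over each
  cell of dimension at most 2, and the resulting section induces \<open>\<sigma>\<close>. As \<open>E\<close> need not have coverings,
  points of the covering are represented by paths in \<open>E\<close>, and continuity of a lift is expressed
  by compatibility with the transport along paths; attaching a cell preserves this property by the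
  argument of van Kampen's theorem.

  Conversely, a section \<open>s\<close> makes \<open>\<pi>\<^sub>1 E \<rightarrow> \<pi>\<^sub>1 B\<close> surjective, so \<open>e\<^sub>0\<close> and \<open>s b\<^sub>0\<close> are joined by a path in the
  fibre. Over a disc on which a loop of the fibre bounds in \<open>E\<close>, the bounding disc and the section are
  homotopic lifts of the same map into a trivial bundle, and on the boundary this homotopy contracts the
  loop within the fibre.\<close>

section \<open>Trivialisations along a map into the base\<close>

text \<open>The obstacle is that a lift over a cell must lie in the right sheet of the covering, and
  earlier choices are known only modulo \<open>Sg\<close>. The splitting settles this twice: every
  loop at \<open>b\<^sub>0\<close> is, up to homotopy, the image of a loop in \<open>Sg\<close>, so
  two markings over one point of \<open>B\<close> can be joined inside the fibre; and a loop in
  \<open>Sg\<close> with null image is null in \<open>E\<close>, so that injectivity on the fibre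
  can be applied. The base point need not be a vertex. If it lies inside a cell, the value
  \<open>e\<^sub>0\<close> and the trivial marking have to be imposed there without touching the
  boundary values, so a lift is first built from the boundary and then deformed near one interior
  point. Path connectedness of \<open>E\<close> matters for the equivalence: the disjoint union of
  the Hopf fibration and the trivial circle bundle over the 2-sphere has a section, but with base
  point in the Hopf part the fibre does not inject on fundamental groups.\<close>

definition trivialisation ::
    "'e::topological_space set \<Rightarrow> ('e \<Rightarrow> 'b) \<Rightarrow> 'f::topological_space set \<Rightarrow> ('c::topological_space \<Rightarrow> 'b)
     \<Rightarrow> 'c set \<Rightarrow> ('c \<times> 'f \<Rightarrow> 'e) \<Rightarrow> ('c \<times> 'e \<Rightarrow> 'f) \<Rightarrow> bool" where
  "trivialisation E p F\<^sub>0 u S T T' \<longleftrightarrow>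
     continuous_on (S \<times> F\<^sub>0) T \<and>
     continuous_on {z. fst z \<in> S \<and> snd z \<in> E \<and> p (snd z) = u (fst z)} T' \<and>
     (\<forall>c\<in>S. \<forall>y\<in>F\<^sub>0. T (c, y) \<in> E \<and> p (T (c, y)) = u c \<and> T' (c, T (c, y)) = y) \<and>
     (\<forall>c\<in>S. \<forall>x\<in>E. p x = u c \<longrightarrow> T' (c, x) \<in> F\<^sub>0 \<and> T (c, T' (c, x)) = x)"

text \<open>This is triviality of the pullback of \<open>p\<close> along \<open>u\<close>. The
  pullback space is never formed: \<open>T\<close> and \<open>T'\<close> record the total space and
  fibre components of two mutually inverse bundle maps. The map \<open>u\<close> may identify
  points, as a characteristic map does on the boundary of its cell.\<close>

definition trivial_over ::
    "'e::topological_space set \<Rightarrow> ('e \<Rightarrow> 'b) \<Rightarrow> 'f::topological_space set \<Rightarrow> ('c::topological_space \<Rightarrow> 'b)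
     \<Rightarrow> 'c set \<Rightarrow> bool" where
  "trivial_over E p F\<^sub>0 u S \<longleftrightarrow> (\<exists>T T'. trivialisation E p F\<^sub>0 u S T T')"

lemma trivialisation_compose:
  assumes T: "trivialisation E p F\<^sub>0 u S T T'"
    and f: "continuous_on R f" "f ` R \<subseteq> S" and v: "\<And>x. x \<in> R \<Longrightarrow> v x = u (f x)"
  shows "trivialisation E p F\<^sub>0 v R (\<lambda>(c, y). T (f c, y)) (\<lambda>(c, x). T' (f c, x))"
proof -
  have cT: "continuous_on (S \<times> F\<^sub>0) T"
    and cT': "continuous_on {z. fst z \<in> S \<and> snd z \<in> E \<and> p (snd z) = u (fst z)} T'"
    using T by (auto simp: trivialisation_def)
  have "continuous_on (R \<times> F\<^sub>0) (\<lambda>z. T (f (fst z), snd z))"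
    by (rule continuous_on_compose2 [OF cT])
      (use f in \<open>auto intro!: continuous_intros continuous_on_compose2 [OF f(1)]\<close>)
  moreover have "continuous_on {z. fst z \<in> R \<and> snd z \<in> E \<and> p (snd z) = v (fst z)} (\<lambda>z. T' (f (fst z), snd z))"
    by (rule continuous_on_compose2 [OF cT'])
      (use f v in \<open>auto intro!: continuous_intros continuous_on_compose2 [OF f(1)]\<close>)
  moreover have "f x \<in> S" if "x \<in> R" for x using f that by auto
  ultimately show ?thesis
    using T v unfolding trivialisation_def case_prod_unfold by simp
qed

lemma trivial_over_compose:
  assumes "trivial_over E p F\<^sub>0 u S" "continuous_on R f" "f ` R \<subseteq> S" "\<And>x. x \<in> R \<Longrightarrow> v x = u (f x)"
  shows "trivial_over E p F\<^sub>0 v R"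
  using assms unfolding trivial_over_def by (blast intro: trivialisation_compose)

lemma trivial_over_subset:
  "\<lbrakk>trivial_over E p F\<^sub>0 u S; R \<subseteq> S\<rbrakk> \<Longrightarrow> trivial_over E p F\<^sub>0 u R"
  by (rule trivial_over_compose [where f = "\<lambda>x. x"]) (auto simp: continuous_on_id)

lemma fibre_bundle_locally_trivial:
  assumes fb: "fibre_bundle E p B F\<^sub>0" and u: "continuous_on S u" "u ` S \<subseteq> B" and c: "c \<in> S"
  obtains N where "open N" "c \<in> N" "trivial_over E p F\<^sub>0 u (S \<inter> N)"
proof -
  have "u c \<in> B" using u c by auto
  with fb have "\<exists>U. openin (top_of_set B) U \<and> u c \<in> U \<and>
        (\<exists>\<phi> \<psi>. homeomorphism {x\<in>E. p x \<in> U} (U \<times> F\<^sub>0) \<phi> \<psi> \<and>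
               (\<forall>x\<in>E. p x \<in> U \<longrightarrow> fst (\<phi> x) = p x))"
    by (simp add: fibre_bundle_def)
  then obtain U \<phi> \<psi> where U: "openin (top_of_set B) U" "u c \<in> U"
    and hom: "homeomorphism {x\<in>E. p x \<in> U} (U \<times> F\<^sub>0) \<phi> \<psi>"
    and \<phi>: "\<And>x. \<lbrakk>x \<in> E; p x \<in> U\<rbrakk> \<Longrightarrow> fst (\<phi> x) = p x"
    by blast
  obtain W where W: "open W" "U = B \<inter> W"
    using U(1) by (auto simp: openin_open)
  obtain N where N: "open N" "N \<inter> S = u -` W \<inter> S"
    using u(1) W(1) by (metis continuous_on_open_invariant)
  have inU: "u x \<in> U" if "x \<in> S \<inter> N" for x
    using that N W u(2) by auto
  have c\<phi>: "continuous_on {x\<in>E. p x \<in> U} \<phi>" and c\<psi>: "continuous_on (U \<times> F\<^sub>0) \<psi>"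
    and im: "\<phi> ` {x\<in>E. p x \<in> U} = U \<times> F\<^sub>0" "\<psi> ` (U \<times> F\<^sub>0) = {x\<in>E. p x \<in> U}"
    and inv: "\<And>x. \<lbrakk>x \<in> E; p x \<in> U\<rbrakk> \<Longrightarrow> \<psi> (\<phi> x) = x" "\<And>z. z \<in> U \<times> F\<^sub>0 \<Longrightarrow> \<phi> (\<psi> z) = z"
    using hom by (auto simp: homeomorphism_def)
  have cu: "continuous_on (S \<inter> N) u" using u(1) by (rule continuous_on_subset) auto
  have "trivialisation E p F\<^sub>0 u (S \<inter> N) (\<lambda>z. \<psi> (u (fst z), snd z)) (\<lambda>z. snd (\<phi> (snd z)))"
    unfolding trivialisation_def
  proof (intro conjI ballI impI)
    show "continuous_on ((S \<inter> N) \<times> F\<^sub>0) (\<lambda>z. \<psi> (u (fst z), snd z))"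
      by (rule continuous_on_compose2 [OF c\<psi>])
        (use inU in \<open>auto intro!: continuous_intros continuous_on_compose2 [OF cu]\<close>)
    show "continuous_on {z. fst z \<in> S \<inter> N \<and> snd z \<in> E \<and> p (snd z) = u (fst z)} (\<lambda>z. snd (\<phi> (snd z)))"
      by (rule continuous_on_snd, rule continuous_on_compose2 [OF c\<phi>])
        (use inU in \<open>auto intro!: continuous_intros\<close>)
    fix x assume x: "x \<in> S \<inter> N"
    { fix y assume y: "y \<in> F\<^sub>0"
      have z: "(u x, y) \<in> U \<times> F\<^sub>0" using inU x y by auto
      then have *: "\<psi> (u x, y) \<in> {x\<in>E. p x \<in> U}" using im by blast
      then show "\<psi> (u (fst (x, y)), snd (x, y)) \<in> E" by simp
      show "p (\<psi> (u (fst (x, y)), snd (x, y))) = u x"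
        using \<phi> [of "\<psi> (u x, y)"] * inv(2) [OF z] by auto
      show "snd (\<phi> (snd (x, \<psi> (u (fst (x, y)), snd (x, y))))) = y"
        using inv(2) [OF z] by simp }
    fix e assume e: "e \<in> E" "p e = u x"
    then have "p e \<in> U" using inU x by auto
    then have "\<phi> e \<in> \<phi> ` {x\<in>E. p x \<in> U}" using e by blast
    then have "\<phi> e \<in> U \<times> F\<^sub>0" "fst (\<phi> e) = u x" "\<psi> (\<phi> e) = e"
      using e im(1) \<phi> [of e] inv(1) [of e] \<open>p e \<in> U\<close> by auto
    then show "snd (\<phi> (snd (x, e))) \<in> F\<^sub>0"
      "\<psi> (u (fst (x, snd (\<phi> (snd (x, e))))), snd (x, snd (\<phi> (snd (x, e))))) = e"
      by (auto simp: mem_Times_iff) (metis prod.collapse)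
  qed
  moreover have "c \<in> N" using N W U c by auto
  ultimately show ?thesis using that N(1) by (auto simp: trivial_over_def)
qed

text \<open>Over the overlap the two trivialisations differ by a family of homeomorphisms of
  \<open>F\<^sub>0\<close>. The retraction \<open>r\<close> extends this family to all of
  \<open>S2\<close>; twisting the second trivialisation by it makes both agree where they
  meet.\<close>

lemma trivial_over_Un:
  fixes u :: "'c::topological_space \<Rightarrow> 'b" and E :: "'e::topological_space set"
  assumes "trivial_over E p F\<^sub>0 u S1" "trivial_over E p F\<^sub>0 u S2" and cl: "closed S1" "closed S2"
    and r: "continuous_on S2 r" "r ` S2 \<subseteq> S1 \<inter> S2" "\<And>x. x \<in> S1 \<inter> S2 \<Longrightarrow> r x = x"
  shows "trivial_over E p F\<^sub>0 u (S1 \<union> S2)"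
proof -
  obtain T1 T1' T2 T2' where "trivialisation E p F\<^sub>0 u S1 T1 T1'" "trivialisation E p F\<^sub>0 u S2 T2 T2'"
    using assms by (auto simp: trivial_over_def)
  note T = this [unfolded trivialisation_def]
  define P where "P S = {z::'c \<times> 'e. fst z \<in> S \<and> snd z \<in> E \<and> p (snd z) = u (fst z)}" for S
  have c: "continuous_on (S1 \<times> F\<^sub>0) T1" "continuous_on (S2 \<times> F\<^sub>0) T2"
      "continuous_on (P S1) T1'" "continuous_on (P S2) T2'"
    and T1: "\<And>c y. \<lbrakk>c \<in> S1; y \<in> F\<^sub>0\<rbrakk> \<Longrightarrow> T1 (c, y) \<in> E \<and> p (T1 (c, y)) = u c \<and> T1' (c, T1 (c, y)) = y"
    and T1': "\<And>c x. \<lbrakk>c \<in> S1; x \<in> E; p x = u c\<rbrakk> \<Longrightarrow> T1' (c, x) \<in> F\<^sub>0 \<and> T1 (c, T1' (c, x)) = x"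
    and T2: "\<And>c y. \<lbrakk>c \<in> S2; y \<in> F\<^sub>0\<rbrakk> \<Longrightarrow> T2 (c, y) \<in> E \<and> p (T2 (c, y)) = u c \<and> T2' (c, T2 (c, y)) = y"
    and T2': "\<And>c x. \<lbrakk>c \<in> S2; x \<in> E; p x = u c\<rbrakk> \<Longrightarrow> T2' (c, x) \<in> F\<^sub>0 \<and> T2 (c, T2' (c, x)) = x"
    using T by (auto simp: P_def)
  have r1: "r x \<in> S1" "r x \<in> S2" if "x \<in> S2" for x using r(2) that by auto
  define T where "T z = (if fst z \<in> S1 then T1 z
      else T2 (fst z, T2' (r (fst z), T1 (r (fst z), snd z))))" for z
  define T' where "T' z = (if fst z \<in> S1 then T1' z
      else T1' (r (fst z), T2 (r (fst z), T2' z)))" for z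
  have clI: "closedin (top_of_set A) (A \<inter> S \<times> UNIV)" if "closed S" for A and S :: "'c set"
    using that by (intro closedin_closed_Int closed_Times) auto
  have eqs: "(S1 \<union> S2) \<times> F\<^sub>0 \<inter> S1 \<times> UNIV = S1 \<times> F\<^sub>0" "(S1 \<union> S2) \<times> F\<^sub>0 \<inter> S2 \<times> UNIV = S2 \<times> F\<^sub>0"
    "P (S1 \<union> S2) \<inter> S1 \<times> UNIV = P S1" "P (S1 \<union> S2) \<inter> S2 \<times> UNIV = P S2"
    by (auto simp: P_def)
  have cl': "closedin (top_of_set ((S1 \<union> S2) \<times> F\<^sub>0)) (S1 \<times> F\<^sub>0)"
            "closedin (top_of_set ((S1 \<union> S2) \<times> F\<^sub>0)) (S2 \<times> F\<^sub>0)"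
            "closedin (top_of_set (P (S1 \<union> S2))) (P S1)"
            "closedin (top_of_set (P (S1 \<union> S2))) (P S2)"
    using clI [OF cl(1), of "(S1 \<union> S2) \<times> F\<^sub>0"] clI [OF cl(2), of "(S1 \<union> S2) \<times> F\<^sub>0"]
      clI [OF cl(1), of "P (S1 \<union> S2)"] clI [OF cl(2), of "P (S1 \<union> S2)"]
    unfolding eqs by blast+
  have cr: "continuous_on (S2 \<times> F\<^sub>0) (\<lambda>z. r (fst z))" "continuous_on (P S2) (\<lambda>z. r (fst z))"
    by (auto intro!: continuous_on_compose2 [OF r(1)] continuous_intros simp: P_def)
  have "continuous_on ((S1 \<times> F\<^sub>0) \<union> (S2 \<times> F\<^sub>0)) T"
    unfolding T_def
  proof (rule continuous_on_cases_local)
    show "continuous_on (S2 \<times> F\<^sub>0) (\<lambda>z. T2 (fst z, T2' (r (fst z), T1 (r (fst z), snd z))))"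
      by (intro continuous_on_compose2 [OF c(1)] continuous_on_compose2 [OF c(2)]
          continuous_on_compose2 [OF c(4)] continuous_intros cr)
        (use r1 T1 T2' in \<open>auto simp: P_def\<close>)
    show "T1 z = T2 (fst z, T2' (r (fst z), T1 (r (fst z), snd z)))"
      if "z \<in> S1 \<times> F\<^sub>0 \<and> \<not> fst z \<in> S1 \<or> z \<in> S2 \<times> F\<^sub>0 \<and> fst z \<in> S1" for z
      using that r(3) [of "fst z"] T1 [of "fst z" "snd z"] T2' [of "fst z" "T1 z"] by auto
  qed (use c cl' in \<open>auto simp: Sigma_Un_distrib1\<close>)
  moreover have "continuous_on (P S1 \<union> P S2) T'"
    unfolding T'_def
  proof (rule continuous_on_cases_local)
    show "continuous_on (P S2) (\<lambda>z. T1' (r (fst z), T2 (r (fst z), T2' z)))"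
      by (intro continuous_on_compose2 [OF c(2)] 
          continuous_on_compose2 [OF c(3)] c continuous_intros cr)
        (use r1 T2 T2' in \<open>auto simp: P_def\<close>)
    show "T1' z = T1' (r (fst z), T2 (r (fst z), T2' z))"
      if "z \<in> P S1 \<and> \<not> fst z \<in> S1 \<or> z \<in> P S2 \<and> fst z \<in> S1" for z
      using that r(3) [of "fst z"] T2' [of "fst z" "snd z"] by (auto simp: P_def)
    have "P S1 \<union> P S2 = P (S1 \<union> S2)" by (auto simp: P_def)
    then show "closedin (top_of_set (P S1 \<union> P S2)) (P S1)" "closedin (top_of_set (P S1 \<union> P S2)) (P S2)"
      using cl' by simp_all
  qed (use c in auto)
  moreover have "P S1 \<union> P S2 = P (S1 \<union> S2)" by (auto simp: P_def)
  moreover have "T (c, y) \<in> E \<and> p (T (c, y)) = u c \<and> T' (c, T (c, y)) = y"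
    if "c \<in> S1 \<union> S2" "y \<in> F\<^sub>0" for c y
  proof (cases "c \<in> S1")
    case True then show ?thesis using T1 that by (auto simp: T_def T'_def)
  next
    case False
    then have c: "c \<in> S2" using that by auto
    define w where "w = T2' (r c, T1 (r c, y))"
    have w: "w \<in> F\<^sub>0" "T2 (r c, w) = T1 (r c, y)"
      unfolding w_def using T2' [of "r c" "T1 (r c, y)"] T1 [of "r c" y] r1 [OF c] that by auto
    then show ?thesis
      using False T2 [OF c w(1)] T1 [of "r c" y] r1 [OF c] that
      by (simp add: T_def T'_def flip: w_def)
  qed
  moreover have "T' (c, x) \<in> F\<^sub>0 \<and> T (c, T' (c, x)) = x"
    if "c \<in> S1 \<union> S2" "x \<in> E" "p x = u c" for c x
  proof (cases "c \<in> S1")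
    case True then show ?thesis using T1' that by (auto simp: T_def T'_def)
  next
    case False
    then have c: "c \<in> S2" using that by auto
    define w where "w = T2' (c, x)"
    have w: "w \<in> F\<^sub>0" "T2 (c, w) = x"
      unfolding w_def using T2' [OF c] that by auto
    have "T2 (r c, w) \<in> E" "p (T2 (r c, w)) = u (r c)" "T2' (r c, T2 (r c, w)) = w"
      using T2 [of "r c" w] r1 [OF c] w by auto
    then show ?thesis
      using False w T1' [of "r c" "T2 (r c, w)"] r1 [OF c]
      by (simp add: T_def T'_def flip: w_def)
  qed
  ultimately have "trivialisation E p F\<^sub>0 u (S1 \<union> S2) T T'"
    by (simp add: trivialisation_def P_def Sigma_Un_distrib1)
  then show ?thesis by (auto simp: trivial_over_def)
qed

text \<open>The rectangle is subdivided by the \<open>Bolzano\<close> induction in each coordinate: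
  vertically over a thin strip around a fixed \<open>x\<close>, then horizontally over strips of
  full height. Neighbouring pieces meet in an edge onto which one of them retracts, so
  \<open>trivial_over_Un\<close> glues them.\<close>

lemma fibre_bundle_trivial_over_rectangle:
  fixes u :: "real \<times> real \<Rightarrow> 'b::topological_space"
  assumes fb: "fibre_bundle E p B F\<^sub>0"
    and u: "continuous_on ({a..b} \<times> {c..d}) u" "u ` ({a..b} \<times> {c..d}) \<subseteq> B"
    and le: "a \<le> b" "c \<le> d"
  shows "trivial_over E p F\<^sub>0 u ({a..b} \<times> {c..d})"
proof -
  let ?R = "{a..b} \<times> {c..d}"
  have p: "continuous_on E p" using fb by (simp add: fibre_bundle_def)
  \<comment> \<open>Intersecting with the rectangle allows the intervals of the induction to stick
    out of it. The half width \<open>e\<close> of the strip may shrink whenever two pieces are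
    glued.\<close>
  define Q where "Q x e c' d' \<longleftrightarrow> trivial_over E p F\<^sub>0 u (({x-e..x+e} \<inter> {a..b}) \<times> ({c'..d'} \<inter> {c..d}))"
    for x e c' d'
  have Q_mono: "Q x e' c' d'" if "Q x e c' d'" "e' \<le> e" for x e e' c' d'
    using that unfolding Q_def by (elim trivial_over_subset) auto
  have strip: "\<exists>e>0. Q x e c d" if x: "x \<in> {a..b}" for x
    using le(2)
  proof (induction rule: Bolzano)
    case (trans c1 c2 c3)
    then obtain e where e: "e > 0" "Q x e c1 c2" "Q x e c2 c3"
      by (metis Q_mono min.cobounded1 min.cobounded2 min_less_iff_conj)
    show ?case
    proof (cases "c2 \<in> {c..d}")
      case True
      have "trivial_over E p F\<^sub>0 u ((({x-e..x+e} \<inter> {a..b}) \<times> ({c1..c2} \<inter> {c..d})) \<union>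
              (({x-e..x+e} \<inter> {a..b}) \<times> ({c2..c3} \<inter> {c..d})))"
        by (rule trivial_over_Un [where r = "\<lambda>z. (fst z, c2)"])
          (use e True trans p in \<open>auto simp: Q_def intro!: continuous_intros closed_Times closed_Int\<close>)
      then have "Q x e c1 c3"
        unfolding Q_def by (rule trivial_over_subset) auto
      then show ?thesis using e by blast
    next
      case False
      then have "{c1..c3} \<inter> {c..d} = {c1..c2} \<inter> {c..d} \<or> {c1..c3} \<inter> {c..d} = {c2..c3} \<inter> {c..d}"
        using trans by auto
      then show ?thesis using e unfolding Q_def by metis
    qed
  next
    case (local y)
    have "(x, y) \<in> ?R" using x local by auto
    then obtain N where N: "open N" "(x, y) \<in> N" "trivial_over E p F\<^sub>0 u (?R \<inter> N)"
      using fibre_bundle_locally_trivial [OF fb u] by blast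
    obtain A A' where A: "open A" "open A'" "x \<in> A" "y \<in> A'" "A \<times> A' \<subseteq> N"
      using N(1,2) by (rule open_prod_elim) auto
    obtain e e' where e: "e > 0" "cball x e \<subseteq> A" "e' > 0" "cball y e' \<subseteq> A'"
      using A by (meson open_contains_cball)
    have "Q x e c' d'" if "c' \<le> y" "y \<le> d'" "d' - c' < e'" for c' d'
      unfolding Q_def
    proof (rule trivial_over_subset [OF N(3)])
      have "{x-e..x+e} \<subseteq> A" "{c'..d'} \<subseteq> A'"
        using e that by (auto simp: subset_iff dist_real_def)
      then show "({x-e..x+e} \<inter> {a..b}) \<times> ({c'..d'} \<inter> {c..d}) \<subseteq> ?R \<inter> N"
        using A(5) by blast
    qed
    then show ?case using e by blast
  qed
  define Q' where "Q' s t \<longleftrightarrow> trivial_over E p F\<^sub>0 u (({s..t} \<inter> {a..b}) \<times> {c..d})" for s t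
  have "Q' a b"
    using le(1)
  proof (induction rule: Bolzano)
    case (trans c1 c2 c3)
    show ?case
    proof (cases "c2 \<in> {a..b}")
      case True
      have "trivial_over E p F\<^sub>0 u ((({c1..c2} \<inter> {a..b}) \<times> {c..d}) \<union> (({c2..c3} \<inter> {a..b}) \<times> {c..d}))"
        by (rule trivial_over_Un [where r = "\<lambda>z. (c2, snd z)"])
          (use True trans p in \<open>auto simp: Q'_def intro!: continuous_intros closed_Times closed_Int\<close>)
      then show ?thesis
        unfolding Q'_def by (rule trivial_over_subset) auto
    next
      case False
      then have "{c1..c3} \<inter> {a..b} = {c1..c2} \<inter> {a..b} \<or> {c1..c3} \<inter> {a..b} = {c2..c3} \<inter> {a..b}"
        using trans by auto
      then show ?thesis using trans unfolding Q'_def by metis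
    qed
  next
    case (local x)
    then obtain e where e: "e > 0" "Q x e c d" using strip [of x] by auto
    show ?case
    proof (intro exI conjI allI impI)
      fix a' b' assume "a' \<le> x \<and> x \<le> b' \<and> b' - a' < e"
      then show "Q' a' b'"
        using e(2) unfolding Q_def Q'_def by (elim trivial_over_subset) auto
    qed (use e in auto)
  qed
  then show ?thesis by (simp add: Q'_def)
qed

text \<open>The nearest point map retracts a square onto the nonempty compact convex set, so
  \<open>u\<close> extends to the square and the trivialisation found there is restricted.\<close>

lemma fibre_bundle_trivial_over_convex:
  fixes u :: "complex \<Rightarrow> 'b::topological_space"
  assumes fb: "fibre_bundle E p B F\<^sub>0" and S: "convex S" "compact S"
    and u: "continuous_on S u" "u ` S \<subseteq> B"
  shows "trivial_over E p F\<^sub>0 u S"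
proof (cases "S = {}")
  case True
  then have "trivialisation E p F\<^sub>0 u S (\<lambda>_. undefined) (\<lambda>_. undefined)"
    by (auto simp: trivialisation_def)
  then show ?thesis by (auto simp: trivial_over_def)
next
  case False
  obtain K where K: "\<And>z. z \<in> S \<Longrightarrow> norm z \<le> K"
    using S(2) by (meson bounded_iff compact_imp_bounded)
  then have "K \<ge> 0" using False by (meson ex_in_conv norm_ge_zero order_trans)
  define r where "r z = closest_point S (Complex (fst z) (snd z))" for z
  have r: "continuous_on UNIV r" unfolding r_def
    by (intro continuous_on_compose2 [OF continuous_on_closest_point [of S UNIV]] S False)
      (use S in \<open>auto intro!: continuous_intros simp: compact_imp_closed Complex_eq\<close>)
  have rS: "r z \<in> S" for z
    unfolding r_def using S(2) False by (simp add: closest_point_in_set compact_imp_closed)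
  have "trivial_over E p F\<^sub>0 (u \<circ> r) ({-K..K} \<times> {-K..K})"
    by (intro fibre_bundle_trivial_over_rectangle [OF fb] continuous_on_compose2 [OF u(1)] continuous_on_compose)
      (use r rS u \<open>K \<ge> 0\<close> in \<open>auto intro: continuous_on_subset\<close>)
  then show ?thesis
  proof (rule trivial_over_compose [where f = "\<lambda>z. (Re z, Im z)"])
    show "(\<lambda>z. (Re z, Im z)) ` S \<subseteq> {-K..K} \<times> {-K..K}"
      using order_trans [OF abs_Re_le_cmod K] order_trans [OF abs_Im_le_cmod K]
      by (force simp: abs_le_iff)
    show "u z = (u \<circ> r) (Re z, Im z)" if "z \<in> S" for z
      using that by (simp add: r_def closest_point_self)
  qed (auto intro!: continuous_intros)
qed

section \<open>Path algebra up to homotopy\<close>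

definition path_in :: "'a::topological_space set \<Rightarrow> (real \<Rightarrow> 'a) \<Rightarrow> bool" where
  "path_in X q \<longleftrightarrow> path q \<and> path_image q \<subseteq> X"

lemma path_in_alt: "path_in X q \<longleftrightarrow> continuous_on {0..1} q \<and> (\<forall>t\<in>{0..1}. q t \<in> X)"
  by (auto simp: path_in_def path_def path_image_def)

lemma path_in_join [simp]:
  "\<lbrakk>path_in X a; path_in X b; pathfinish a = pathstart b\<rbrakk> \<Longrightarrow> path_in X (a +++ b)"
  by (auto simp: path_in_def path_image_join)

lemma path_in_reversepath [simp]: "path_in X (reversepath a) \<longleftrightarrow> path_in X a"
  by (auto simp: path_in_def)

lemma path_in_const [simp]: "path_in X (\<lambda>_. x) \<longleftrightarrow> x \<in> X"
  by (auto simp: path_in_alt)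

lemma path_const_ends [simp]: "pathstart (\<lambda>_. x) = x" "pathfinish (\<lambda>_. x) = x"
  by (auto simp: pathstart_def pathfinish_def)

lemma path_in_ends: "path_in X q \<Longrightarrow> pathstart q \<in> X" "path_in X q \<Longrightarrow> pathfinish q \<in> X"
  by (auto simp: path_in_alt pathstart_def pathfinish_def)

lemma path_in_compose: "\<lbrakk>path_in X q; continuous_on X f; f ` X \<subseteq> Y\<rbrakk> \<Longrightarrow> path_in Y (f \<circ> q)"
  unfolding path_in_alt by (auto intro!: continuous_on_compose2 [of X f] simp: comp_def)

lemma path_in_mono: "\<lbrakk>path_in X q; X \<subseteq> Y\<rbrakk> \<Longrightarrow> path_in Y q"
  by (auto simp: path_in_def)

lemma homotopic_imp_path_in: "homotopic_paths X a b \<Longrightarrow> path_in X a \<and> path_in X b"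
  by (metis homotopic_paths_imp_path homotopic_paths_imp_subset path_in_def)

lemma loops_at_iff: "g \<in> loops_at X x \<longleftrightarrow> path_in X g \<and> pathstart g = x \<and> pathfinish g = x"
  by (auto simp: loops_at_def path_in_def)

lemma homotopic_paths_pointwise_eq:
  "\<lbrakk>path_in X a; \<And>t. t \<in> {0..1} \<Longrightarrow> a t = b t\<rbrakk> \<Longrightarrow> homotopic_paths X a b"
  by (rule homotopic_paths_eq) (auto simp: path_in_def)

lemma homotopic_paths_const_join:
  assumes "path_in X q" "x = pathstart q"
  shows "homotopic_paths X ((\<lambda>_. x) +++ q) q"
proof (rule homotopic_paths_sym, rule homotopic_paths_reparametrize
    [where f = "\<lambda>t. if t \<le> 1/2 then 0 else 2 * t - 1"])
  show "continuous_on {0..1} (\<lambda>t::real. if t \<le> 1/2 then 0 else 2 * t - 1)"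
    unfolding split_01
    by (rule continuous_on_cases continuous_intros | force)+
qed (use assms in \<open>auto simp: path_in_def joinpaths_def pathstart_def pathfinish_def\<close>)

lemma homotopic_paths_join_reversepath:
  assumes "path_in X q"
  shows "homotopic_paths X (q +++ reversepath q) (\<lambda>_. pathstart q)"
proof -
  have cont: "continuous_on {0..1} q" and im: "q ` {0..1} \<subseteq> X"
    using assms by (auto simp: path_in_def path_def path_image_def)
  \<comment> \<open>At stage \<open>fst z\<close> the path follows \<open>q\<close> up to that
    parameter, waits there and returns; the tent \<open>1 - \<bar>2 * t - 1\<bar>\<close> describes
    the full round trip.\<close>
  let ?u = "\<lambda>z::real\<times>real. min (fst z) (1 - \<bar>2 * snd z - 1\<bar>)"
  have rng: "?u z \<in> {0..1}" if "z \<in> {0..1} \<times> {0..1}" for z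
    using that by (auto simp: min_def abs_if)
  have cu: "continuous_on ({0..1} \<times> {0..1}) (\<lambda>z. q (?u z))"
    by (rule continuous_on_compose2 [OF cont]) (use rng in \<open>auto intro!: continuous_intros\<close>)
  have "homotopic_paths X (\<lambda>_. pathstart q) (q +++ reversepath q)"
    unfolding homotopic_paths
    by (rule exI [where x = "\<lambda>z. q (?u z)"])
      (use cu rng im in \<open>auto simp: image_subset_iff joinpaths_def reversepath_def
         pathstart_def pathfinish_def abs_if min_def algebra_simps\<close>)
  then show ?thesis by (rule homotopic_paths_sym)
qed

text \<open>Composition of relations is totally defined and associative, which turns identities between
  concatenations of paths up to homotopy into rewriting.\<close>

definition hrel :: "'a::topological_space set \<Rightarrow> (real \<Rightarrow> 'a) \<Rightarrow> ((real \<Rightarrow> 'a) \<times> (real \<Rightarrow> 'a)) set" where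
  "hrel X q = {(r, s). path_in X r \<and> pathfinish r = pathstart q \<and> homotopic_paths X (r +++ q) s}"

lemma hrel_join:
  assumes "path_in X a" "path_in X b" "pathfinish a = pathstart b"
  shows "hrel X (a +++ b) = hrel X a O hrel X b"
proof (rule equalityI; rule subsetI)
  have *: "homotopic_paths X (r +++ (a +++ b)) ((r +++ a) +++ b)"
    if "path_in X r" "pathfinish r = pathstart a" for r
    using that assms unfolding path_in_def by (intro homotopic_paths_assoc) auto
  fix z
  { assume "z \<in> hrel X (a +++ b)"
    then obtain r s where z: "z = (r, s)" and r: "path_in X r" "pathfinish r = pathstart a"
      "homotopic_paths X (r +++ (a +++ b)) s"
      by (auto simp: hrel_def)
    then have "homotopic_paths X ((r +++ a) +++ b) s"
      using * by (meson homotopic_paths_sym homotopic_paths_trans)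
    moreover have "path_in X (r +++ a)" using r assms by simp
    ultimately have "(r, r +++ a) \<in> hrel X a" "(r +++ a, s) \<in> hrel X b"
      using r assms by (auto simp: hrel_def path_in_def)
    then show "z \<in> hrel X a O hrel X b" using z by auto }
  { assume "z \<in> hrel X a O hrel X b"
    then obtain r s t where z: "z = (r, s)" "path_in X r" "pathfinish r = pathstart a"
      "homotopic_paths X (r +++ a) t" "homotopic_paths X (t +++ b) s"
      by (auto simp: hrel_def)
    have "homotopic_paths X ((r +++ a) +++ b) (t +++ b)"
      using z assms by (intro homotopic_paths_join) (auto simp: path_in_def)
    then have "homotopic_paths X (r +++ (a +++ b)) s"
      using * z by (meson homotopic_paths_trans)
    then show "z \<in> hrel X (a +++ b)" using z by (auto simp: hrel_def) }
qed

lemma hrel_cong: "homotopic_paths X a b \<Longrightarrow> hrel X a = hrel X b"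
proof -
  have "hrel X a \<subseteq> hrel X b" if ab: "homotopic_paths X a b" for a b
  proof clarify
    fix r s assume "(r, s) \<in> hrel X a"
    then have r: "path_in X r" "pathfinish r = pathstart a" "homotopic_paths X (r +++ a) s"
      by (auto simp: hrel_def)
    have "homotopic_paths X (r +++ b) (r +++ a)"
      using r ab homotopic_paths_imp_pathstart [OF ab]
      by (intro homotopic_paths_join) (auto simp: path_in_def homotopic_paths_sym)
    then show "(r, s) \<in> hrel X b"
      using r homotopic_paths_imp_pathstart [OF ab] homotopic_paths_trans by (force simp: hrel_def)
  qed
  then show "homotopic_paths X a b \<Longrightarrow> hrel X a = hrel X b"
    using homotopic_paths_sym by blast
qed

text \<open>Applied to the constant path at the starting point, the relation returns the homotopy
  class, so passing to relations loses nothing.\<close>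

lemma homotopic_paths_hrel_iff:
  assumes "path_in X a" "path_in X b"
  shows "homotopic_paths X a b \<longleftrightarrow> hrel X a = hrel X b"
proof
  assume eq: "hrel X a = hrel X b"
  have "((\<lambda>_. pathstart a), a) \<in> hrel X a"
    using assms path_in_ends by (auto simp: hrel_def homotopic_paths_const_join)
  then have "pathstart b = pathstart a" "homotopic_paths X ((\<lambda>_. pathstart a) +++ b) a"
    unfolding eq by (auto simp: hrel_def)
  then show "homotopic_paths X a b"
    using homotopic_paths_const_join [OF assms(2)] by (metis homotopic_paths_sym homotopic_paths_trans)
qed (rule hrel_cong)

lemma hrel_const_left:
  assumes "path_in X q" "x = pathstart q"
  shows "hrel X (\<lambda>_. x) O hrel X q = hrel X q"
  using hrel_cong [OF homotopic_paths_const_join [OF assms]] assms path_in_ends(1) [OF assms(1)]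
  by (simp add: hrel_join)

lemma hrel_rinv:
  assumes "path_in X q"
  shows "hrel X q O hrel X (reversepath q) = hrel X (\<lambda>_. pathstart q)"
  using hrel_cong [OF homotopic_paths_join_reversepath [OF assms]] assms
  by (simp add: hrel_join)

lemma hrel_linv:
  assumes "path_in X q"
  shows "hrel X (reversepath q) O hrel X q = hrel X (\<lambda>_. pathfinish q)"
  using hrel_rinv [of X "reversepath q"] assms by simp

lemma hrel_const_right:
  assumes "path_in X q" "x = pathfinish q"
  shows "hrel X q O hrel X (\<lambda>_. x) = hrel X q"
  using hrel_rinv [OF assms(1)] hrel_linv [OF assms(1)] hrel_const_left [OF assms(1)] assms(2)
  by (metis O_assoc)

text \<open>The cancellations inside a longer composite. Compositions are nested to the right, so a
  factor and its inverse stand side by side with a remainder \<open>Z\<close> behind them; together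
  with the plain rules this gives a normal form in the fundamental groupoid.\<close>

lemma hrel_assoc_simps:
  "\<lbrakk>path_in X q; x = pathstart q\<rbrakk> \<Longrightarrow> hrel X (\<lambda>_. x) O (hrel X q O Z) = hrel X q O Z"
  "\<lbrakk>path_in X q; x = pathfinish q\<rbrakk> \<Longrightarrow> hrel X q O (hrel X (\<lambda>_. x) O Z) = hrel X q O Z"
  "path_in X q \<Longrightarrow> hrel X q O (hrel X (reversepath q) O Z) = hrel X (\<lambda>_. pathstart q) O Z"
  "path_in X q \<Longrightarrow> hrel X (reversepath q) O (hrel X q O Z) = hrel X (\<lambda>_. pathfinish q) O Z"
  by (simp_all add: hrel_const_left hrel_const_right hrel_rinv hrel_linv flip: O_assoc)

lemmas hrel_simps = hrel_join hrel_const_left hrel_const_right hrel_rinv hrel_linv O_assoc hrel_assoc_simps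
  reversepath_joinpaths

lemma homotopic_const_conjugate:
  assumes "path_in X a" "path_in X q" "pathfinish a = pathstart q" "pathfinish q = pathstart q"
  shows "homotopic_paths X ((a +++ q) +++ reversepath a) (\<lambda>_. pathstart a) \<longleftrightarrow>
         homotopic_paths X q (\<lambda>_. pathstart q)"
proof -
  note e = path_in_ends [OF assms(1)] path_in_ends [OF assms(2)]
  have 1: "hrel X q = hrel X (reversepath a) O hrel X ((a +++ q) +++ reversepath a) O hrel X a"
    using assms e by (simp add: hrel_simps)
  have 2: "hrel X ((a +++ q) +++ reversepath a) = hrel X a O hrel X q O hrel X (reversepath a)"
    using assms e by (simp add: hrel_simps)
  have "hrel X ((a +++ q) +++ reversepath a) = hrel X (\<lambda>_. pathstart a) \<longleftrightarrow>
      hrel X q = hrel X (\<lambda>_. pathstart q)"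
  proof
    assume "hrel X ((a +++ q) +++ reversepath a) = hrel X (\<lambda>_. pathstart a)"
    with 1 show "hrel X q = hrel X (\<lambda>_. pathstart q)" using assms e by (simp add: hrel_simps)
  next
    assume "hrel X q = hrel X (\<lambda>_. pathstart q)"
    with 2 show "hrel X ((a +++ q) +++ reversepath a) = hrel X (\<lambda>_. pathstart a)"
      using assms e by (simp add: hrel_simps)
  qed
  then show ?thesis
    using assms e by (simp add: homotopic_paths_hrel_iff)
qed

text \<open>Paths in a convex set with common ends are linearly homotopic, and \<open>G\<close>
  carries the homotopy into \<open>X\<close>.\<close>

lemma homotopic_paths_convex_image:
  fixes q q' :: "real \<Rightarrow> 'c::real_normed_vector"
  assumes C: "convex C" and q: "path_in C q" "path_in C q'"
    and ends: "pathstart q = pathstart q'" "pathfinish q = pathfinish q'"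
    and G: "continuous_on C G" "G ` C \<subseteq> X"
  shows "homotopic_paths X (G \<circ> q) (G \<circ> q')"
proof (rule homotopic_paths_continuous_image)
  show "homotopic_paths C q q'"
    using q ends C by (intro homotopic_paths_linear)
      (auto simp: path_in_def path_image_def convex_contains_segment image_subset_iff)
qed (use G in auto)

lemma square_homotopy:
  fixes G :: "real \<times> real \<Rightarrow> 'a::topological_space"
  assumes G: "continuous_on ({0..1} \<times> {0..1}) G" "G ` ({0..1} \<times> {0..1}) \<subseteq> X"
  shows "homotopic_paths X ((\<lambda>t. G (t, 0)) +++ (\<lambda>t. G (1, t))) ((\<lambda>t. G (0, t)) +++ (\<lambda>t. G (t, 1)))"
    and "homotopic_paths X ((\<lambda>t. G (t, 0)) +++ (\<lambda>t. G (1, t))) (\<lambda>t. G (t, t))"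
proof -
  let ?C = "{0..1::real} \<times> {0..1::real}"
  have C: "convex ?C" by (intro convex_Times) auto
  let ?b = "\<lambda>t::real. (t, 0::real)" and ?r = "\<lambda>t::real. (1::real, t)"
  let ?l = "\<lambda>t::real. (0::real, t)" and ?t = "\<lambda>t::real. (t, 1::real)" and ?d = "\<lambda>t::real. (t, t)"
  have p: "path_in ?C ?b" "path_in ?C ?r" "path_in ?C ?l" "path_in ?C ?t" "path_in ?C ?d"
    by (auto simp: path_in_alt intro!: continuous_intros)
  have e: "pathfinish ?b = pathstart ?r" "pathfinish ?l = pathstart ?t"
    by (auto simp: pathstart_def pathfinish_def)
  have pj: "path_in ?C (?b +++ ?r)" "path_in ?C (?l +++ ?t)"
    using p e by (metis path_in_join)+
  have "homotopic_paths X (G \<circ> (?b +++ ?r)) (G \<circ> (?l +++ ?t))"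
    by (rule homotopic_paths_convex_image [OF C pj _ _ G]) (simp_all add: pathstart_def pathfinish_def joinpaths_def)
  moreover have "homotopic_paths X (G \<circ> (?b +++ ?r)) (G \<circ> ?d)"
    by (rule homotopic_paths_convex_image [OF C pj(1) p(5) _ _ G]) (simp_all add: pathstart_def pathfinish_def joinpaths_def)
  ultimately show "homotopic_paths X ((\<lambda>t. G (t, 0)) +++ (\<lambda>t. G (1, t))) ((\<lambda>t. G (0, t)) +++ (\<lambda>t. G (t, 1)))"
    and "homotopic_paths X ((\<lambda>t. G (t, 0)) +++ (\<lambda>t. G (1, t))) (\<lambda>t. G (t, t))"
    unfolding path_compose_join by (simp_all add: comp_def)
qed

section \<open>Lifting paths and homotopies\<close>

lemma trivialisationD:
  assumes "trivialisation E p F\<^sub>0 u S T T'"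
  shows "continuous_on (S \<times> F\<^sub>0) T"
    and "continuous_on {z. fst z \<in> S \<and> snd z \<in> E \<and> p (snd z) = u (fst z)} T'"
    and "\<And>c y. \<lbrakk>c \<in> S; y \<in> F\<^sub>0\<rbrakk> \<Longrightarrow> T (c, y) \<in> E"
    and "\<And>c y. \<lbrakk>c \<in> S; y \<in> F\<^sub>0\<rbrakk> \<Longrightarrow> p (T (c, y)) = u c"
    and "\<And>c y. \<lbrakk>c \<in> S; y \<in> F\<^sub>0\<rbrakk> \<Longrightarrow> T' (c, T (c, y)) = y"
    and "\<And>c x. \<lbrakk>c \<in> S; x \<in> E; p x = u c\<rbrakk> \<Longrightarrow> T' (c, x) \<in> F\<^sub>0"
    and "\<And>c x. \<lbrakk>c \<in> S; x \<in> E; p x = u c\<rbrakk> \<Longrightarrow> T (c, T' (c, x)) = x"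
  using assms unfolding trivialisation_def by blast+

lemma trivialisation_continuous:
  assumes T: "trivialisation E p F\<^sub>0 u S T T'"
    and f: "continuous_on A f" "\<And>a. a \<in> A \<Longrightarrow> f a \<in> S"
    and g: "continuous_on A g"
  shows "(\<And>a. a \<in> A \<Longrightarrow> g a \<in> F\<^sub>0) \<Longrightarrow> continuous_on A (\<lambda>a. T (f a, g a))"
  using f g by (intro continuous_on_compose2 [OF trivialisationD(1) [OF T]] continuous_intros) auto

lemma trivialisation_continuous':
  assumes T: "trivialisation E p F\<^sub>0 u S T T'"
    and f: "continuous_on A f" "\<And>a. a \<in> A \<Longrightarrow> f a \<in> S"
    and g: "continuous_on A g"
  shows "(\<And>a. a \<in> A \<Longrightarrow> g a \<in> E) \<Longrightarrow> (\<And>a. a \<in> A \<Longrightarrow> p (g a) = u (f a)) \<Longrightarrow>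
    continuous_on A (\<lambda>a. T' (f a, g a))"
  using f g by (intro continuous_on_compose2 [OF trivialisationD(2) [OF T]] continuous_intros) auto

text \<open>In the coordinates of a trivialisation a lift over \<open>J\<close> is just a map into
  the fibre, and such a map extends by composition with the retraction.\<close>

lemma trivial_over_lift_extension:
  assumes triv: "trivial_over E p F\<^sub>0 u S"
    and r: "continuous_on S r" "r ` S \<subseteq> J" "\<And>z. z \<in> J \<Longrightarrow> r z = z" and J: "J \<subseteq> S"
    and g: "continuous_on J g" "\<And>z. z \<in> J \<Longrightarrow> g z \<in> E \<and> p (g z) = u z"
  obtains G where "continuous_on S G" "\<And>z. z \<in> S \<Longrightarrow> G z \<in> E \<and> p (G z) = u z"
    "\<And>z. z \<in> J \<Longrightarrow> G z = g z"
proof -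
  obtain T T' where T: "trivialisation E p F\<^sub>0 u S T T'"
    using triv by (auto simp: trivial_over_def)
  note TD = trivialisationD [OF T]
  have rJ: "r z \<in> J" "r z \<in> S" if "z \<in> S" for z using r J that by auto
  have F: "T' (r z, g (r z)) \<in> F\<^sub>0" if "z \<in> S" for z
    using TD(6) [of "r z" "g (r z)"] g(2) [of "r z"] rJ [OF that] by auto
  have "continuous_on S (\<lambda>z. g (r z))"
    by (rule continuous_on_compose2 [OF g(1) r(1) r(2)])
  then have "continuous_on S (\<lambda>z. T' (r z, g (r z)))"
    using r rJ g(2) by (intro trivialisation_continuous' [OF T]) auto
  then have "continuous_on S (\<lambda>z. T (z, T' (r z, g (r z))))"
    using F by (intro trivialisation_continuous [OF T] continuous_intros) auto
  then show ?thesis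
  proof (rule that)
    show "T (z, T' (r z, g (r z))) \<in> E \<and> p (T (z, T' (r z, g (r z)))) = u z" if "z \<in> S" for z
      using TD F that by blast
    show "T (z, T' (r z, g (r z))) = g z" if "z \<in> J" for z
      using TD(7) [of z "g z"] g(2) [OF that] r(3) [OF that] J that by auto
  qed
qed

lemma trivial_over_path:
  assumes fb: "fibre_bundle E p B F\<^sub>0" and c: "path_in B c"
  shows "trivial_over E p F\<^sub>0 c {0..1}"
proof -
  \<comment> \<open>A dummy second coordinate turns the path into a map on a square.\<close>
  have "trivial_over E p F\<^sub>0 (c \<circ> fst) ({0..1} \<times> {0..1::real})"
    using c by (intro fibre_bundle_trivial_over_rectangle [OF fb])
      (auto simp: path_in_alt comp_def intro!: continuous_on_compose2 [of "{0..1}" c] continuous_intros)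
  then show ?thesis
    by (rule trivial_over_compose [where f = "\<lambda>t. (t, 0)"]) (auto intro!: continuous_intros)
qed

lemma path_lifting:
  assumes fb: "fibre_bundle E p B F\<^sub>0" and c: "path_in B c" and e: "e \<in> E" "p e = pathstart c"
  obtains g where "path_in E g" "pathstart g = e" "\<And>t. t \<in> {0..1} \<Longrightarrow> p (g t) = c t"
proof (rule trivial_over_lift_extension [OF trivial_over_path [OF fb c],
      where r = "\<lambda>_. 0" and J = "{0}" and g = "\<lambda>_. e"])
  fix G assume "continuous_on {0..1} G" "\<And>z. z \<in> {0..1} \<Longrightarrow> G z \<in> E \<and> p (G z) = c z"
    "\<And>z. z \<in> {0} \<Longrightarrow> G z = e"
  then show ?thesis by (intro that [of G]) (auto simp: path_in_alt pathstart_def)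
qed (use e in \<open>auto simp: pathstart_def\<close>)

text \<open>The lift of the homotopy is prescribed on the initial edge by \<open>\<eta>\<close> and
  on the two edges of fixed end points by constants, then extended over the square by retracting it
  onto these three sides. The remaining edge is \<open>\<omega>\<close>.\<close>

lemma homotopic_paths_lifting:
  assumes fb: "fibre_bundle E p B F\<^sub>0" and \<eta>: "path_in E \<eta>" and hom: "homotopic_paths B (p \<circ> \<eta>) c"
  obtains \<omega> where "homotopic_paths E \<eta> \<omega>" "\<And>t. t \<in> {0..1} \<Longrightarrow> p (\<omega> t) = c t"
proof -
  let ?S = "{0..1::real} \<times> {0..1::real}"
  obtain h where h: "continuous_on ?S h" "h \<in> ?S \<rightarrow> B"
    and h01: "\<And>t. t \<in> {0..1} \<Longrightarrow> h (0, t) = p (\<eta> t)" "\<And>t. t \<in> {0..1} \<Longrightarrow> h (1, t) = c t"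
    and hends: "\<And>t. t \<in> {0..1} \<Longrightarrow> h (t, 0) = p (\<eta> 0) \<and> h (t, 1) = p (\<eta> 1)"
    using hom unfolding homotopic_paths by (auto simp: pathstart_def pathfinish_def)
  have triv: "trivial_over E p F\<^sub>0 h ?S"
    using h by (intro fibre_bundle_trivial_over_rectangle [OF fb]) auto
  define J where "J = {z \<in> ?S. fst z = 0 \<or> snd z = 0 \<or> snd z = 1}"
  \<comment> \<open>projection from the point (2, 1/2) onto three sides of the square\<close>
  define k where "k z = max \<bar>2 * snd z - 1\<bar> (1 - fst z / 2)" for z :: "real \<times> real"
  define r where "r z = (2 - (2 - fst z) / k z, ((2 * snd z - 1) / k z + 1) / 2)" for z
  \<comment> \<open>With the coordinates \<open>A = 2 - fst z\<close> and
    \<open>C = 2 * snd z - 1\<close> centred at the projection point, \<open>k\<close> is the gauge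
    \<open>max \<bar>C\<bar> (A / 2)\<close>, which equals 1 on \<open>J\<close>. Dividing
    \<open>A\<close> and \<open>C\<close> by \<open>k\<close> is therefore the radial projection;
    \<open>k \<le> A\<close> keeps the result inside the square.\<close>
  have J_I: "(2 - A, (C + 1) / 2) \<in> J"
    if "\<bar>C\<bar> \<le> 1" "A \<le> 2" "1 \<le> A" "A = 2 \<or> C = 1 \<or> C = -1" for A C :: real
    using that by (auto simp: J_def)
  have k: "k z \<ge> 1/2" "\<bar>2 * snd z - 1\<bar> \<le> k z" "2 - fst z \<le> 2 * k z" "k z \<le> 2 - fst z" 
    and k': "k z = \<bar>2 * snd z - 1\<bar> \<or> 2 * k z = 2 - fst z" if "z \<in> ?S" for z
    using that by (auto simp: k_def max_def abs_if split: if_splits)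
  have "\<bar>(2 * snd z - 1) / k z\<bar> \<le> 1" "(2 - fst z) / k z \<le> 2" "1 \<le> (2 - fst z) / k z" if "z \<in> ?S" for z
    using k [OF that] by (auto simp: field_simps abs_le_iff)
  moreover have "(2 - fst z) / k z = 2 \<or> (2 * snd z - 1) / k z = 1 \<or> (2 * snd z - 1) / k z = -1" if "z \<in> ?S" for z
    using k' [OF that] k(1) [OF that] by (auto simp: field_simps abs_if split: if_splits)
  ultimately have rJ: "r z \<in> J" if "z \<in> ?S" for z
    using J_I that unfolding r_def by blast
  have rid: "r z = z" if "z \<in> J" for z
  proof -
    have "k z = 1" using that by (auto simp: J_def k_def)
    then show ?thesis by (simp add: r_def prod_eq_iff)
  qed
  have "continuous_on ?S k" unfolding k_def by (intro continuous_intros) auto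
  then have cr: "continuous_on ?S r" unfolding r_def
    by (intro continuous_intros) (use k(1) in force)+
  have c\<eta>: "continuous_on J (\<lambda>z. \<eta> (snd z))"
    by (rule continuous_on_compose2 [of "{0..1}" \<eta>]) (use \<eta> in \<open>auto simp: path_in_alt J_def intro!: continuous_intros\<close>)
  show thesis
  proof (rule trivial_over_lift_extension [OF triv cr _ rid _ c\<eta>])
    show "r ` ?S \<subseteq> J" using rJ by auto
    show "J \<subseteq> ?S" by (auto simp: J_def)
    show "\<eta> (snd z) \<in> E \<and> p (\<eta> (snd z)) = h z" if "z \<in> J" for z
      using that \<eta> h01 hends by (cases z) (auto simp: J_def path_in_alt)
    fix G assume G: "continuous_on ?S G" "\<And>z. z \<in> ?S \<Longrightarrow> G z \<in> E \<and> p (G z) = h z"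
      "\<And>z. z \<in> J \<Longrightarrow> G z = \<eta> (snd z)"
    show thesis
    proof (rule that)
      show "homotopic_paths E \<eta> (\<lambda>t. G (1, t))"
        unfolding homotopic_paths
        by (rule exI [of _ G]) (use G in \<open>auto simp: J_def pathstart_def pathfinish_def\<close>)
      show "p (G (1, t)) = c t" if "t \<in> {0..1}" for t
        using G(2) [of "(1, t)"] h01 that by auto
    qed
  qed auto
qed

section \<open>Markings: lifting to the covering of the total space given by the splitting\<close>

text \<open>\<open>Sg\<close> is the set of loops whose class lies in the image of the splitting of \<open>\<pi>\<^sub>1\<close>. A marking of a
  point \<open>x\<close> is a path to \<open>x\<close>, considered modulo \<open>Sg\<close>; marked points are the points of the
  corresponding covering of \<open>E\<close>, whose fibres over \<open>B\<close> are path connected and simply connected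
  (\<open>transports_within_fibre\<close> and \<open>transports_loop_null\<close> below).\<close>

locale split_bundle =
  fixes E :: "'e::topological_space set" and p :: "'e \<Rightarrow> 'b::topological_space" and B :: "'b set"
    and F\<^sub>0 :: "'f::topological_space set" and e\<^sub>0 :: 'e and b\<^sub>0 :: 'b and Sg :: "(real \<Rightarrow> 'e) set"
  assumes fibration: "fibre_bundle E p B F\<^sub>0" and e\<^sub>0: "e\<^sub>0 \<in> E" "p e\<^sub>0 = b\<^sub>0" and b\<^sub>0: "b\<^sub>0 \<in> B"
    and Sg_loop: "g \<in> Sg \<Longrightarrow> path_in E g \<and> pathstart g = e\<^sub>0 \<and> pathfinish g = e\<^sub>0"
    and Sg_homotopic: "\<lbrakk>g \<in> Sg; homotopic_paths E g h\<rbrakk> \<Longrightarrow> h \<in> Sg"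
    and Sg_const: "(\<lambda>_. e\<^sub>0) \<in> Sg"
    and Sg_join: "\<lbrakk>g \<in> Sg; h \<in> Sg\<rbrakk> \<Longrightarrow> g +++ h \<in> Sg"
    and Sg_reversepath: "g \<in> Sg \<Longrightarrow> reversepath g \<in> Sg"
    and Sg_onto: "\<lbrakk>path_in B c; pathstart c = b\<^sub>0; pathfinish c = b\<^sub>0\<rbrakk> \<Longrightarrow>
        \<exists>g\<in>Sg. homotopic_paths B (p \<circ> g) c"
    and Sg_null: "\<lbrakk>g \<in> Sg; homotopic_paths B (p \<circ> g) (\<lambda>_. b\<^sub>0)\<rbrakk> \<Longrightarrow> homotopic_paths E g (\<lambda>_. e\<^sub>0)"
    and fibre_null: "\<lbrakk>path_in {x \<in> E. p x = b\<^sub>0} f; pathstart f = e\<^sub>0; pathfinish f = e\<^sub>0;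
        homotopic_paths E f (\<lambda>_. e\<^sub>0)\<rbrakk> \<Longrightarrow> homotopic_paths {x \<in> E. p x = b\<^sub>0} f (\<lambda>_. e\<^sub>0)"
begin

definition marking :: "(real \<Rightarrow> 'e) \<Rightarrow> 'e \<Rightarrow> bool" where
  "marking m x \<longleftrightarrow> path_in E m \<and> pathstart m = e\<^sub>0 \<and> pathfinish m = x"

text \<open>In terms of the covering: the lift of \<open>q\<close> that starts at the point
  represented by \<open>m\<close> ends at the point represented by \<open>m'\<close>.\<close>

definition transports :: "(real \<Rightarrow> 'e) \<Rightarrow> (real \<Rightarrow> 'e) \<Rightarrow> (real \<Rightarrow> 'e) \<Rightarrow> bool" where
  "transports m q m' \<longleftrightarrow> marking m (pathstart q) \<and> marking m' (pathfinish q) \<and> path_in E q \<and>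
     (m +++ q) +++ reversepath m' \<in> Sg"

section \<open>Calculus of transports: path lifting in the covering without the covering
  space\<close>

lemma continuous_p: "continuous_on E p" and p_in: "x \<in> E \<Longrightarrow> p x \<in> B"
  using fibration by (auto simp: fibre_bundle_def)

lemma path_in_p: "path_in E q \<Longrightarrow> path_in B (p \<circ> q)"
  using continuous_p p_in by (auto intro: path_in_compose)

lemma Sg_hrel: "\<lbrakk>g \<in> Sg; hrel E h = hrel E g; path_in E h\<rbrakk> \<Longrightarrow> h \<in> Sg"
  using Sg_homotopic [of g h] Sg_loop [of g] homotopic_paths_hrel_iff [of E g h] by simp

lemma marking_extend: "\<lbrakk>marking m (pathstart q); path_in E q\<rbrakk> \<Longrightarrow> marking (m +++ q) (pathfinish q)"
  by (auto simp: marking_def)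

lemma marking_in: "marking m x \<Longrightarrow> x \<in> E"
  using path_in_ends(2) by (force simp: marking_def)

lemma transports_homotopic:
  assumes "transports m q m'" "homotopic_paths E q q'"
  shows "transports m q' m'"
proof -
  have "path_in E q'" "pathstart q' = pathstart q" "pathfinish q' = pathfinish q"
    using assms(2) by (simp_all add: homotopic_imp_path_in homotopic_paths_imp_pathstart homotopic_paths_imp_pathfinish)
  moreover have "hrel E q = hrel E q'" using assms(2) by (rule hrel_cong)
  ultimately show ?thesis
    using assms(1) unfolding transports_def marking_def
    by (auto elim!: Sg_hrel simp: hrel_simps)
qed

lemma transports_refl: "marking m x \<Longrightarrow> transports m (\<lambda>_. x) m"
  unfolding transports_def
  using marking_in [of m x] e\<^sub>0 by (auto simp: marking_def hrel_simps intro!: Sg_hrel [OF Sg_const])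

lemma transports_extend:
  assumes "marking m (pathstart q)" "path_in E q"
  shows "transports m q (m +++ q)"
  using assms marking_extend [OF assms] e\<^sub>0 path_in_ends [OF assms(2)]
  by (auto simp: transports_def marking_def hrel_simps intro!: Sg_hrel [OF Sg_const])

lemma transports_initial: "marking m x \<Longrightarrow> transports (\<lambda>_. e\<^sub>0) m m"
  using e\<^sub>0 by (auto simp: transports_def marking_def hrel_simps intro!: Sg_hrel [OF Sg_const])

lemma transports_Sg: "g \<in> Sg \<Longrightarrow> transports (\<lambda>_. e\<^sub>0) g (\<lambda>_. e\<^sub>0)"
  using Sg_loop [of g] e\<^sub>0
  by (auto simp: transports_def marking_def hrel_simps reversepath_def [of "\<lambda>_. e\<^sub>0"] intro!: Sg_hrel [of g])

lemma transports_SgD: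
  assumes "transports (\<lambda>_. e\<^sub>0) g (\<lambda>_. e\<^sub>0)" shows "g \<in> Sg"
proof -
  have g: "path_in E g" "pathstart g = e\<^sub>0" "pathfinish g = e\<^sub>0"
    "((\<lambda>_. e\<^sub>0) +++ g) +++ reversepath (\<lambda>_. e\<^sub>0) \<in> Sg"
    using assms by (auto simp: transports_def marking_def)
  show ?thesis
    by (rule Sg_hrel [OF g(4)]) (use g e\<^sub>0 in \<open>simp_all add: hrel_simps reversepath_def [of "\<lambda>_. e\<^sub>0"]\<close>)
qed

lemma transports_join:
  assumes "transports m q m'" "transports m' q' m''"
  shows "transports m (q +++ q') m''"
proof -
  have "((m +++ q) +++ reversepath m') +++ ((m' +++ q') +++ reversepath m'') \<in> Sg"
    using assms by (auto simp: transports_def intro: Sg_join)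
  then show ?thesis
    using assms unfolding transports_def marking_def
    by (auto elim!: Sg_hrel simp: hrel_simps)
qed

lemma transports_reversepath:
  assumes "transports m q m'" shows "transports m' (reversepath q) m"
proof -
  have "reversepath ((m +++ q) +++ reversepath m') \<in> Sg"
    using assms by (auto simp: transports_def intro: Sg_reversepath)
  then show ?thesis
    using assms unfolding transports_def marking_def
    by (auto elim!: Sg_hrel simp: hrel_simps)
qed

lemma transports_cancel_left:
  assumes "transports m (q +++ q') m''" "transports m q m'" "pathfinish q = pathstart q'" "path_in E q'"
  shows "transports m' q' m''"
proof -
  have "transports m' (reversepath q +++ (q +++ q')) m''"
    using assms transports_join transports_reversepath by blast
  moreover have "homotopic_paths E (reversepath q +++ (q +++ q')) q'"
    using assms path_in_ends [of E q'] by (subst homotopic_paths_hrel_iff) (auto simp: transports_def hrel_simps)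
  ultimately show ?thesis by (rule transports_homotopic)
qed

lemma transports_cancel_right:
  assumes "transports m (q +++ q') m''" "transports m' q' m''" "pathfinish q = pathstart q'" "path_in E q"
  shows "transports m q m'"
proof -
  have "transports m ((q +++ q') +++ reversepath q') m'"
    using assms transports_join transports_reversepath by blast
  moreover have "homotopic_paths E ((q +++ q') +++ reversepath q') q"
    using assms path_in_ends [of E q] by (subst homotopic_paths_hrel_iff) (auto simp: transports_def hrel_simps)
  ultimately show ?thesis by (rule transports_homotopic)
qed

text \<open>Since the boundary of the square is null in \<open>E\<close>, three transports determine
  the fourth. This is how compatibility with markings is carried across a homotopy.\<close>

lemma transports_square:
  fixes G :: "real \<times> real \<Rightarrow> 'e"
  assumes G: "continuous_on ({0..1} \<times> {0..1}) G" "G ` ({0..1} \<times> {0..1}) \<subseteq> E"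
    and l: "transports m00 (\<lambda>t. G (0, t)) m01" and t: "transports m01 (\<lambda>t. G (t, 1)) m11"
    and r: "transports m10 (\<lambda>t. G (1, t)) m11"
  shows "transports m00 (\<lambda>t. G (t, 0)) m10"
proof (rule transports_cancel_right [OF _ r])
  have "homotopic_paths E ((\<lambda>t. G (0, t)) +++ (\<lambda>t. G (t, 1))) ((\<lambda>t. G (t, 0)) +++ (\<lambda>t. G (1, t)))"
    using square_homotopy(1) [OF G] by (rule homotopic_paths_sym)
  with transports_join [OF l t]
  show "transports m00 ((\<lambda>t. G (t, 0)) +++ (\<lambda>t. G (1, t))) m11"
    by (rule transports_homotopic)
  show "path_in E (\<lambda>t. G (t, 0))"
    using G by (auto simp: path_in_alt image_subset_iff intro!: continuous_on_compose2 [OF G(1)] continuous_intros)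
qed (simp add: pathstart_def pathfinish_def)

text \<open>The loop \<open>p \<circ> m\<close> followed by the reverse of
  \<open>p \<circ> m'\<close> is homotopic to the image of some \<open>g\<close> in
  \<open>Sg\<close>. Inserting \<open>g\<close> between the reverse of \<open>m\<close> and
  \<open>m'\<close> gives a path from \<open>x\<close> to \<open>y\<close> whose image is null, and
  lifting the null homotopy pushes that path into the fibre. Inserting a loop of \<open>Sg\<close>
  does not affect transport.\<close>

lemma transports_within_fibre:
  assumes m: "marking m x" and m': "marking m' y" and xy: "p x = p y"
  obtains \<omega> where "path_in {z \<in> E. p z = p x} \<omega>" "pathstart \<omega> = x" "pathfinish \<omega> = y" "transports m \<omega> m'"
proof -
  let ?c = "(p \<circ> m) +++ reversepath (p \<circ> m')"
  note M = m [unfolded marking_def] m' [unfolded marking_def]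
  have P: "path_in B (p \<circ> m)" "path_in B (p \<circ> m')" using M path_in_p by auto
  have ends: "pathstart (p \<circ> m) = b\<^sub>0" "pathstart (p \<circ> m') = b\<^sub>0" "pathfinish (p \<circ> m) = p y" "pathfinish (p \<circ> m') = p y"
    using M e\<^sub>0 xy by (auto simp: pathstart_compose pathfinish_compose)
  have "path_in B ?c" "pathstart ?c = b\<^sub>0" "pathfinish ?c = b\<^sub>0" using P ends by auto
  then obtain g where g: "g \<in> Sg" "homotopic_paths B (p \<circ> g) ?c" using Sg_onto by blast
  note gl = Sg_loop [OF g(1)]
  have "path_in B (p \<circ> g)" "pathstart (p \<circ> g) = b\<^sub>0" "pathfinish (p \<circ> g) = b\<^sub>0"
    using gl path_in_p e\<^sub>0 by (auto simp: pathstart_compose pathfinish_compose)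
  note P = this P
  have hg: "hrel B (p \<circ> g) = hrel B (p \<circ> m) O hrel B (reversepath (p \<circ> m'))"
    using hrel_cong [OF g(2)] P ends by (simp add: hrel_simps)
  let ?\<eta> = "reversepath m +++ (g +++ m')"
  have \<eta>: "path_in E ?\<eta>" "pathstart ?\<eta> = x" "pathfinish ?\<eta> = y" using M gl by auto
  have yB: "p y \<in> B" using marking_in [OF m'] p_in by simp
  have "homotopic_paths B (p \<circ> ?\<eta>) (\<lambda>_. p y)"
    unfolding path_compose_join path_compose_reversepath
    by (subst homotopic_paths_hrel_iff) (use P ends hg yB in \<open>simp_all add: hrel_simps\<close>)
  then obtain \<omega> where \<omega>: "homotopic_paths E ?\<eta> \<omega>" "\<And>t. t \<in> {0..1} \<Longrightarrow> p (\<omega> t) = p y"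
    using homotopic_paths_lifting [OF fibration \<eta>(1)] by metis
  have "transports m (reversepath m) (\<lambda>_. e\<^sub>0)"
    using transports_initial [OF m] by (rule transports_reversepath)
  moreover have "transports (\<lambda>_. e\<^sub>0) m' m'" using m' by (rule transports_initial)
  ultimately have "transports m ?\<eta> m'"
    using transports_join transports_Sg [OF g(1)] by blast
  then have "transports m \<omega> m'" using \<omega>(1) transports_homotopic by blast
  moreover have "path_in {z \<in> E. p z = p x} \<omega>"
    using \<omega>(2) homotopic_imp_path_in [OF \<omega>(1)] xy by (auto simp: path_in_alt)
  ultimately show ?thesis
    using that \<eta> homotopic_paths_imp_pathstart [OF \<omega>(1)] homotopic_paths_imp_pathfinish [OF \<omega>(1)] by simp
qed

text \<open>Conjugation by \<open>m\<close> turns \<open>\<omega>\<close> into a loop in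
  \<open>Sg\<close> with null image, so \<open>\<omega>\<close> is null in \<open>E\<close> by
  \<open>Sg_null\<close>. Injectivity is only available in the fibre over \<open>b\<^sub>0\<close>,
  so the loop is moved there along a trivialisation over \<open>p \<circ> m\<close>, contracted in
  that fibre, and moved back.\<close>

lemma transports_loop_null:
  assumes \<omega>: "path_in {z \<in> E. p z = b} \<omega>" and loop: "pathfinish \<omega> = pathstart \<omega>" and t: "transports m \<omega> m"
  shows "homotopic_paths {z \<in> E. p z = b} \<omega> (\<lambda>_. pathstart \<omega>)"
proof -
  define x where "x = pathstart \<omega>"
  have \<omega>E: "path_in E \<omega>" and x: "x \<in> E" "p x = b"
    using \<omega> path_in_ends(1) [OF \<omega>] by (auto simp: path_in_alt x_def)
  have m: "path_in E m" "pathstart m = e\<^sub>0" "pathfinish m = x"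
    using t by (auto simp: transports_def marking_def x_def)
  have l: "(m +++ \<omega>) +++ reversepath m \<in> Sg" using t by (simp add: transports_def)
  have "p \<circ> \<omega> \<in> {f. \<forall>t\<in>{0..1}. f t = b}" using \<omega> by (auto simp: path_in_alt)
  then have "homotopic_paths B (p \<circ> \<omega>) (\<lambda>_. b)"
    using path_in_p [OF \<omega>E] by (intro homotopic_paths_eq) (auto simp: path_in_def)
  then have "homotopic_paths B (((p \<circ> m) +++ (p \<circ> \<omega>)) +++ reversepath (p \<circ> m)) (\<lambda>_. pathstart (p \<circ> m))"
    using m \<omega>E loop x path_in_p
    by (subst homotopic_const_conjugate) (auto simp: pathstart_compose pathfinish_compose x_def)
  then have "homotopic_paths B (p \<circ> ((m +++ \<omega>) +++ reversepath m)) (\<lambda>_. b\<^sub>0)"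
    using m e\<^sub>0 by (simp add: path_compose_join path_compose_reversepath pathstart_compose)
  then have "homotopic_paths E ((m +++ \<omega>) +++ reversepath m) (\<lambda>_. pathstart m)"
    using Sg_null [OF l] m by simp
  then have \<omega>null: "homotopic_paths E \<omega> (\<lambda>_. x)"
    using m \<omega>E loop by (subst (asm) homotopic_const_conjugate) (auto simp: x_def)
  have c: "path_in B (p \<circ> m)" using m path_in_p by simp
  obtain T T' where T: "trivialisation E p F\<^sub>0 (p \<circ> m) {0..1} T T'"
    using trivial_over_path [OF fibration c] by (auto simp: trivial_over_def)
  note TD = trivialisationD [OF T] and Tc = trivialisation_continuous [OF T] and Tc' = trivialisation_continuous' [OF T]
  have m01: "m 0 = e\<^sub>0" "m 1 = x" "\<omega> 0 = x" "\<omega> 1 = x"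
    using m loop by (auto simp: pathstart_def pathfinish_def x_def)
  have mE: "m t \<in> E" and \<omega>t: "\<omega> t \<in> E" "p (\<omega> t) = b" if "t \<in> {0..1}" for t
    using m \<omega> that by (auto simp: path_in_alt)
  \<comment> \<open>The fibre coordinate of the marking joins the coordinate of
    \<open>e\<^sub>0\<close> to the starting point of \<open>w\<close>; it is needed because the
    moved loop need not pass through \<open>e\<^sub>0\<close>.\<close>
  define a where "a t = T' (t, m t)" for t
  define w where "w t = T' (1, \<omega> t)" for t
  have a: "path_in F\<^sub>0 a" and w: "path_in F\<^sub>0 w"
    unfolding path_in_alt a_def w_def
    using m(1) \<omega>E mE \<omega>t m01 x by (auto simp: path_in_alt intro!: Tc' TD(6) continuous_intros)
  have aw: "pathfinish a = pathstart w" "pathfinish w = pathstart w"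
    by (simp_all add: a_def w_def pathstart_def pathfinish_def m01)
  have F0: "continuous_on F\<^sub>0 (\<lambda>y. T (t, y))" "(\<lambda>y. T (t, y)) ` F\<^sub>0 \<subseteq> {z \<in> E. p z = (p \<circ> m) t}"
    and F1: "continuous_on {z \<in> E. p z = (p \<circ> m) t} (\<lambda>z. T' (t, z))" "(\<lambda>z. T' (t, z)) ` {z \<in> E. p z = (p \<circ> m) t} \<subseteq> F\<^sub>0"
    if "t \<in> {0..1}" for t
    using that TD(3,4,6) by (auto intro!: Tc Tc' continuous_intros)
  let ?T0 = "\<lambda>y. T (0, y)"
  have T0E: "continuous_on F\<^sub>0 ?T0" "?T0 ` F\<^sub>0 \<subseteq> E" using F0 [of 0] by auto
  \<comment> \<open>Sliding the fibre coordinate \<open>w\<close> from time 1 to time 0 is a free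
    homotopy in \<open>E\<close> from \<open>\<omega>\<close> with track \<open>?l\<close>. Free
    homotopy preserves being null, by conjugation with the track.\<close>
  have T0w: "homotopic_paths E (?T0 \<circ> w) (\<lambda>_. pathstart (?T0 \<circ> w))"
  proof -
    let ?G = "\<lambda>z. T (snd z, w (fst z))"
    have G: "continuous_on ({0..1} \<times> {0..1}) ?G" "?G ` ({0..1} \<times> {0..1}) \<subseteq> E"
      using w TD(3) by (auto intro!: Tc continuous_intros continuous_on_compose2 [of "{0..1}" w] simp: path_in_alt)
    let ?r = "\<lambda>t. T (t, w 1)" and ?l = "\<lambda>t. T (t, w 0)"
    have w01: "w 1 = w 0" "w 0 \<in> F\<^sub>0" using aw w by (auto simp: pathstart_def pathfinish_def path_in_alt)
    have r: "path_in E ?l" using w01 TD(3) by (auto simp: path_in_alt intro!: Tc continuous_intros)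
    have Tw: "T (1, w t) = \<omega> t" if "t \<in> {0..1}" for t
      using TD(7) [of 1 "\<omega> t"] \<omega>t [OF that] m01 x by (simp add: w_def)
    have "homotopic_paths E (\<lambda>t. T (1, w t)) \<omega>"
      using Tw \<omega>E by (intro homotopic_paths_sym [OF homotopic_paths_eq]) (auto simp: path_in_def)
    then have h1: "hrel E (\<lambda>t. T (1, w t)) = hrel E (\<lambda>_. x)"
      using \<omega>null by (metis hrel_cong)
    have tw: "path_in E (\<lambda>t. T (1, w t))" "path_in E (\<lambda>t. T (0, w t))"
      using w path_in_compose [of F\<^sub>0 w "\<lambda>y. T (1, y)" E] path_in_compose [of F\<^sub>0 w "\<lambda>y. T (0, y)" E] F0 [of 1] F0 [of 0]
      by (auto simp: comp_def)
    have ends: "pathstart ?l = T (0, w 0)" "pathfinish ?l = x" "pathstart (\<lambda>t. T (1, w t)) = x"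
       "pathfinish (\<lambda>t. T (1, w t)) = x" "pathstart (\<lambda>t. T (0, w t)) = T (0, w 0)" 
       "pathfinish (\<lambda>t. T (0, w t)) = T (0, w 0)"
      using Tw [of 0] Tw [of 1] m01 w01 by (auto simp: pathstart_def pathfinish_def)
    have "homotopic_paths E ((\<lambda>t. T (0, w t)) +++ ?l) (?l +++ (\<lambda>t. T (1, w t)))"
      using square_homotopy(1) [OF G] w01 by simp
    then have "hrel E (\<lambda>t. T (0, w t)) O hrel E ?l = hrel E ?l"
      using hrel_cong r tw ends h1 by (force simp: hrel_simps)
    then have "hrel E (\<lambda>t. T (0, w t)) O hrel E ?l O hrel E (reversepath ?l) = hrel E ?l O hrel E (reversepath ?l)"
      by (metis O_assoc)
    then have "hrel E (\<lambda>t. T (0, w t)) = hrel E (\<lambda>_. T (0, w 0))"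
      using r tw ends by (simp add: hrel_simps)
    then show ?thesis
      using tw ends path_in_ends [OF tw(2)] by (simp add: homotopic_paths_hrel_iff comp_def)
  qed
  \<comment> \<open>Conjugating by \<open>a\<close> bases the loop at \<open>a 0\<close>, which
    \<open>?T0\<close> sends to \<open>e\<^sub>0\<close>, as \<open>fibre_null\<close>
    requires.\<close>
  let ?L = "(a +++ w) +++ reversepath a"
  let ?F = "{x \<in> E. p x = b\<^sub>0}"
  have a0: "pathstart a = a 0" by (simp add: pathstart_def)
  then have L: "path_in F\<^sub>0 ?L" "pathstart ?L = a 0" "pathfinish ?L = a 0"
    using a w aw by auto
  have Ta: "T (0, a 0) = e\<^sub>0" "T' (0, e\<^sub>0) = a 0" using TD(7) [of 0 e\<^sub>0] e\<^sub>0 m01 by (auto simp: a_def)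
  have F00: "continuous_on F\<^sub>0 ?T0" "?T0 ` F\<^sub>0 \<subseteq> ?F" using F0 [of 0] m01 e\<^sub>0 by auto
  have "homotopic_paths ?F (?T0 \<circ> ?L) (\<lambda>_. e\<^sub>0)"
  proof (rule fibre_null)
    show "path_in ?F (?T0 \<circ> ?L)" by (rule path_in_compose [OF L(1) F00])
    show "pathstart (?T0 \<circ> ?L) = e\<^sub>0" "pathfinish (?T0 \<circ> ?L) = e\<^sub>0"
      using L Ta by (simp_all add: pathstart_compose pathfinish_compose)
    have "homotopic_paths E (((?T0 \<circ> a) +++ (?T0 \<circ> w)) +++ reversepath (?T0 \<circ> a)) (\<lambda>_. pathstart (?T0 \<circ> a))"
      using T0w path_in_compose [OF a T0E] path_in_compose [OF w T0E] aw
      by (subst homotopic_const_conjugate) (auto simp: pathstart_compose pathfinish_compose)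
    then show "homotopic_paths E (?T0 \<circ> ?L) (\<lambda>_. e\<^sub>0)"
      using Ta by (simp add: path_compose_join path_compose_reversepath pathstart_compose a0)
  qed
  then have "homotopic_paths F\<^sub>0 ((\<lambda>z. T' (0, z)) \<circ> (?T0 \<circ> ?L)) ((\<lambda>z. T' (0, z)) \<circ> (\<lambda>_. e\<^sub>0))"
    by (rule homotopic_paths_continuous_image) (use F1 [of 0] m01 e\<^sub>0 in auto)
  moreover have "homotopic_paths F\<^sub>0 ?L ((\<lambda>z. T' (0, z)) \<circ> (?T0 \<circ> ?L))"
    using L(1) TD(5) by (intro homotopic_paths_eq) (auto simp: path_in_alt path_in_def [symmetric] path_def path_image_def)
  ultimately have "homotopic_paths F\<^sub>0 ?L (\<lambda>_. pathstart a)"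
    using Ta a0 by (simp add: comp_def) (meson homotopic_paths_trans)
  then have "homotopic_paths F\<^sub>0 w (\<lambda>_. pathstart w)"
    using a w aw by (simp add: homotopic_const_conjugate)
  then have "homotopic_paths {z \<in> E. p z = b} ((\<lambda>y. T (1, y)) \<circ> w) ((\<lambda>y. T (1, y)) \<circ> (\<lambda>_. pathstart w))"
    by (rule homotopic_paths_continuous_image) (use F0 [of 1] m01 x in auto)
  moreover have Tw: "T (1, w t) = \<omega> t" if "t \<in> {0..1}" for t
    using TD(7) [of 1 "\<omega> t"] \<omega>t [OF that] m01 x by (simp add: w_def)
  then have "homotopic_paths {z \<in> E. p z = b} \<omega> ((\<lambda>y. T (1, y)) \<circ> w)"
    using \<omega> by (intro homotopic_paths_eq) (auto simp: path_in_def)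
  ultimately have "homotopic_paths {z \<in> E. p z = b} \<omega> ((\<lambda>y. T (1, y)) \<circ> (\<lambda>_. pathstart w))"
    by (meson homotopic_paths_trans)
  then show ?thesis using Tw [of 0] by (simp add: comp_def pathstart_def)
qed

end

section \<open>Lifting cells\<close>

text \<open>The type carrying \<^const>\<open>closed_disc\<close> is not a normed vector space, so discs of dimension at most 2
  are modelled in the complex plane.\<close>

definition disc :: "nat \<Rightarrow> complex set" where
  "disc n = {z. norm z \<le> 1 \<and> (n < 2 \<longrightarrow> Im z = 0) \<and> (n < 1 \<longrightarrow> Re z = 0)}"

lemma convex_disc: "convex (disc n)" and compact_disc: "compact (disc n)"
proof -
  have eq: "disc n = cball 0 1 \<inter> ({z. n < 2 \<longrightarrow> Im z = 0} \<inter> {z. n < 1 \<longrightarrow> Re z = 0})"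
    by (auto simp: disc_def)
  show "convex (disc n)"
    unfolding eq by (intro convex_Int convex_cball) (auto simp: convex_def)
  show "compact (disc n)"
    unfolding eq by (intro compact_Int_closed compact_cball closed_Int closed_Collect_imp closed_Collect_eq
        continuous_intros) auto
qed

lemma zero_in_disc [simp]: "0 \<in> disc n"
  by (simp add: disc_def)

lemma norm_disc: "z \<in> disc n \<Longrightarrow> norm z \<le> 1"
  by (simp add: disc_def)

lemma scaleR_in_disc: "\<lbrakk>z \<in> disc n; norm (c *\<^sub>R z) \<le> 1\<rbrakk> \<Longrightarrow> c *\<^sub>R z \<in> disc n"
  by (auto simp: disc_def)

context split_bundle
begin

section \<open>Equality of marked points and coherent lifts\<close>

lemma transports_eq:
  assumes "transports m q m'" "\<And>t. t \<in> {0..1} \<Longrightarrow> q t = q' t"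
  shows "transports m q' m'"
  using assms by (intro transports_homotopic [OF assms(1)] homotopic_paths_eq)
    (auto simp: transports_def path_in_def)

text \<open>Transport along a constant path is equality of points of the covering, so this is
  uniqueness of path lifting there. The next lemmas substitute equal markings for one
  another.\<close>

lemma transports_unique:
  assumes "transports m q m'" "transports m q m''"
  shows "transports m' (\<lambda>_. pathfinish q) m''"
proof (rule transports_homotopic)
  show "transports m' (reversepath q +++ q) m''"
    using transports_join transports_reversepath assms by blast
  have "path_in E q" using assms by (simp add: transports_def)
  then show "homotopic_paths E (reversepath q +++ q) (\<lambda>_. pathfinish q)"
    using path_in_ends [of E q] by (subst homotopic_paths_hrel_iff) (auto simp: hrel_simps)
qed

lemma transports_subst_left:
  assumes "transports m (\<lambda>_. x) m'" "transports m' q m''"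
  shows "transports m q m''"
proof (rule transports_homotopic)
  show "transports m ((\<lambda>_. x) +++ q) m''" using assms by (rule transports_join)
  have "x = pathstart q" "path_in E q"
    using assms by (auto simp: transports_def marking_def)
  then show "homotopic_paths E ((\<lambda>_. x) +++ q) q"
    by (simp add: homotopic_paths_const_join)
qed

lemma transports_sym: "transports m (\<lambda>_. x) m' \<Longrightarrow> transports m' (\<lambda>_. x) m"
  by (drule transports_reversepath) (simp add: reversepath_def)

lemma transports_subst_right:
  assumes "transports m q m'" "transports m' (\<lambda>_. x) m''"
  shows "transports m q m''"
proof -
  have "transports m'' (reversepath q) m"
    using transports_subst_left [OF transports_sym [OF assms(2)] transports_reversepath [OF assms(1)]] .
  then show ?thesis using transports_reversepath by fastforce
qed

text \<open>Stands for a continuous lift of \<open>u\<close> to the covering, with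
  \<open>(s x, m x)\<close> naming the point above \<open>x\<close>. The second component has no
  topology here, so its continuity is replaced by the condition on all paths. The parameter
  \<open>u\<close> is the identity for a partial section and the characteristic map for a lift over
  a cell.\<close>

definition coherent :: "('c::topological_space \<Rightarrow> 'b) \<Rightarrow> 'c set \<Rightarrow> ('c \<Rightarrow> 'e) \<Rightarrow> ('c \<Rightarrow> real \<Rightarrow> 'e) \<Rightarrow> bool" where
  "coherent u X s m \<longleftrightarrow> continuous_on X s \<and>
     (\<forall>x\<in>X. s x \<in> E \<and> p (s x) = u x \<and> marking (m x) (s x)) \<and>
     (\<forall>q. path_in X q \<longrightarrow> transports (m (q 0)) (s \<circ> q) (m (q 1)))"

lemma coherentD:
  assumes "coherent u X s m"
  shows "continuous_on X s" "\<And>x. x \<in> X \<Longrightarrow> s x \<in> E" "\<And>x. x \<in> X \<Longrightarrow> p (s x) = u x"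
    "\<And>x. x \<in> X \<Longrightarrow> marking (m x) (s x)"
    "\<And>q. path_in X q \<Longrightarrow> transports (m (q 0)) (s \<circ> q) (m (q 1))"
  using assms by (auto simp: coherent_def)

text \<open>One marking determines all others by transport along segments from \<open>z1\<close>.
  Any path in \<open>D\<close> is homotopic to a detour through segments, so coherence is
  automatic.\<close>

lemma coherent_convex:
  fixes D :: "'c::real_normed_vector set"
  assumes D: "convex D" and g: "continuous_on D g" "\<And>z. z \<in> D \<Longrightarrow> g z \<in> E \<and> p (g z) = u z"
    and z1: "z1 \<in> D" and m: "marking m (g z1)"
  shows "coherent u D g (\<lambda>z. m +++ (g \<circ> linepath z1 z))"
proof -
  have lin: "path_in D (linepath z1 z)" if "z \<in> D" for z
    using D z1 that by (auto simp: path_in_def convex_contains_segment)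
  have gE: "g ` D \<subseteq> E" using g by auto
  note gp = path_in_compose [OF _ g(1) gE]
  show ?thesis
    unfolding coherent_def
  proof (intro conjI ballI allI impI)
    fix z assume z: "z \<in> D"
    show "g z \<in> E" "p (g z) = u z" using g z by auto
    show "marking (m +++ (g \<circ> linepath z1 z)) (g z)"
      using marking_extend [of m "g \<circ> linepath z1 z"] m gp [OF lin [OF z]]
      by (simp add: pathstart_compose pathfinish_compose)
  next
    fix q :: "real \<Rightarrow> 'c" assume q: "path_in D q"
    have q01: "pathstart q = q 0" "pathfinish q = q 1" "q 0 \<in> D" "q 1 \<in> D"
      using q by (auto simp: path_in_alt pathstart_def pathfinish_def)
    have tr: "transports m (g \<circ> linepath z1 z) (m +++ (g \<circ> linepath z1 z))" if "z \<in> D" for z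
      using m gp [OF lin [OF that]] by (intro transports_extend) (auto simp: pathstart_compose)
    have "homotopic_paths E (g \<circ> linepath z1 (q 1)) (g \<circ> (linepath z1 (q 0) +++ q))"
      using q01 lin q g gE D by (intro homotopic_paths_convex_image [of D]) auto
    from transports_homotopic [OF tr [OF q01(4)] this]
    have "transports m ((g \<circ> linepath z1 (q 0)) +++ (g \<circ> q)) (m +++ (g \<circ> linepath z1 (q 1)))"
      by (simp add: path_compose_join)
    then show "transports (m +++ (g \<circ> linepath z1 (q 0))) (g \<circ> q) (m +++ (g \<circ> linepath z1 (q 1)))"
      by (rule transports_cancel_left [OF _ tr [OF q01(3)]])
        (use q01 gp [OF q] in \<open>auto simp: pathstart_compose pathfinish_compose\<close>)
  qed (use g in auto)
qed

text \<open>Each marking is prolonged by the track of its point under the deformation. Along a path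
  \<open>q\<close> the tracks sweep out a square with three known transports.\<close>

lemma coherent_vertical_homotopy:
  assumes c: "coherent u D g m"
    and G: "continuous_on (D \<times> {0..1::real}) G" "\<And>z t. \<lbrakk>z \<in> D; t \<in> {0..1}\<rbrakk> \<Longrightarrow> G (z, t) \<in> E \<and> p (G (z, t)) = u z"
    and G0: "\<And>z. z \<in> D \<Longrightarrow> G (z, 0) = g z"
  shows "coherent u D (\<lambda>z. G (z, 1)) (\<lambda>z. m z +++ (\<lambda>t. G (z, t)))"
    and "\<And>z. z \<in> D \<Longrightarrow> transports (m z) (\<lambda>t. G (z, t)) (m z +++ (\<lambda>t. G (z, t)))"
proof -
  note C = coherentD [OF c]
  have pG: "path_in E (\<lambda>t. G (z, t))" if "z \<in> D" for z
    using that G by (auto simp: path_in_alt intro!: continuous_on_compose2 [OF G(1)] continuous_intros)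
  show tr: "transports (m z) (\<lambda>t. G (z, t)) (m z +++ (\<lambda>t. G (z, t)))" if "z \<in> D" for z
    using that G0 C(4) pG by (intro transports_extend) (auto simp: pathstart_def)
  show "coherent u D (\<lambda>z. G (z, 1)) (\<lambda>z. m z +++ (\<lambda>t. G (z, t)))"
    unfolding coherent_def
  proof (intro conjI ballI allI impI)
    show "continuous_on D (\<lambda>z. G (z, 1))"
      by (auto intro!: continuous_on_compose2 [OF G(1)] continuous_intros)
    fix z assume z: "z \<in> D"
    then show "G (z, 1) \<in> E" "p (G (z, 1)) = u z" using G by auto
    show "marking (m z +++ (\<lambda>t. G (z, t))) (G (z, 1))"
      using tr [OF z] by (simp add: transports_def pathfinish_def)
  next
    fix q assume q: "path_in D q"
    then have cq: "continuous_on {0..1} q" and qD: "\<And>t. t \<in> {0..1} \<Longrightarrow> q t \<in> D"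
      by (auto simp: path_in_alt)
    \<comment> \<open>The deformation parameter is reversed so that the unknown transport, at time
      1, becomes the bottom edge that \<open>transports_square\<close> concludes about.\<close>
    let ?H = "\<lambda>z. G (q (fst z), 1 - snd z)"
    have rev: "transports (m z +++ (\<lambda>t. G (z, t))) (\<lambda>t. G (z, 1 - t)) (m z)" if "z \<in> D" for z
      using transports_reversepath [OF tr [OF that]] by (simp add: reversepath_def)
    have "transports (m (q 0) +++ (\<lambda>t. G (q 0, t))) (\<lambda>t. ?H (t, 0)) (m (q 1) +++ (\<lambda>t. G (q 1, t)))"
    proof (rule transports_square)
      show "continuous_on ({0..1} \<times> {0..1}) ?H"
        by (rule continuous_on_compose2 [OF G(1)])
          (auto intro!: continuous_intros continuous_on_compose2 [OF cq] qD)
      show "?H ` ({0..1} \<times> {0..1}) \<subseteq> E" using G qD by auto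
      show "transports (m (q 0)) (\<lambda>t. ?H (t, 1)) (m (q 1))"
        by (rule transports_eq [OF C(5) [OF q]]) (use G0 qD in auto)
    qed (use rev qD in auto)
    then show "transports (m (q 0) +++ (\<lambda>t. G (q 0, t))) ((\<lambda>z. G (z, 1)) \<circ> q) (m (q 1) +++ (\<lambda>t. G (q 1, t)))"
      by (simp add: comp_def)
  qed
qed

text \<open>Two deformations in the fibres, both fixed on the unit circle: the first makes the fibre
  coordinate constant near \<open>z0\<close>, the second drags that constant along a path in the
  fibre which ends at \<open>e\<close> and transports the marking at \<open>z0\<close> to
  \<open>\<mu>\<close>.\<close>

lemma coherent_prescribe_interior_point:
  assumes \<Phi>: "continuous_on (disc n) \<Phi>" "\<Phi> ` disc n \<subseteq> B"
    and c: "coherent \<Phi> (disc n) g M"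
    and z0: "z0 \<in> disc n" "norm z0 < 1" and e: "e \<in> E" "p e = \<Phi> z0" and \<mu>: "marking \<mu> e"
  obtains g' M' where "coherent \<Phi> (disc n) g' M'" "g' z0 = e" "transports (M' z0) (\<lambda>_. e) \<mu>"
    "\<And>z. \<lbrakk>z \<in> disc n; norm z = 1\<rbrakk> \<Longrightarrow> g' z = g z \<and> transports (M' z) (\<lambda>_. g z) (M z)"
proof -
  let ?D = "disc n"
  obtain T T' where T: "trivialisation E p F\<^sub>0 \<Phi> ?D T T'"
    using fibre_bundle_trivial_over_convex [OF fibration convex_disc compact_disc \<Phi>]
    by (auto simp: trivial_over_def)
  note TD = trivialisationD [OF T] and Tc = trivialisation_continuous [OF T] and Tc' = trivialisation_continuous' [OF T]
  note C = coherentD [OF c]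
  \<comment> \<open>With this choice the ball of radius \<open>2 * \<epsilon>\<close> about
    \<open>z0\<close>, outside which the cutoff \<open>w\<close> vanishes, does not reach beyond the
    open unit disc; on the ball of radius \<open>\<epsilon>\<close> the cutoff is 1.\<close>
  define \<epsilon> where "\<epsilon> = (1 - norm z0) / 3"
  have \<epsilon>: "\<epsilon> > 0" using z0 by (simp add: \<epsilon>_def)
  define w where "w z = max 0 (min 1 (2 - dist z z0 / \<epsilon>))" for z
  define \<kappa> where "\<kappa> z = z + w z *\<^sub>R (z0 - z)" for z
  have w01: "0 \<le> w z" "w z \<le> 1" for z by (auto simp: w_def)
  have far: "2 * \<epsilon> \<le> dist z z0" if "norm z = 1" for z
    using norm_triangle_ineq2 [of z z0] that \<epsilon> by (simp add: dist_norm \<epsilon>_def)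
  have \<kappa>_bd: "\<kappa> z = z" if "norm z = 1" for z
    using far [OF that] \<epsilon> by (simp add: \<kappa>_def w_def field_simps)
  have \<kappa>_near: "\<kappa> z = z0" if "dist z z0 \<le> \<epsilon>" for z
  proof -
    have "w z = 1" using that \<epsilon> by (simp add: w_def field_simps)
    then show ?thesis by (simp add: \<kappa>_def)
  qed
  have seg: "z + (t * w z) *\<^sub>R (z0 - z) \<in> ?D" if "z \<in> ?D" "t \<in> {0..1}" for z t
  proof -
    have "z + (t * w z) *\<^sub>R (z0 - z) = (1 - t * w z) *\<^sub>R z + (t * w z) *\<^sub>R z0"
      by (simp add: algebra_simps)
    moreover have "0 \<le> t * w z" "t * w z \<le> 1" using w01 that by (auto simp: mult_le_one)
    ultimately show ?thesis using convexD [OF convex_disc that(1) z0(1), of "1 - t * w z" "t * w z"] by simp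
  qed
  have \<kappa>D: "\<kappa> z \<in> ?D" if "z \<in> ?D" for z using seg [OF that, of 1] by (simp add: \<kappa>_def)
  have cw: "continuous_on A w" for A unfolding w_def by (intro continuous_intros) (use \<epsilon> in auto)
  have c\<kappa>: "continuous_on A \<kappa>" for A unfolding \<kappa>_def by (intro continuous_intros cw)
  define g0 where "g0 z = T' (z, g z)" for z
  have cg0: "continuous_on ?D g0" and g0: "\<And>z. z \<in> ?D \<Longrightarrow> g0 z \<in> F\<^sub>0" "\<And>z. z \<in> ?D \<Longrightarrow> T (z, g0 z) = g z"
    unfolding g0_def using C by (auto intro!: Tc' TD continuous_intros)
  \<comment> \<open>Only the argument of the coordinate \<open>g0\<close> moves towards
    \<open>z0\<close>; the base point stays at \<open>z\<close>, so the deformation is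
    vertical.\<close>
  define G1 where "G1 = (\<lambda>(z, t). T (z, g0 (z + (t * w z) *\<^sub>R (z0 - z))))"
  define g1 where "g1 z = G1 (z, 1)" for z
  define M1 where "M1 z = M z +++ (\<lambda>t. G1 (z, t))" for z
  have G1: "continuous_on (?D \<times> {0..1}) G1"
    unfolding G1_def case_prod_unfold
    by (auto intro!: Tc continuous_intros continuous_on_compose2 [OF cg0] continuous_on_compose2 [OF cw [of UNIV]] g0 seg)
  have g1: "g1 z = T (z, g0 (\<kappa> z))" for z by (simp add: g1_def G1_def \<kappa>_def)
  have c1: "coherent \<Phi> ?D g1 M1" and t1: "\<And>z. z \<in> ?D \<Longrightarrow> transports (M z) (\<lambda>t. G1 (z, t)) (M1 z)"
    unfolding g1_def M1_def
    by (rule coherent_vertical_homotopy [OF c G1]; use TD g0 seg in \<open>auto simp: G1_def\<close>)+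
  have "marking (M1 z0) (g1 z0)" using coherentD [OF c1] z0 by auto
  moreover have pg1: "p (g1 z0) = \<Phi> z0" using coherentD [OF c1] z0 by auto
  ultimately obtain \<omega> where \<omega>: "path_in {z \<in> E. p z = \<Phi> z0} \<omega>" "pathstart \<omega> = g1 z0" "pathfinish \<omega> = e"
    "transports (M1 z0) \<omega> \<mu>"
    using transports_within_fibre [of "M1 z0" "g1 z0" \<mu> e] \<mu> e by auto
  define w0 where "w0 t = T' (z0, \<omega> t)" for t
  have \<omega>E: "\<omega> t \<in> E" "p (\<omega> t) = \<Phi> z0" if "t \<in> {0..1}" for t using \<omega> that by (auto simp: path_in_alt)
  have cw0: "continuous_on {0..1} w0" and w0: "\<And>t. t \<in> {0..1} \<Longrightarrow> w0 t \<in> F\<^sub>0" "\<And>t. t \<in> {0..1} \<Longrightarrow> T (z0, w0 t) = \<omega> t"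
    unfolding w0_def using \<omega> \<omega>E z0 by (auto simp: path_in_alt intro!: Tc' TD continuous_intros)
  have w00: "w0 0 = g0 z0"
    using \<omega>(2) TD(5) [of z0 "g0 z0"] z0 g0 \<kappa>_near [of z0] \<epsilon> by (simp add: w0_def pathstart_def g1)
  define v where "v = (\<lambda>(z, t). if dist z z0 \<le> \<epsilon> then w0 (t * max 0 (1 - dist z z0 / \<epsilon>)) else g0 (\<kappa> z))"
  have rng: "t * max 0 (1 - dist z z0 / \<epsilon>) \<in> {0..1}" if "t \<in> {0..1}" for z t
    using that \<epsilon> by (auto simp: mult_le_one)
  have cv: "continuous_on (?D \<times> {0..1}) v"
    unfolding v_def case_prod_unfold
  proof (rule continuous_on_cases_le)
    show "continuous_on {z \<in> ?D \<times> {0..1}. dist (fst z) z0 \<le> \<epsilon>} (\<lambda>z. w0 (snd z * max 0 (1 - dist (fst z) z0 / \<epsilon>)))"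
    proof (rule continuous_on_compose2 [OF cw0])
      show "(\<lambda>z. snd z * max 0 (1 - dist (fst z) z0 / \<epsilon>)) ` {z \<in> ?D \<times> {0..1}. dist (fst z) z0 \<le> \<epsilon>} \<subseteq> {0..1}"
        by (rule image_subsetI, rule rng) auto
    qed (use \<epsilon> in \<open>auto intro!: continuous_intros\<close>)
    show "continuous_on {z \<in> ?D \<times> {0..1}. \<epsilon> \<le> dist (fst z) z0} (\<lambda>z. g0 (\<kappa> (fst z)))"
      by (rule continuous_on_compose2 [OF cg0])
        (use \<kappa>D in \<open>auto intro!: continuous_intros continuous_on_compose2 [OF c\<kappa> [of UNIV]]\<close>)
    show "w0 (snd z * max 0 (1 - dist (fst z) z0 / \<epsilon>)) = g0 (\<kappa> (fst z))"
      if "z \<in> ?D \<times> {0..1}" "dist (fst z) z0 = \<epsilon>" for z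
      using that \<epsilon> \<kappa>_near w00 by auto
  qed (intro continuous_intros)
  have v: "v (z, t) \<in> F\<^sub>0" if "z \<in> ?D" "t \<in> {0..1}" for z t
    using that w0(1) rng g0(1) \<kappa>D by (auto simp: v_def)
  define G2 where "G2 = (\<lambda>z. T (fst z, v z))"
  define g2 where "g2 z = G2 (z, 1)" for z
  define M2 where "M2 z = M1 z +++ (\<lambda>t. G2 (z, t))" for z
  have G2: "continuous_on (?D \<times> {0..1}) G2"
    unfolding G2_def by (rule Tc) (use v cv in \<open>auto intro!: continuous_intros\<close>)
  have G20: "G2 (z, 0) = g1 z" for z using w00 \<kappa>_near [of z] by (simp add: G2_def v_def g1)
  have c2: "coherent \<Phi> ?D g2 M2" and t2: "\<And>z. z \<in> ?D \<Longrightarrow> transports (M1 z) (\<lambda>t. G2 (z, t)) (M2 z)"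
    unfolding g2_def M2_def
    by (rule coherent_vertical_homotopy [OF c1 G2]; use TD v G20 in \<open>auto simp: G2_def\<close>)+
  have G2z0: "G2 (z0, t) = \<omega> t" if "t \<in> {0..1}" for t
    using that w0 \<epsilon> by (simp add: G2_def v_def)
  show thesis
  proof (rule that [OF c2])
    show "g2 z0 = e" using \<omega>(3) G2z0 [of 1] by (simp add: g2_def pathfinish_def)
    have "transports (M1 z0) \<omega> (M2 z0)" by (rule transports_eq [OF t2 [OF z0(1)]]) (use G2z0 in auto)
    then show "transports (M2 z0) (\<lambda>_. e) \<mu>" using transports_unique \<omega> by metis
    fix z assume z: "z \<in> ?D" "norm z = 1"
    have w: "w z = 0" using far [OF z(2)] \<epsilon> by (simp add: w_def field_simps)
    have 1: "G1 (z, t) = g z" for t using w z g0 by (simp add: G1_def)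
    have 2: "G2 (z, t) = g z" for t
      using far [OF z(2)] \<epsilon> \<kappa>_bd [OF z(2)] z g0 by (simp add: G2_def v_def)
    have t: "transports (M z) (\<lambda>_. g z) (M1 z)" "transports (M1 z) (\<lambda>_. g z) (M2 z)"
      using t1 [OF z(1)] t2 [OF z(1)] 1 2 by simp_all
    show "g2 z = g z \<and> transports (M2 z) (\<lambda>_. g z) (M z)"
      using transports_sym [OF transports_subst_left [OF t]] 2 by (simp add: g2_def)
  qed
qed

end

text \<open>A continuous map from a compact space to a Hausdorff space is closed, hence a quotient
  map onto its image, also after restriction to the full preimage of any \<open>W\<close>. No
  closedness of \<open>W\<close> is asked for, so that open cells and punctured cells are
  covered.\<close>

lemma continuous_on_quotient_of_compact:
  fixes f :: "'c::topological_space \<Rightarrow> 'a::topological_space" and h :: "'a \<Rightarrow> 'd::topological_space"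
  assumes K: "compact K" and f: "continuous_on K f" "f ` K \<subseteq> Y" and Y: "Hausdorff_space (top_of_set Y)"
    and W: "W \<subseteq> f ` K" and hf: "continuous_on {z \<in> K. f z \<in> W} (\<lambda>z. h (f z))"
  shows "continuous_on W h"
  unfolding continuous_on_closed_invariant
proof (intro allI impI)
  fix C :: "'d set" assume "closed C"
  then obtain A where A: "closed A" "A \<inter> {z \<in> K. f z \<in> W} = (\<lambda>z. h (f z)) -` C \<inter> {z \<in> K. f z \<in> W}"
    using hf unfolding continuous_on_closed_invariant by blast
  have "compact (f ` (K \<inter> A))"
    using K A f by (intro compact_continuous_image compact_Int_closed) (auto intro: continuous_on_subset)
  then have "closedin (top_of_set Y) (f ` (K \<inter> A))"
    using f by (intro compactin_imp_closedin [OF Y]) (auto simp: compactin_subtopology)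
  then obtain A' where A': "closed A'" "f ` (K \<inter> A) = Y \<inter> A'" by (auto simp: closedin_closed)
  have "w \<in> A' \<longleftrightarrow> h w \<in> C" if w: "w \<in> W" for w
  proof -
    obtain z where z: "z \<in> K" "w = f z" using W w by auto
    have "w \<in> A' \<longleftrightarrow> w \<in> f ` (K \<inter> A)" using A' w W f by blast
    also have "\<dots> \<longleftrightarrow> h w \<in> C"
    proof
      assume "w \<in> f ` (K \<inter> A)"
      then obtain z' where z': "z' \<in> K" "z' \<in> A" "w = f z'" by auto
      then have "z' \<in> A \<inter> {z \<in> K. f z \<in> W}" using w by auto
      then show "h w \<in> C" using A(2) z' by auto
    next
      assume "h w \<in> C"
      then have "z \<in> (\<lambda>z. h (f z)) -` C \<inter> {z \<in> K. f z \<in> W}" using z w by auto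
      then show "w \<in> f ` (K \<inter> A)" using A(2) z by blast
    qed
    finally show ?thesis .
  qed
  then have "A' \<inter> W = h -` C \<inter> W" by auto
  then show "\<exists>A. closed A \<and> A \<inter> W = h -` C \<inter> W" using A'(1) by blast
qed

section \<open>The disc as a cone on the circle\<close>

definition circle :: "real \<Rightarrow> complex" where
  "circle t = cis (2 * pi * t)"

lemma circle_simps [simp]: "circle 0 = 1" "circle 1 = 1" "norm (circle t) = 1"
  by (simp_all add: circle_def)

lemma continuous_on_circle [continuous_intros]:
  "continuous_on A g \<Longrightarrow> continuous_on A (\<lambda>x. circle (g x))"
  unfolding circle_def by (intro continuous_intros)

lemma circle_inj:
  assumes "circle s = circle t" and "s \<in> {0..1}" "t \<in> {0..1}"
  shows "s = t \<or> s = 0 \<and> t = 1 \<or> s = 1 \<and> t = 0"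
proof -
  have "sin (2 * pi * s) = sin (2 * pi * t) \<and> cos (2 * pi * s) = cos (2 * pi * t)"
    using assms(1) unfolding circle_def by (metis cis.sel)
  then obtain k :: int where k: "2 * pi * s = 2 * pi * t + 2 * pi * k"
    using sin_cos_eq_iff by blast
  then have "2 * pi * s = 2 * pi * (t + k)" by (simp add: algebra_simps)
  then have "s = t + k" by simp
  moreover have "k \<in> {-1, 0, 1}" using \<open>s = t + k\<close> assms(2,3) by auto
  ultimately show ?thesis using assms(2,3) by auto
qed

lemma circle_polar: "z = of_real (norm z) * circle (Arg2pi z / (2 * pi))"
  using Arg2pi [of z] by (simp add: circle_def cis_conv_exp is_Arg_def)

text \<open>The square of a null homotopy becomes the disc when its final edge is shrunk to the
  centre and the two edges of fixed end points are glued. The homotopy is constant on the sets so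
  identified and therefore descends.\<close>

lemma null_loop_extends_to_disc:
  fixes f :: "complex \<Rightarrow> 'f::topological_space"
  assumes "homotopic_paths X (\<lambda>t. f (circle t)) (\<lambda>_. c)"
  obtains k where "continuous_on (disc 2) k" "k ` disc 2 \<subseteq> X" "\<And>z. norm z = 1 \<Longrightarrow> k z = f z"
proof -
  let ?S = "{0..1::real} \<times> {0..1::real}"
  have c: "f 1 = c" using homotopic_paths_imp_pathstart [OF assms] by (simp add: pathstart_def)
  obtain h where h: "continuous_on ?S h" "h \<in> ?S \<rightarrow> X"
    and h0: "\<And>t. t \<in> {0..1} \<Longrightarrow> h (0, t) = f (circle t)"
    and h1: "\<And>t. t \<in> {0..1} \<Longrightarrow> h (1, t) = c"
    and hends: "\<And>t. t \<in> {0..1} \<Longrightarrow> h (t, 0) = c \<and> h (t, 1) = c"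
    using assms unfolding homotopic_paths by (auto simp: pathstart_def pathfinish_def c)
  \<comment> \<open>Polar coordinates with reversed radius: time 0 of the homotopy lies on the unit
    circle, time 1 at the centre.\<close>
  define A where "A z = of_real (1 - fst z) * circle (snd z)" for z :: "real \<times> real"
  have normA: "norm (A z) = 1 - fst z" if "z \<in> ?S" for z using that by (auto simp: A_def norm_mult simp del: of_real_diff)
  have A_h: "h z = h z'" if "z \<in> ?S" "z' \<in> ?S" "A z = A z'" for z z'
  proof -
    have fst: "fst z = fst z'" using normA [OF that(1)] normA [OF that(2)] that(3) by simp
    show ?thesis
    proof (cases "fst z = 1")
      case True then show ?thesis using that fst h1 by (metis mem_Times_iff prod.collapse)
    next
      case False
      then have "circle (snd z) = circle (snd z')" using that(3) fst by (simp add: A_def)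
      then have "snd z = snd z' \<or> snd z = 0 \<and> snd z' = 1 \<or> snd z = 1 \<and> snd z' = 0"
        using circle_inj that by (simp add: mem_Times_iff)
      then show ?thesis using hends that fst by (cases z; cases z') auto
    qed
  qed
  have surj: "\<exists>w\<in>?S. A w = z \<and> fst w = 1 - norm z" if "z \<in> disc 2" for z
  proof -
    have "A (1 - norm z, Arg2pi z / (2 * pi)) = z"
      using circle_polar [of z] by (simp add: A_def)
    moreover have "(1 - norm z, Arg2pi z / (2 * pi)) \<in> ?S"
      using Arg2pi [of z] norm_disc [OF that] by (auto simp: field_simps)
    ultimately show ?thesis by (metis fst_conv)
  qed
  define k where "k z = h (SOME w. w \<in> ?S \<and> A w = z)" for z
  have kA: "k (A w) = h w" if "w \<in> ?S" for w
  proof -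
    define w' where "w' = (SOME w'. w' \<in> ?S \<and> A w' = A w)"
    have w': "w' \<in> ?S \<and> A w' = A w"
      unfolding w'_def by (rule someI [of _ w]) (use that in simp)
    then have "h w' = h w" using that by (intro A_h) auto
    then show ?thesis by (simp add: k_def w'_def)
  qed
  have cA: "continuous_on ?S A" unfolding A_def by (intro continuous_intros)
  have Adisc: "A ` ?S = disc 2"
  proof
    show "A ` ?S \<subseteq> disc 2" using normA by (auto simp: disc_def)
    show "disc 2 \<subseteq> A ` ?S" using surj by blast
  qed
  show thesis
  proof
    show "continuous_on (disc 2) k"
    proof (rule continuous_on_quotient_of_compact [where K = ?S and f = A and Y = "disc 2"])
      show "Hausdorff_space (top_of_set (disc 2))" by (simp add: Hausdorff_space_subtopology)
      show "continuous_on {z \<in> ?S. A z \<in> disc 2} (\<lambda>z. k (A z))"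
        by (rule continuous_on_eq [OF continuous_on_subset [OF h(1)]]) (use kA in auto)
    qed (use cA Adisc in \<open>auto intro: compact_Times\<close>)
    show "k ` disc 2 \<subseteq> X" using kA h(2) by (force simp flip: Adisc)
    fix z :: complex assume z: "norm z = 1"
    then obtain w where w: "w \<in> ?S" "A w = z" "fst w = 0" using surj [of z] by (auto simp: disc_def)
    then have "f (circle (snd w)) = f z" by (simp add: A_def)
    then show "k z = f z" using kA [OF w(1)] h0 [of "snd w"] w by (cases w) auto
  qed
qed

context split_bundle
begin

text \<open>The lift with constant fibre coordinate \<open>y\<close> is right at -1. At 1 its value
  and marking can be corrected by a path in the fibre, since the fibres of the covering are path
  connected; the correction is spread along the interval.\<close>

lemma coherent_disc1_lift:
  assumes \<Phi>: "continuous_on (disc 1) \<Phi>" "\<Phi> ` disc 1 \<subseteq> B"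
    and X: "coherent (\<lambda>x. x) X s m" and bd: "\<And>z. \<lbrakk>z \<in> disc 1; norm z = 1\<rbrakk> \<Longrightarrow> \<Phi> z \<in> X"
  obtains g M where "coherent \<Phi> (disc 1) g M"
    "\<And>z. \<lbrakk>z \<in> disc 1; norm z = 1\<rbrakk> \<Longrightarrow> g z = s (\<Phi> z) \<and> transports (M z) (\<lambda>_. g z) (m (\<Phi> z))"
proof -
  let ?D = "disc 1"
  note C = coherentD [OF X]
  have pm: "1 \<in> ?D" "-1 \<in> ?D" by (auto simp: disc_def)
  have X1: "\<Phi> 1 \<in> X" "\<Phi> (-1) \<in> X" using bd pm by auto
  have D: "z = 1 \<or> z = -1" if "z \<in> ?D" "norm z = 1" for z
    using that by (auto simp: disc_def complex_eq_iff cmod_def abs_if split: if_splits)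
  obtain T T' where T: "trivialisation E p F\<^sub>0 \<Phi> ?D T T'"
    using fibre_bundle_trivial_over_convex [OF fibration convex_disc compact_disc \<Phi>]
    by (auto simp: trivial_over_def)
  note TD = trivialisationD [OF T] and Tc = trivialisation_continuous [OF T] and Tc' = trivialisation_continuous' [OF T]
  define y where "y = T' (-1, s (\<Phi> (-1)))"
  have y: "y \<in> F\<^sub>0" "T (-1, y) = s (\<Phi> (-1))" unfolding y_def using TD(6,7) pm C X1 by auto
  define h where "h z = T (z, y)" for z
  define M where "M z = m (\<Phi> (-1)) +++ (h \<circ> linepath (-1) z)" for z
  have h: "continuous_on ?D h" "\<And>z. z \<in> ?D \<Longrightarrow> h z \<in> E \<and> p (h z) = \<Phi> z"
    unfolding h_def using TD y by (auto intro!: Tc continuous_intros)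
  have hc: "coherent \<Phi> ?D h M"
    unfolding M_def using h C(4) [OF X1(2)] y(2) pm
    by (intro coherent_convex convex_disc) (auto simp: h_def)
  have "marking (M 1) (h 1)" "marking (m (\<Phi> 1)) (s (\<Phi> 1))" "p (h 1) = \<Phi> 1" "p (s (\<Phi> 1)) = \<Phi> 1"
    using coherentD [OF hc] pm C X1 by auto
  then obtain \<omega> where \<omega>: "path_in {z \<in> E. p z = \<Phi> 1} \<omega>" "pathstart \<omega> = h 1" "pathfinish \<omega> = s (\<Phi> 1)"
    "transports (M 1) \<omega> (m (\<Phi> 1))"
    using transports_within_fibre [of "M 1" "h 1" "m (\<Phi> 1)" "s (\<Phi> 1)"] by auto
  define w where "w t = T' (1, \<omega> t)" for t
  have \<omega>E: "\<omega> t \<in> E" "p (\<omega> t) = \<Phi> 1" if "t \<in> {0..1}" for t using \<omega> that by (auto simp: path_in_alt)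
  have cw: "continuous_on {0..1} w" and w: "\<And>t. t \<in> {0..1} \<Longrightarrow> w t \<in> F\<^sub>0" "\<And>t. t \<in> {0..1} \<Longrightarrow> T (1, w t) = \<omega> t"
    unfolding w_def using \<omega> \<omega>E pm by (auto simp: path_in_alt intro!: Tc' TD continuous_intros)
  have w0: "w 0 = y" using \<omega>(2) TD(5) [of 1 y] pm y by (simp add: w_def pathstart_def h_def)
  \<comment> \<open>The factor \<open>(Re z + 1) / 2\<close> is 0 at -1 and 1 at 1, so the
    correction is absent at one end and complete at the other.\<close>
  define G where "G z = T (fst z, w (snd z * ((Re (fst z) + 1) / 2)))" for z
  have rng: "t * ((Re z + 1) / 2) \<in> {0..1}" if "z \<in> ?D" "t \<in> {0..1}" for z t
    using that abs_Re_le_cmod [of z] norm_disc [OF that(1)]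
    unfolding atLeastAtMost_iff by (intro conjI mult_nonneg_nonneg mult_le_one) auto
  have cG: "continuous_on (?D \<times> {0..1}) G"
    unfolding G_def
  proof (intro Tc)
    show "continuous_on (?D \<times> {0..1}) (\<lambda>z. w (snd z * ((Re (fst z) + 1) / 2)))"
    proof (rule continuous_on_compose2 [OF cw])
      show "(\<lambda>z. snd z * ((Re (fst z) + 1) / 2)) ` (?D \<times> {0..1}) \<subseteq> {0..1}"
        by (rule image_subsetI, rule rng) auto
    qed (auto intro!: continuous_intros)
    show "w (snd z * ((Re (fst z) + 1) / 2)) \<in> F\<^sub>0" if "z \<in> ?D \<times> {0..1}" for z
      by (rule w(1), rule rng) (use that in auto)
  qed (auto intro!: continuous_intros)
  have GE: "G (z, t) \<in> E \<and> p (G (z, t)) = \<Phi> z" if "z \<in> ?D" "t \<in> {0..1}" for z t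
    using TD(3,4) [OF that(1) w(1) [OF rng [OF that]]] by (simp add: G_def)
  note V = coherent_vertical_homotopy [OF hc cG GE]
  have G0: "G (z, 0) = h z" for z by (simp add: G_def h_def w0)
  have tr: "transports (M z) (\<lambda>t. G (z, t)) (M z +++ (\<lambda>t. G (z, t)))" if "z \<in> ?D" for z
    using V(2) G0 that by blast
  show thesis
  proof
    show "coherent \<Phi> ?D (\<lambda>z. G (z, 1)) (\<lambda>z. M z +++ (\<lambda>t. G (z, t)))" using V(1) G0 by blast
    fix z assume "z \<in> ?D" "norm z = 1"
    then consider "z = 1" | "z = -1" using D by blast
    then show "G (z, 1) = s (\<Phi> z) \<and> transports (M z +++ (\<lambda>t. G (z, t))) (\<lambda>_. G (z, 1)) (m (\<Phi> z))"
    proof cases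
      case 1
      have G1: "G (1, t) = \<omega> t" if "t \<in> {0..1}" for t using w that by (simp add: G_def)
      have "transports (M 1) \<omega> (M 1 +++ (\<lambda>t. G (1, t)))"
        by (rule transports_eq [OF tr [OF pm(1)]]) (use G1 in auto)
      then show ?thesis using transports_unique [OF _ \<omega>(4)] 1 \<omega>(3) G1 [of 1] by (simp add: pathfinish_def)
    next
      case 2
      have G1: "G (-1, t) = s (\<Phi> (-1))" for t using w0 y by (simp add: G_def)
      have 1: "transports (M (-1)) (\<lambda>_. s (\<Phi> (-1))) (M (-1) +++ (\<lambda>t. G (-1, t)))"
        using tr [OF pm(2)] G1 by simp
      \<comment> \<open>\<open>M (-1)\<close> is \<open>m (\<Phi> (-1))\<close> followed by a
        constant path: a different path, but the same marked point.\<close>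
      have "transports (m (\<Phi> (-1))) (h \<circ> linepath (-1) (-1)) (M (-1))"
        unfolding M_def
        by (rule transports_extend) (use C(2,4) [OF X1(2)] y in \<open>auto simp: h_def pathstart_def path_in_alt\<close>)
      then have 2: "transports (m (\<Phi> (-1))) (\<lambda>_. s (\<Phi> (-1))) (M (-1))"
        by (rule transports_eq) (use y in \<open>simp add: h_def linepath_def algebra_simps flip: scaleR_add_left\<close>)
      show ?thesis
        using transports_sym [OF transports_subst_left [OF 2 1]] \<open>z = -1\<close> G1 by simp
    qed
  qed
qed

text \<open>The boundary values, read in fibre coordinates, form a loop \<open>f\<close> in
  \<open>F\<^sub>0\<close>. Coherence on \<open>X\<close> shows that this loop, moved into the fibre
  over \<open>\<Phi> 1\<close>, transports \<open>m (\<Phi> 1)\<close> to itself, so it is null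
  there and its filling gives the lift.\<close>

lemma coherent_disc2_lift:
  assumes \<Phi>: "continuous_on (disc 2) \<Phi>" "\<Phi> ` disc 2 \<subseteq> B"
    and X: "coherent (\<lambda>x. x) X s m" and bd: "\<And>z. norm z = 1 \<Longrightarrow> \<Phi> z \<in> X"
  obtains g M where "coherent \<Phi> (disc 2) g M"
    "\<And>z. norm z = 1 \<Longrightarrow> g z = s (\<Phi> z) \<and> transports (M z) (\<lambda>_. g z) (m (\<Phi> z))"
proof -
  let ?D = "disc 2"
  note C = coherentD [OF X]
  have D: "z \<in> ?D" if "norm z = 1" for z using that by (simp add: disc_def)
  obtain T T' where T: "trivialisation E p F\<^sub>0 \<Phi> ?D T T'"
    using fibre_bundle_trivial_over_convex [OF fibration convex_disc compact_disc \<Phi>]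
    by (auto simp: trivial_over_def)
  note TD = trivialisationD [OF T] and Tc = trivialisation_continuous [OF T] and Tc' = trivialisation_continuous' [OF T]
  define f where "f z = T' (z, s (\<Phi> z))" for z
  have f: "f z \<in> F\<^sub>0" "T (z, f z) = s (\<Phi> z)" if "norm z = 1" for z
    unfolding f_def using TD(6,7) [OF D [OF that]] bd [OF that] C by auto
  have cf: "continuous_on (sphere 0 1) f"
    unfolding f_def
    by (intro Tc' continuous_on_compose2 [OF C(1)] continuous_on_subset [OF \<Phi>(1)] continuous_intros)
      (use D bd C in auto)
  have cf': "continuous_on A (\<lambda>t. f (circle (g t)))" if "continuous_on A g" for A and g :: "'x::topological_space \<Rightarrow> real"
    by (rule continuous_on_compose2 [OF cf]) (use that in \<open>auto intro!: continuous_intros\<close>)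
  define \<omega> where "\<omega> t = T (1, f (circle t))" for t
  have one: "1 \<in> ?D" by (simp add: disc_def)
  have \<omega>: "path_in {z \<in> E. p z = \<Phi> 1} \<omega>"
    unfolding path_in_alt \<omega>_def using TD(3,4) one f
    by (auto intro!: Tc continuous_intros cf')
  have \<omega>ends: "\<omega> 0 = s (\<Phi> 1)" "\<omega> 1 = s (\<Phi> 1)" using f [of 1] by (simp_all add: \<omega>_def)
  have pe: "path_in X (\<lambda>t. \<Phi> (circle t))"
    unfolding path_in_alt using bd D
    by (auto intro!: continuous_on_compose2 [OF \<Phi>(1)] continuous_intros)
  have "transports (m (\<Phi> 1)) (\<lambda>t. s (\<Phi> (circle t))) (m (\<Phi> 1))"
    using C(5) [OF pe] by (simp add: comp_def)
  moreover have "homotopic_paths E (\<lambda>t. s (\<Phi> (circle t))) \<omega>"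
  proof -
    have inD: "of_real (1 - r) * circle t + of_real r \<in> ?D" if "r \<in> {0..1}" for r t
      using norm_triangle_ineq [of "of_real (1 - r) * circle t" "of_real r"] that
      by (simp add: disc_def norm_mult del: of_real_diff)
    \<comment> \<open>Fibre coordinates are kept while the boundary point moves straight to 1. The
      ends stay fixed because the circle begins and ends at 1.\<close>
    let ?h = "\<lambda>z. T (of_real (1 - fst z) * circle (snd z) + of_real (fst z), f (circle (snd z)))"
    show ?thesis
      unfolding homotopic_paths
    proof (intro exI [of _ ?h] conjI ballI)
      show "continuous_on ({0..1} \<times> {0..1}) ?h"
        using f inD by (intro Tc continuous_intros cf') auto
      show "?h \<in> {0..1} \<times> {0..1} \<rightarrow> E" using TD(3) inD f by auto
    qed (use f in \<open>auto simp: \<omega>_def pathstart_def pathfinish_def simp flip: of_real_add of_real_diff\<close>)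
  qed
  ultimately have "transports (m (\<Phi> 1)) \<omega> (m (\<Phi> 1))" by (rule transports_homotopic)
  then have "homotopic_paths {z \<in> E. p z = \<Phi> 1} \<omega> (\<lambda>_. s (\<Phi> 1))"
    using transports_loop_null [OF \<omega>] \<omega>ends by (simp add: pathstart_def pathfinish_def)
  then have "homotopic_paths F\<^sub>0 ((\<lambda>x. T' (1, x)) \<circ> \<omega>) ((\<lambda>x. T' (1, x)) \<circ> (\<lambda>_. s (\<Phi> 1)))"
    by (rule homotopic_paths_continuous_image) (use TD(6) one in \<open>auto intro!: Tc' continuous_intros\<close>)
  moreover have "(\<lambda>x. T' (1, x)) \<circ> \<omega> = (\<lambda>t. f (circle t))"
    using TD(5) [OF one f(1)] by (simp add: \<omega>_def comp_def)
  ultimately obtain k where k: "continuous_on ?D k" "k ` ?D \<subseteq> F\<^sub>0" "\<And>z. norm z = 1 \<Longrightarrow> k z = f z"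
    using null_loop_extends_to_disc [of F\<^sub>0 f "f 1"] by (auto simp: comp_def f_def)
  define g where "g z = T (z, k z)" for z
  have g: "continuous_on ?D g" "\<And>z. z \<in> ?D \<Longrightarrow> g z \<in> E \<and> p (g z) = \<Phi> z"
    unfolding g_def using k TD(3,4) by (auto intro!: Tc continuous_intros simp: image_subset_iff)
  have g_bd: "g z = s (\<Phi> z)" if "norm z = 1" for z using k f that by (simp add: g_def)
  define M where "M z = m (\<Phi> 1) +++ (g \<circ> linepath 1 z)" for z
  have m1: "marking (m (\<Phi> 1)) (g 1)" using C(4) [OF bd [of 1]] g_bd by simp
  have gc: "coherent \<Phi> ?D g M"
    unfolding M_def by (rule coherent_convex [OF convex_disc g one m1])
  have "M 1 = m (\<Phi> 1) +++ (\<lambda>_. g 1)" by (simp add: M_def linepath_refl comp_def)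
  moreover have "transports (m (\<Phi> 1)) (\<lambda>_. g 1) (m (\<Phi> 1) +++ (\<lambda>_. g 1))"
    using m1 marking_in [OF m1] by (intro transports_extend) simp_all
  ultimately have M1: "transports (M 1) (\<lambda>_. g 1) (m (\<Phi> 1))"
    by (simp add: transports_sym)
  show thesis
  proof
    show "coherent \<Phi> ?D g M" by (rule gc)
    fix z :: complex assume z: "norm z = 1"
    \<comment> \<open>Markings at 1 and at \<open>z\<close> are compared along the boundary arc
      between them, on which \<open>g\<close> and \<open>s \<circ> \<Phi>\<close> agree; unique
      transport then identifies the markings at \<open>z\<close>.\<close>
    define a where "a t = circle (t * (Arg2pi z / (2 * pi)))" for t
    have a: "continuous_on {0..1} a" "\<And>t. norm (a t) = 1" "a 0 = 1" "a 1 = z"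
      unfolding a_def using z circle_polar [of z] by (auto intro!: continuous_intros)
    have "path_in ?D a" "path_in X (\<Phi> \<circ> a)"
      using a D bd by (auto simp: path_in_alt comp_def intro!: continuous_on_compose2 [OF \<Phi>(1)])
    then have "transports (M 1) (g \<circ> a) (M z)" "transports (m (\<Phi> 1)) (s \<circ> (\<Phi> \<circ> a)) (m (\<Phi> z))"
      using coherentD(5) [OF gc] C(5) a by fastforce+
    moreover have "s \<circ> (\<Phi> \<circ> a) = g \<circ> a" using g_bd a by auto
    ultimately have "transports (M 1) (g \<circ> a) (M z)" "transports (M 1) (g \<circ> a) (m (\<Phi> z))"
      using transports_subst_left [OF M1] by auto
    then have "transports (M z) (\<lambda>_. g z) (m (\<Phi> z))"
      using transports_unique a(4) by (fastforce simp: pathfinish_def)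
    then show "g z = s (\<Phi> z) \<and> transports (M z) (\<lambda>_. g z) (m (\<Phi> z))" using g_bd z by simp
  qed
qed

text \<open>For a point there is no boundary, so \<open>e\<close> and \<open>\<mu>\<close> are used
  directly. In dimensions 1 and 2 the boundary values are matched first and the value at
  \<open>z0\<close> is corrected afterwards.\<close>

lemma coherent_disc_lift:
  assumes n: "n \<le> 2" and \<Phi>: "continuous_on (disc n) \<Phi>" "\<Phi> ` disc n \<subseteq> B"
    and X: "coherent (\<lambda>x. x) X s m" and bd: "\<And>z. \<lbrakk>z \<in> disc n; norm z = 1\<rbrakk> \<Longrightarrow> \<Phi> z \<in> X"
    and z0: "z0 \<in> disc n" "norm z0 < 1" and e: "p e = \<Phi> z0" "marking \<mu> e"
  obtains g M where "coherent \<Phi> (disc n) g M" "g z0 = e" "transports (M z0) (\<lambda>_. e) \<mu>"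
    "\<And>z. \<lbrakk>z \<in> disc n; norm z = 1\<rbrakk> \<Longrightarrow> g z = s (\<Phi> z) \<and> transports (M z) (\<lambda>_. g z) (m (\<Phi> z))"
proof -
  consider "n = 0" | "n = 1" | "n = 2" using n by linarith
  then show thesis
  proof cases
    case 1
    have D: "disc n = {0}" by (auto simp: 1 disc_def complex_eq_iff)
    have eE: "e \<in> E" using e marking_in by blast
    have "coherent \<Phi> (disc n) (\<lambda>_. e) (\<lambda>_. \<mu>)"
      using e eE z0 D transports_refl [OF e(2)] by (auto simp: coherent_def comp_def)
    then show thesis using transports_refl [OF e(2)] D by (intro that) auto
  next
    case 2
    obtain g M where g: "coherent \<Phi> (disc n) g M"
      "\<And>z. \<lbrakk>z \<in> disc n; norm z = 1\<rbrakk> \<Longrightarrow> g z = s (\<Phi> z) \<and> transports (M z) (\<lambda>_. g z) (m (\<Phi> z))"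
      using coherent_disc1_lift [OF \<Phi> [unfolded 2] X] bd 2 by auto
    obtain g' M' where g': "coherent \<Phi> (disc n) g' M'" "g' z0 = e" "transports (M' z0) (\<lambda>_. e) \<mu>"
      "\<And>z. \<lbrakk>z \<in> disc n; norm z = 1\<rbrakk> \<Longrightarrow> g' z = g z \<and> transports (M' z) (\<lambda>_. g z) (M z)"
      using coherent_prescribe_interior_point [OF \<Phi> g(1) z0 marking_in [OF e(2)] e] by blast
    show thesis
    proof (rule that [OF g'(1-3)])
      fix z assume z: "z \<in> disc n" "norm z = 1"
      show "g' z = s (\<Phi> z) \<and> transports (M' z) (\<lambda>_. g' z) (m (\<Phi> z))"
        using g(2) [of z] g'(4) [OF z] transports_subst_left [of "M' z" "g z" "M z" "\<lambda>_. g z"] z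
        by metis
    qed
  next
    case 3
    obtain g M where g: "coherent \<Phi> (disc n) g M"
      "\<And>z. \<lbrakk>z \<in> disc n; norm z = 1\<rbrakk> \<Longrightarrow> g z = s (\<Phi> z) \<and> transports (M z) (\<lambda>_. g z) (m (\<Phi> z))"
      using coherent_disc2_lift [OF \<Phi> [unfolded 3] X] bd 3 by (auto simp: disc_def)
    obtain g' M' where g': "coherent \<Phi> (disc n) g' M'" "g' z0 = e" "transports (M' z0) (\<lambda>_. e) \<mu>"
      "\<And>z. \<lbrakk>z \<in> disc n; norm z = 1\<rbrakk> \<Longrightarrow> g' z = g z \<and> transports (M' z) (\<lambda>_. g z) (M z)"
      using coherent_prescribe_interior_point [OF \<Phi> g(1) z0 marking_in [OF e(2)] e] by blast
    show thesis
    proof (rule that [OF g'(1-3)])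
      fix z assume z: "z \<in> disc n" "norm z = 1"
      show "g' z = s (\<Phi> z) \<and> transports (M' z) (\<lambda>_. g' z) (m (\<Phi> z))"
        using g(2) [of z] g'(4) [OF z] transports_subst_left [of "M' z" "g z" "M z" "\<lambda>_. g z"] z
        by metis
    qed
  qed
qed

end

section \<open>Attaching cells\<close>

text \<open>The library's \<^const>\<open>subpath\<close> is confined to normed vector spaces.\<close>

definition segment_of_path :: "real \<Rightarrow> real \<Rightarrow> (real \<Rightarrow> 'a) \<Rightarrow> real \<Rightarrow> 'a" where
  "segment_of_path a b q t = q ((b - a) * t + a)"

lemma affine_in_Icc:
  fixes a b t :: real
  assumes "a \<le> b" "t \<in> {0..1}"
  shows "(b - a) * t + a \<in> {a..b}"
  using assms mult_left_le [of t "b - a"] by auto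

lemma path_avoids_closed_nearby:
  fixes q :: "real \<Rightarrow> 'a::topological_space"
  assumes q: "continuous_on {0..1} q" and C: "closed C" and t: "t \<in> {0..1}" "q t \<notin> C"
  obtains d where "d > 0" "\<And>t'. \<lbrakk>t' \<in> {0..1}; \<bar>t' - t\<bar> < d\<rbrakk> \<Longrightarrow> q t' \<notin> C"
proof -
  have "open (- C)" using C by auto
  then obtain A where A: "open A" "A \<inter> {0..1} = q -` (- C) \<inter> {0..1}"
    using q unfolding continuous_on_open_invariant by metis
  then have "t \<in> A" using t by auto
  then obtain d where d: "d > 0" "ball t d \<subseteq> A" using A(1) openE by blast
  show thesis
  proof (rule that [OF d(1)])
    fix t' :: real assume "t' \<in> {0..1}" "\<bar>t' - t\<bar> < d"
    then have "t' \<in> A \<inter> {0..1}" using d by (auto simp: subset_iff dist_real_def)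
    then show "q t' \<notin> C" using A by auto
  qed
qed

context split_bundle
begin

text \<open>Transports along consecutive segments compose, so a condition on short segments
  suffices; \<open>Bolzano\<close> supplies the subdivision.\<close>

lemma transports_local:
  assumes q: "path_in Y q" and s: "continuous_on Y s" "s ` Y \<subseteq> E" and m: "\<And>x. x \<in> Y \<Longrightarrow> marking (m x) (s x)"
    and local: "\<And>t. t \<in> {0..1} \<Longrightarrow> \<exists>d>0. \<forall>a b. 0 \<le> a \<and> a \<le> t \<and> t \<le> b \<and> b \<le> 1 \<and> b - a < d \<longrightarrow>
        transports (m (q a)) (s \<circ> segment_of_path a b q) (m (q b))"
  shows "transports (m (q 0)) (s \<circ> q) (m (q 1))"
proof -
  \<comment> \<open>The guard makes \<open>P\<close> vacuous for intervals leaving the unit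
    interval, which the local hypothesis of \<open>Bolzano\<close> also ranges over.\<close>
  define P where "P a b \<longleftrightarrow> (0 \<le> a \<and> b \<le> 1 \<longrightarrow> transports (m (q a)) (s \<circ> segment_of_path a b q) (m (q b)))" for a b
  have cq: "continuous_on {0..1} q" and qY: "\<And>t. t \<in> {0..1} \<Longrightarrow> q t \<in> Y" using q by (auto simp: path_in_alt)
  have csq: "continuous_on {0..1} (\<lambda>t. s (q t))"
    by (rule continuous_on_compose2 [OF s(1) cq]) (use qY in auto)
  have "P 0 1"
  proof (rule Bolzano)
    fix a b c :: real assume P: "P a b" "P b c" and le: "a \<le> b" "b \<le> c"
    show "P a c"
      unfolding P_def
    proof (intro impI)
      assume ac: "0 \<le> a \<and> c \<le> 1"
      let ?l = "\<lambda>(a::real) b t. (b - a) * t + a"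
      have l: "path_in {0..1} (?l u v)" if "0 \<le> u" "u \<le> v" "v \<le> 1" for u v
        using affine_in_Icc [OF that(2)] that by (force simp: path_in_alt intro!: continuous_intros)
      have ends: "pathstart (?l u v) = u" "pathfinish (?l u v) = v" for u v
        by (simp_all add: pathstart_def pathfinish_def)
      have "transports (m (q a)) ((s \<circ> segment_of_path a b q) +++ (s \<circ> segment_of_path b c q)) (m (q c))"
        using P ac le by (intro transports_join [of _ _ "m (q b)"]) (auto simp: P_def)
      then have 1: "transports (m (q a)) ((\<lambda>t. s (q t)) \<circ> (?l a b +++ ?l b c)) (m (q c))"
        unfolding path_compose_join by (simp add: segment_of_path_def comp_def)
      have "homotopic_paths E ((\<lambda>t. s (q t)) \<circ> (?l a b +++ ?l b c)) ((\<lambda>t. s (q t)) \<circ> ?l a c)"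
      proof (rule homotopic_paths_convex_image [of "{0..1}"])
        show "path_in {0..1} (?l a b +++ ?l b c)"
          by (intro path_in_join l) (use ac le ends in auto)
        show "path_in {0..1} (?l a c)" by (intro l) (use ac le in auto)
        show "(\<lambda>t. s (q t)) ` {0..1} \<subseteq> E" using s qY by auto
      qed (use csq ends in auto)
      from transports_homotopic [OF 1 this]
      show "transports (m (q a)) (s \<circ> segment_of_path a c q) (m (q c))"
        by (simp add: segment_of_path_def comp_def)
    qed
  next
    fix t :: real assume "0 \<le> t" "t \<le> 1"
    then obtain d where "d > 0" "\<forall>a b. 0 \<le> a \<and> a \<le> t \<and> t \<le> b \<and> b \<le> 1 \<and> b - a < d \<longrightarrow>
        transports (m (q a)) (s \<circ> segment_of_path a b q) (m (q b))"
      using local [of t] by auto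
    then show "\<exists>d>0. \<forall>a b. a \<le> t \<and> t \<le> b \<and> b - a < d \<longrightarrow> P a b"
      by (auto simp: P_def intro!: exI [of _ d])
  qed simp
  then show ?thesis by (simp add: P_def segment_of_path_def comp_def)
qed

text \<open>A short piece of a path avoids either \<open>X\<close> or the centre
  \<open>\<Phi> 0\<close>. In the first case it lies in the open cell and lifts to the disc; in the
  second it is pushed radially into \<open>X\<close>. In both cases the transport is already
  known.\<close>

lemma coherent_attach_cell:
  assumes B: "Hausdorff_space (top_of_set B)"
    and X: "compact X" "X \<subseteq> B" and c: "coherent (\<lambda>x. x) X s m"
    and \<Phi>: "continuous_on (disc n) \<Phi>" "\<Phi> ` disc n \<subseteq> B" "inj_on \<Phi> {z \<in> disc n. norm z < 1}"
    and disj: "\<And>z. \<lbrakk>z \<in> disc n; norm z < 1\<rbrakk> \<Longrightarrow> \<Phi> z \<notin> X"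
    and bd: "\<And>z. \<lbrakk>z \<in> disc n; norm z = 1\<rbrakk> \<Longrightarrow> \<Phi> z \<in> X"
    and g: "coherent \<Phi> (disc n) g M"
    and compat: "\<And>z. \<lbrakk>z \<in> disc n; norm z = 1\<rbrakk> \<Longrightarrow> g z = s (\<Phi> z) \<and> transports (M z) (\<lambda>_. g z) (m (\<Phi> z))"
  obtains s' m' where "coherent (\<lambda>x. x) (X \<union> \<Phi> ` disc n) s' m'"
    "\<And>x. x \<in> X \<Longrightarrow> s' x = s x \<and> m' x = m x"
    "\<And>z. z \<in> disc n \<Longrightarrow> s' (\<Phi> z) = g z \<and> transports (M z) (\<lambda>_. g z) (m' (\<Phi> z))"
proof -
  let ?D = "disc n"
  let ?Y = "X \<union> \<Phi> ` ?D"
  note C = coherentD [OF c] and CD = coherentD [OF g]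
  define \<Psi> where "\<Psi> y = (THE z. z \<in> ?D \<and> norm z < 1 \<and> \<Phi> z = y)" for y
  have \<Psi>: "\<Psi> (\<Phi> z) = z" if "z \<in> ?D" "norm z < 1" for z
    unfolding \<Psi>_def using \<Phi>(3) that by (intro the_equality) (auto simp: inj_on_def)
  have bd': "norm z = 1" if "z \<in> ?D" "\<Phi> z \<in> X" for z
    using disj [OF that(1)] norm_disc [OF that(1)] that(2) by force
  have int: "norm z < 1" if "z \<in> ?D" "\<Phi> z \<notin> X" for z
    using bd [OF that(1)] norm_disc [OF that(1)] that(2) by force
  define s' where "s' y = (if y \<in> X then s y else g (\<Psi> y))" for y
  define m' where "m' y = (if y \<in> X then m y else M (\<Psi> y))" for y
  have s'X: "s' x = s x" "m' x = m x" if "x \<in> X" for x using that by (auto simp: s'_def m'_def)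
  have s'\<Phi>: "s' (\<Phi> z) = g z" if "z \<in> ?D" for z
    using compat [of z] bd' [of z] \<Psi> [of z] int [of z] that by (auto simp: s'_def)
  have m'\<Phi>: "transports (M z) (\<lambda>_. g z) (m' (\<Phi> z))" if "z \<in> ?D" for z
    using compat [of z] bd' [of z] \<Psi> [of z] int [of z] that transports_refl [OF CD(4) [OF that]]
    by (auto simp: m'_def)
  have closedin: "closedin (top_of_set B) S" if "compact S" "S \<subseteq> B" for S
    using that by (intro compactin_imp_closedin [OF B]) (simp add: compactin_subtopology)
  have c\<Phi>D: "compact (\<Phi> ` ?D)" by (rule compact_continuous_image [OF \<Phi>(1) compact_disc])
  have YB: "?Y \<subseteq> B" using X \<Phi> by auto
  \<comment> \<open>The ambient type need not be Hausdorff. \<open>X\<close> and the centre are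
    closed only within \<open>B\<close>, so they are cut out by closed sets of the whole type, as
    \<open>path_avoids_closed_nearby\<close> expects.\<close>
  obtain CX where CX: "closed CX" "X = B \<inter> CX" using closedin [OF X] by (auto simp: closedin_closed)
  have "closedin (top_of_set B) {\<Phi> 0}" by (rule closedin) (use \<Phi> in auto)
  then obtain C0 where C0: "closed C0" "{\<Phi> 0} = B \<inter> C0" by (auto simp: closedin_closed)
  have clY: "closedin (top_of_set ?Y) X" "closedin (top_of_set ?Y) (\<Phi> ` ?D)"
    using closedin_subset_trans [OF closedin [OF X] _ YB] closedin_subset_trans [OF closedin [OF c\<Phi>D \<Phi>(2)] _ YB]
    by auto
  \<comment> \<open>\<open>\<Psi>\<close> inverts \<open>\<Phi>\<close> only on the open cell, so it
    cannot give continuity on the closed one. Instead \<open>s'\<close> pulls back to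
    \<open>g\<close> on the disc, and \<open>\<Phi>\<close> is a quotient map onto its
    image.\<close>
  have cs'D: "continuous_on (\<Phi> ` ?D) s'"
  proof (rule continuous_on_quotient_of_compact [OF compact_disc \<Phi>(1,2) B])
    show "continuous_on {z \<in> ?D. \<Phi> z \<in> \<Phi> ` ?D} (\<lambda>z. s' (\<Phi> z))"
      by (rule continuous_on_eq [OF continuous_on_subset [OF CD(1)]]) (use s'\<Phi> in auto)
  qed simp
  have cs'X: "continuous_on X s'"
    by (rule continuous_on_eq [OF C(1)]) (use s'X in auto)
  have cs': "continuous_on ?Y s'"
    using continuous_on_Un_local [OF clY cs'X cs'D] .
  have s'E: "s' y \<in> E \<and> p (s' y) = y \<and> marking (m' y) (s' y)" if y: "y \<in> ?Y" for y
  proof (cases "y \<in> X")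
    case True then show ?thesis using C s'X by auto
  next
    case False
    then obtain z where z: "z \<in> ?D" "y = \<Phi> z" "norm z < 1" using y False int by auto
    then show ?thesis using CD s'\<Phi> [OF z(1)] False \<Psi> by (auto simp: m'_def)
  qed
  have avoid_X: "transports (m' (q 0)) (s' \<circ> q) (m' (q 1))"
    if q: "path_in ?Y q" and qX: "\<And>t. t \<in> {0..1} \<Longrightarrow> q t \<notin> X" for q
  proof -
    let ?W = "\<Phi> ` {z \<in> ?D. norm z < 1}"
    have c\<Psi>: "continuous_on ?W \<Psi>"
    proof (rule continuous_on_quotient_of_compact [OF compact_disc \<Phi>(1,2) B])
      have "norm z < 1" if "z \<in> ?D" "\<Phi> z \<in> ?W" for z using that disj int by auto
      then show "continuous_on {z \<in> ?D. \<Phi> z \<in> ?W} (\<lambda>z. \<Psi> (\<Phi> z))"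
        by (intro continuous_on_eq [OF continuous_on_id]) (auto simp: \<Psi>)
    qed auto
    have qW: "q t \<in> ?W" if t: "t \<in> {0..1}" for t
    proof -
      have "q t \<in> ?Y" using q t by (simp add: path_in_alt)
      then obtain z where "z \<in> ?D" "q t = \<Phi> z" using qX [OF t] by auto
      then show ?thesis using int [of z] qX [OF t] by auto
    qed
    have "continuous_on {0..1} q" using q by (simp add: path_in_alt)
    then have "continuous_on {0..1} (\<lambda>t. \<Psi> (q t))"
      by (rule continuous_on_compose2 [OF c\<Psi>]) (rule image_subsetI, rule qW)
    moreover have "\<Psi> (q t) \<in> ?D" if "t \<in> {0..1}" for t using qW [OF that] \<Psi> by auto
    ultimately have "path_in ?D (\<lambda>t. \<Psi> (q t))" by (simp add: path_in_alt)
    from CD(5) [OF this] have 1: "transports (M (\<Psi> (q 0))) (\<lambda>t. g (\<Psi> (q t))) (M (\<Psi> (q 1)))"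
      by (simp add: comp_def)
    have "s' (q t) = g (\<Psi> (q t))" "m' (q t) = M (\<Psi> (q t))" if "t \<in> {0..1}" for t
      using qX [OF that] by (auto simp: s'_def m'_def)
    then show ?thesis using transports_eq [OF 1] by simp
  qed
  have avoid_0: "transports (m' (q 0)) (s' \<circ> q) (m' (q 1))"
    if q: "path_in ?Y q" and q0: "\<And>t. t \<in> {0..1} \<Longrightarrow> q t \<noteq> \<Phi> 0" for q
  proof -
    let ?U = "?Y - {\<Phi> 0}" and ?I = "{0..1::real}"
    \<comment> \<open>the radial deformation of the complement of the centre of the cell\<close>
    define push where "push \<tau> z = (1 - \<tau> + \<tau> / norm z) *\<^sub>R z" for \<tau> and z :: complex
    define h where "h w = (if snd w \<in> X then snd w else \<Phi> (push (fst w) (\<Psi> (snd w))))" for w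
    have norm_push: "norm (push \<tau> z) = (1 - \<tau>) * norm z + \<tau>" if "z \<noteq> 0" "\<tau> \<in> ?I" for \<tau> z
    proof -
      have "norm (push \<tau> z) = (1 - \<tau> + \<tau> / norm z) * norm z" using that by (simp add: push_def)
      also have "\<dots> = (1 - \<tau>) * norm z + \<tau>" using that by (simp add: distrib_right)
      finally show ?thesis .
    qed
    have push1: "push \<tau> z = z" if "norm z = 1" for \<tau> z using that by (simp add: push_def)
    have push0: "push 0 z = z" for z by (simp add: push_def)
    have pushD: "push \<tau> z \<in> ?D" if "z \<in> ?D" "z \<noteq> 0" "\<tau> \<in> ?I" for \<tau> z
    proof -
      have "norm (push \<tau> z) \<le> 1"
        unfolding norm_push [OF that(2,3)] using that norm_disc [OF that(1)] mult_left_le [of "norm z" "1 - \<tau>"]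
        by auto
      then show ?thesis unfolding push_def by (intro scaleR_in_disc that(1))
    qed
    have h\<Phi>: "h (\<tau>, \<Phi> z) = \<Phi> (push \<tau> z)" if "z \<in> ?D" for \<tau> z
      using that bd' [of z] \<Psi> [of z] int [of z] push1 by (auto simp: h_def)
    have cpush: "continuous_on (?I \<times> (?D - {0})) (\<lambda>w. push (fst w) (snd w))"
      unfolding push_def by (intro continuous_intros) auto
    have hX: "h (\<tau>, y) = y" if "y \<in> X" for \<tau> y using that by (simp add: h_def)
    have "continuous_on (?I \<times> (X - {\<Phi> 0}) \<union> ?I \<times> (\<Phi> ` ?D - {\<Phi> 0})) h"
    proof (rule continuous_on_Un_local)
      have cl: "closedin (top_of_set (?I \<times> A)) (?I \<times> (A \<inter> S))" if "closed S" for A S :: "'b set"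
      proof -
        have "?I \<times> (A \<inter> S) = (?I \<times> A) \<inter> (UNIV \<times> S)" by auto
        then show ?thesis using closedin_closed_Int [of "UNIV \<times> S" "?I \<times> A"] that by (simp add: closed_Times)
      qed
      have eq: "?I \<times> (X - {\<Phi> 0}) \<union> ?I \<times> (\<Phi> ` ?D - {\<Phi> 0}) = ?I \<times> ?U" by auto
      obtain CD where CD: "closed CD" "\<Phi> ` ?D = B \<inter> CD"
        using closedin [OF c\<Phi>D \<Phi>(2)] by (auto simp: closedin_closed)
      have "X - {\<Phi> 0} = ?U \<inter> CX" "\<Phi> ` ?D - {\<Phi> 0} = ?U \<inter> CD" using CX CD YB by auto
      then show "closedin (top_of_set (?I \<times> (X - {\<Phi> 0}) \<union> ?I \<times> (\<Phi> ` ?D - {\<Phi> 0}))) (?I \<times> (X - {\<Phi> 0}))"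
        "closedin (top_of_set (?I \<times> (X - {\<Phi> 0}) \<union> ?I \<times> (\<Phi> ` ?D - {\<Phi> 0}))) (?I \<times> (\<Phi> ` ?D - {\<Phi> 0}))"
        unfolding eq using cl CX(1) CD(1) by metis+
      show "continuous_on (?I \<times> (X - {\<Phi> 0})) h"
        by (rule continuous_on_eq [of _ snd]) (auto intro!: continuous_intros simp: hX)
      show "continuous_on (?I \<times> (\<Phi> ` ?D - {\<Phi> 0})) h"
      \<comment> \<open>The deformation must be continuous jointly in time and point, so the
        quotient argument is applied to the product of \<open>\<Phi>\<close> with the interval. The
        preimage in question omits the centre, where \<open>push\<close> is singular.\<close>
      proof (rule continuous_on_quotient_of_compact [where K = "?I \<times> ?D" and f = "\<lambda>w. (fst w, \<Phi> (snd w))" and Y = "?I \<times> B"])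
        show "compact (?I \<times> ?D)" by (intro compact_Times compact_Icc compact_disc)
        show "continuous_on (?I \<times> ?D) (\<lambda>w. (fst w, \<Phi> (snd w)))"
          by (intro continuous_intros continuous_on_compose2 [OF \<Phi>(1)]) auto
        show "Hausdorff_space (top_of_set (?I \<times> B))"
          using B unfolding prod_topology_subtopology_eu [symmetric] Hausdorff_space_prod_topology
          by (simp add: Hausdorff_space_subtopology)
        have "continuous_on (?I \<times> (?D - {0})) (\<lambda>w. \<Phi> (push (fst w) (snd w)))"
          by (rule continuous_on_compose2 [OF \<Phi>(1) cpush]) (rule image_subsetI, rule pushD, auto)
        then show "continuous_on {w \<in> ?I \<times> ?D. (fst w, \<Phi> (snd w)) \<in> ?I \<times> (\<Phi> ` ?D - {\<Phi> 0})}
            (\<lambda>w. h (fst w, \<Phi> (snd w)))"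
          by (rule continuous_on_eq [OF continuous_on_subset]) (auto intro!: h\<Phi> [symmetric])
        show "?I \<times> (\<Phi> ` ?D - {\<Phi> 0}) \<subseteq> (\<lambda>w. (fst w, \<Phi> (snd w))) ` (?I \<times> ?D)"
          by (force simp: image_iff)
      qed (use \<Phi> in auto)
    qed
    moreover have "?I \<times> (X - {\<Phi> 0}) \<union> ?I \<times> (\<Phi> ` ?D - {\<Phi> 0}) = ?I \<times> ?U" by auto
    ultimately have ch: "continuous_on (?I \<times> ?U) h" by simp
    have hh: "h (\<tau>, y) \<in> ?Y \<and> h (1, y) \<in> X \<and> h (0, y) = y"
      if "y \<in> ?U" "\<tau> \<in> ?I" for \<tau> y
    proof -
      consider "y \<in> X" | z where "z \<in> ?D" "z \<noteq> 0" "y = \<Phi> z" using \<open>y \<in> ?U\<close> by auto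
      then show ?thesis
      proof cases
        case 2
        then show ?thesis
          using pushD [of z \<tau>] pushD [of z 1] norm_push [of z 1] bd \<open>\<tau> \<in> ?I\<close> h\<Phi> push0 by auto
      qed (simp add: hX)
    qed
    then have hY: "h (\<tau>, y) \<in> ?Y" if "y \<in> ?U" "\<tau> \<in> ?I" for \<tau> y using that by blast
    have h1: "h (1, y) \<in> X" and h0: "h (0, y) = y" if "y \<in> ?U" for y
      using hh [OF that, of 0] by auto
    have qU: "q t \<in> ?U" if "t \<in> ?I" for t using q q0 [OF that] that by (auto simp: path_in_alt)
    have cq: "continuous_on ?I q" using q by (simp add: path_in_alt)
    \<comment> \<open>The radial track of a point relates its marking to that of its image in
      \<open>X\<close>: constant on \<open>X\<close>, and read off from coherence of
      \<open>g\<close> inside the disc.\<close>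
    have side: "transports (m' y) (\<lambda>\<tau>. s' (h (\<tau>, y))) (m' (h (1, y)))" if y: "y \<in> ?U" for y
    proof -
      consider "y \<in> X" | z where "z \<in> ?D" "z \<noteq> 0" "y = \<Phi> z" using y by auto
      then show ?thesis
      proof cases
        case 1
        then show ?thesis using s'E [of y] by (auto simp: hX intro: transports_refl)
      next
        case 2
        have "path_in ?D (\<lambda>\<tau>. push \<tau> z)"
          unfolding path_in_alt using 2 pushD by (auto simp: push_def intro!: continuous_intros)
        from CD(5) [OF this] have "transports (M z) (\<lambda>\<tau>. g (push \<tau> z)) (M (push 1 z))"
          by (simp add: comp_def push0)
        then have "transports (M z) (\<lambda>\<tau>. s' (h (\<tau>, y))) (M (push 1 z))"
          by (rule transports_eq) (use 2 s'\<Phi> pushD h\<Phi> in auto)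
        with transports_sym [OF m'\<Phi> [OF 2(1)]]
        have "transports (m' y) (\<lambda>\<tau>. s' (h (\<tau>, y))) (M (push 1 z))"
          unfolding 2(3) by (rule transports_subst_left)
        moreover have "transports (M (push 1 z)) (\<lambda>_. g (push 1 z)) (m' (h (1, y)))"
          using m'\<Phi> [OF pushD [of z 1]] 2 h\<Phi> by simp
        ultimately show ?thesis by (rule transports_subst_right)
      qed
    qed
    let ?G = "\<lambda>w. s' (h (snd w, q (fst w)))"
    \<comment> \<open>In the square swept out by pushing \<open>q\<close>, two sides are radial
      tracks and the far side lies in \<open>X\<close>, where \<open>c\<close> applies.\<close>
    have "transports (m' (q 0)) (\<lambda>t. ?G (t, 0)) (m' (q 1))"
    proof (rule transports_square)
      have w: "fst w \<in> ?I" "snd w \<in> ?I" if "w \<in> ?I \<times> ?I" for w using that by auto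
      have hqY: "h (snd w, q (fst w)) \<in> ?Y" if "w \<in> ?I \<times> ?I" for w
        by (rule hY [OF qU [OF w(1) [OF that]] w(2) [OF that]])
      have "continuous_on (?I \<times> ?I) (\<lambda>w. (snd w, q (fst w)))"
        by (intro continuous_intros continuous_on_compose2 [OF cq]) auto
      then have "continuous_on (?I \<times> ?I) (\<lambda>w. h (snd w, q (fst w)))"
        by (rule continuous_on_compose2 [OF ch]) (intro image_subsetI SigmaI w(2) qU w(1))
      then show "continuous_on (?I \<times> ?I) ?G"
        by (rule continuous_on_compose2 [OF cs']) (rule image_subsetI, rule hqY)
      show "?G ` (?I \<times> ?I) \<subseteq> E" using s'E [OF hqY] by (intro image_subsetI) simp
      show "transports (m' (q 0)) (\<lambda>t. ?G (0, t)) (m' (h (1, q 0)))"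
        "transports (m' (q 1)) (\<lambda>t. ?G (1, t)) (m' (h (1, q 1)))"
        using side qU by simp_all
      have "continuous_on ?I (\<lambda>t. h (1, q t))"
        by (rule continuous_on_compose2 [OF ch]) (intro continuous_intros cq, intro image_subsetI SigmaI qU, auto)
      then have pX: "path_in X (\<lambda>t. h (1, q t))" using h1 qU by (auto simp: path_in_alt)
      then have hX1: "h (1, q t) \<in> X" if "t \<in> ?I" for t using that by (simp add: path_in_alt)
      have "transports (m (h (1, q 0))) (\<lambda>t. ?G (t, 1)) (m (h (1, q 1)))"
        by (rule transports_eq [OF C(5) [OF pX]]) (use s'X hX1 in simp)
      then show "transports (m' (h (1, q 0))) (\<lambda>t. ?G (t, 1)) (m' (h (1, q 1)))"
        using s'X hX1 [of 0] hX1 [of 1] by simp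
    qed
    then show ?thesis by (rule transports_eq) (use h0 qU in auto)
  qed
  have "transports (m' (q 0)) (s' \<circ> q) (m' (q 1))" if q: "path_in ?Y q" for q
  proof (rule transports_local [OF q cs'])
    show "s' ` ?Y \<subseteq> E" "\<And>x. x \<in> ?Y \<Longrightarrow> marking (m' x) (s' x)" using s'E by auto
    have cq: "continuous_on {0..1} q" and qY: "\<And>t. t \<in> {0..1} \<Longrightarrow> q t \<in> ?Y" using q by (auto simp: path_in_alt)
    have ends: "segment_of_path a b q 0 = q a" "segment_of_path a b q 1 = q b" for a b by (simp_all add: segment_of_path_def)
    have sub: "path_in ?Y (segment_of_path a b q)" "\<And>t'. t' \<in> {0..1} \<Longrightarrow> \<exists>u\<in>{a..b}. segment_of_path a b q t' = q u"
      if "0 \<le> a" "a \<le> b" "b \<le> 1" for a b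
    proof -
      show *: "\<exists>u\<in>{a..b}. segment_of_path a b q t' = q u" if "t' \<in> {0..1}" for t'
        using affine_in_Icc [OF \<open>a \<le> b\<close> that] by (auto simp: segment_of_path_def)
      have "continuous_on {0..1} (segment_of_path a b q)"
        unfolding segment_of_path_def
        by (rule continuous_on_compose2 [OF cq])
          (use affine_in_Icc [OF \<open>a \<le> b\<close>] that in \<open>force intro!: continuous_intros\<close>)+
      moreover have "segment_of_path a b q t' \<in> ?Y" if t': "t' \<in> {0..1}" for t'
      proof -
        obtain u where "u \<in> {a..b}" "segment_of_path a b q t' = q u" using * [OF t'] by blast
        then show ?thesis using qY [of u] \<open>0 \<le> a\<close> \<open>b \<le> 1\<close> by auto
      qed
      ultimately show "path_in ?Y (segment_of_path a b q)" by (simp add: path_in_alt)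
    qed
    fix t :: real assume t: "t \<in> {0..1}"
    show "\<exists>d>0. \<forall>a b. 0 \<le> a \<and> a \<le> t \<and> t \<le> b \<and> b \<le> 1 \<and> b - a < d \<longrightarrow>
        transports (m' (q a)) (s' \<circ> segment_of_path a b q) (m' (q b))"
    proof (cases "q t \<in> X")
      case False
      then have "q t \<notin> CX" using CX qY [OF t] YB by auto
      then obtain d where d: "d > 0" "\<And>t'. \<lbrakk>t' \<in> {0..1}; \<bar>t' - t\<bar> < d\<rbrakk> \<Longrightarrow> q t' \<notin> CX"
        using path_avoids_closed_nearby [OF cq CX(1) t] by metis
      show ?thesis
      proof (intro exI [of _ d] conjI allI impI d(1))
        fix a b assume ab: "0 \<le> a \<and> a \<le> t \<and> t \<le> b \<and> b \<le> 1 \<and> b - a < d"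
        have "segment_of_path a b q t' \<notin> X" if t': "t' \<in> {0..1}" for t'
        proof -
          obtain u where u: "u \<in> {a..b}" "segment_of_path a b q t' = q u" using sub(2) [of a b t'] ab t' by auto
          then have "u \<in> {0..1}" "\<bar>u - t\<bar> < d" using ab by (auto simp: abs_less_iff)
          then show ?thesis using d(2) [of u] u(2) CX by auto
        qed
        then show "transports (m' (q a)) (s' \<circ> segment_of_path a b q) (m' (q b))"
          using avoid_X [of "segment_of_path a b q"] sub(1) [of a b] ab ends by auto
      qed
    next
      case True
      then have "q t \<notin> C0" using disj [of 0] C0 X by force
      then obtain d where d: "d > 0" "\<And>t'. \<lbrakk>t' \<in> {0..1}; \<bar>t' - t\<bar> < d\<rbrakk> \<Longrightarrow> q t' \<notin> C0"
        using path_avoids_closed_nearby [OF cq C0(1) t] by metis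
      show ?thesis
      proof (intro exI [of _ d] conjI allI impI d(1))
        fix a b assume ab: "0 \<le> a \<and> a \<le> t \<and> t \<le> b \<and> b \<le> 1 \<and> b - a < d"
        have "segment_of_path a b q t' \<noteq> \<Phi> 0" if t': "t' \<in> {0..1}" for t'
        proof -
          obtain u where u: "u \<in> {a..b}" "segment_of_path a b q t' = q u" using sub(2) [of a b t'] ab t' by auto
          then have "u \<in> {0..1}" "\<bar>u - t\<bar> < d" using ab by (auto simp: abs_less_iff)
          then show ?thesis using d(2) [of u] u(2) C0 by auto
        qed
        then show "transports (m' (q a)) (s' \<circ> segment_of_path a b q) (m' (q b))"
          using avoid_0 [of "segment_of_path a b q"] sub(1) [of a b] ab ends by auto
      qed
    qed
  qed
  then have "coherent (\<lambda>x. x) ?Y s' m'"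
    unfolding coherent_def using cs' s'E by blast
  then show thesis
    using that s'X s'\<Phi> m'\<Phi> by blast
qed

end

section \<open>Sections over a finite 2-complex\<close>

definition disc_embedding :: "complex \<Rightarrow> nat \<Rightarrow> real" where
  "disc_embedding z = (\<lambda>i. if i = 0 then Re z else if i = 1 then Im z else 0)"

lemma continuous_on_disc_embedding: "continuous_on A disc_embedding"
proof (rule continuous_on_coordinatewise_then_product)
  show "continuous_on A (\<lambda>z. disc_embedding z i)" for i
    by (cases "i = 0"; cases "i = 1") (simp_all add: disc_embedding_def continuous_on_Re continuous_on_Im continuous_on_id)
qed

lemma inj_disc_embedding: "disc_embedding z = disc_embedding w \<Longrightarrow> z = w"
  unfolding disc_embedding_def fun_eq_iff by (metis complex_eqI zero_neq_one)

lemma disc_embedding_image: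
  assumes "n \<le> 2"
  shows "disc_embedding ` disc n = closed_disc n"
    and "disc_embedding ` {z \<in> disc n. norm z < 1} = open_disc n"
    and "disc_embedding ` {z \<in> disc n. norm z = 1} = disc_boundary n"
proof -
  have n: "n = 0 \<or> n = 1 \<or> n = 2" using assms by linarith
  then consider "n = 0" | "n = 1" | "n = 2" by blast
  then have sum: "(\<Sum>i<n. (disc_embedding z i)\<^sup>2) = (norm z)\<^sup>2" if "z \<in> disc n" for z
    using that unfolding cmod_power2 by cases (auto simp: disc_def disc_embedding_def numeral_2_eq_2)
  have zero: "disc_embedding z i = 0" if "z \<in> disc n" "i \<ge> n" for z i
    using that assms by (auto simp: disc_def disc_embedding_def)
  have sq: "(norm z)\<^sup>2 \<le> 1 \<longleftrightarrow> norm z \<le> 1" "(norm z)\<^sup>2 < 1 \<longleftrightarrow> norm z < 1" "(norm z)\<^sup>2 = 1 \<longleftrightarrow> norm z = 1"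
    for z :: complex
    using abs_square_le_1 [of "norm z"] abs_square_less_1 [of "norm z"] abs_square_eq_1 [of "norm z"]
    by auto
  have surj: "\<exists>z\<in>disc n. x = disc_embedding z" if x: "\<forall>i\<ge>n. x i = 0" "(\<Sum>i<n. (x i)\<^sup>2) \<le> 1" for x
  proof -
    let ?z = "Complex (x 0) (x 1)"
    have e: "disc_embedding ?z = x"
      using x(1) assms by (auto simp: disc_embedding_def fun_eq_iff)
    have "n < 2 \<longrightarrow> Im ?z = 0" "n < 1 \<longrightarrow> Re ?z = 0" using x by auto
    moreover have "(norm ?z)\<^sup>2 \<le> 1"
      using n x unfolding cmod_power2 by (auto simp: numeral_2_eq_2)
    ultimately have "?z \<in> disc n" using sq by (simp add: disc_def)
    then show ?thesis using e by metis
  qed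
  have mem: "disc_embedding z \<in> closed_disc n" "disc_embedding z \<in> open_disc n \<longleftrightarrow> norm z < 1"
    "disc_embedding z \<in> disc_boundary n \<longleftrightarrow> norm z = 1" if "z \<in> disc n" for z
    using zero [OF that] norm_disc [OF that] sq [of z]
    by (simp_all add: closed_disc_def open_disc_def disc_boundary_def sum [OF that])
  have sub: "closed_disc n \<subseteq> disc_embedding ` disc n" using surj by (auto simp: closed_disc_def)
  have "open_disc n \<subseteq> closed_disc n" "disc_boundary n \<subseteq> closed_disc n"
    by (auto simp: closed_disc_def open_disc_def disc_boundary_def)
  with sub have sub': "open_disc n \<subseteq> disc_embedding ` disc n" "disc_boundary n \<subseteq> disc_embedding ` disc n"
    by blast+
  show "disc_embedding ` disc n = closed_disc n" using sub mem(1) by blast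
  show "disc_embedding ` {z \<in> disc n. norm z < 1} = open_disc n" using sub'(1) mem(2) by blast
  show "disc_embedding ` {z \<in> disc n. norm z = 1} = disc_boundary n" using sub'(2) mem(3) by blast
qed

context split_bundle
begin

text \<open>Any path from \<open>b\<^sub>0\<close> to \<open>b\<close> is lifted from
  \<open>e\<^sub>0\<close>. This provides a marked point over a cell not containing
  \<open>b\<^sub>0\<close>, in particular over a new vertex.\<close>

lemma exists_marking:
  assumes "path_connected B" "b \<in> B"
  obtains \<mu> e where "marking \<mu> e" "p e = b"
proof -
  obtain c where c: "path_in B c" "pathstart c = b\<^sub>0" "pathfinish c = b"
    using assms b\<^sub>0 unfolding path_connected_def path_in_def by metis
  obtain \<mu> where "path_in E \<mu>" "pathstart \<mu> = e\<^sub>0" "\<And>t. t \<in> {0..1} \<Longrightarrow> p (\<mu> t) = c t"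
    using path_lifting [OF fibration c(1), of e\<^sub>0] c e\<^sub>0 by auto
  then show thesis
    using c by (intro that [of \<mu> "pathfinish \<mu>"]) (auto simp: marking_def pathfinish_def)
qed

text \<open>Induction on the number of cells. \<open>A\<close> contains every cell of dimension
  below that of one of its members, which keeps the boundaries of its cells inside. The condition at
  \<open>b\<^sub>0\<close> fixes the section and its marked point over the base point as soon as the
  cell containing it is reached.\<close>

lemma coherent_section_on_subcomplex:
  assumes CW: "finite_CW_structure B I d \<Phi>" and dim: "\<forall>i\<in>I. d i \<le> 2" and conn: "path_connected B"
    and A: "A \<subseteq> I" "\<forall>i\<in>A. \<forall>j\<in>I. d j < d i \<longrightarrow> j \<in> A"
  shows "\<exists>s m. compact (\<Union>i\<in>A. \<Phi> i ` open_disc (d i)) \<and>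
     coherent (\<lambda>x. x) (\<Union>i\<in>A. \<Phi> i ` open_disc (d i)) s m \<and>
     (b\<^sub>0 \<in> (\<Union>i\<in>A. \<Phi> i ` open_disc (d i)) \<longrightarrow> s b\<^sub>0 = e\<^sub>0 \<and> transports (m b\<^sub>0) (\<lambda>_. e\<^sub>0) (\<lambda>_. e\<^sub>0))"
  using A
proof (induction "card A" arbitrary: A)
  case 0
  moreover have "finite I" using CW by (simp add: finite_CW_structure_def)
  ultimately have "A = {}" using finite_subset by fastforce
  moreover have "\<not> path_in {} q" for q :: "real \<Rightarrow> 'b" using path_in_ends(1) by blast
  ultimately show ?case by (simp add: coherent_def)
next
  case (Suc k)
  have cells: "finite I" "Hausdorff_space (top_of_set B)"
    "\<And>i. i \<in> I \<Longrightarrow> continuous_on (closed_disc (d i)) (\<Phi> i)"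
    "\<And>i. i \<in> I \<Longrightarrow> \<Phi> i ` closed_disc (d i) \<subseteq> B"
    "\<And>i. i \<in> I \<Longrightarrow> inj_on (\<Phi> i) (open_disc (d i))"
    "\<And>i. i \<in> I \<Longrightarrow> \<Phi> i ` disc_boundary (d i) \<subseteq> (\<Union>j\<in>{j\<in>I. d j < d i}. \<Phi> j ` open_disc (d j))"
    "disjoint_family_on (\<lambda>i. \<Phi> i ` open_disc (d i)) I" "(\<Union>i\<in>I. \<Phi> i ` open_disc (d i)) = B"
    using CW by (simp_all add: finite_CW_structure_def)
  have finA: "finite A" using Suc.prems cells(1) finite_subset by blast
  have "A \<noteq> {}" using Suc.hyps by auto
  \<comment> \<open>A cell of largest dimension is removed, so that the rest of \<open>A\<close>
    still satisfies the closure condition.\<close>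
  then have "Max (d ` A) \<in> d ` A" using finA by simp
  then obtain i where i: "i \<in> A" "d i = Max (d ` A)" by auto
  then have imax: "d j \<le> d i" if "j \<in> A" for j using that finA by simp
  have iI: "i \<in> I" using i Suc.prems by auto
  let ?n = "d i"
  have n: "?n \<le> 2" using dim iI by auto
  let ?A = "A - {i}"
  let ?X = "\<Union>j\<in>?A. \<Phi> j ` open_disc (d j)"
  have A': "k = card ?A" "?A \<subseteq> I"
    using Suc.hyps(2) Suc.prems(1) i(1) finA by auto
  have down: "\<forall>j\<in>?A. \<forall>l\<in>I. d l < d j \<longrightarrow> l \<in> ?A"
  proof (intro ballI impI)
    fix j l assume "j \<in> ?A" "l \<in> I" "d l < d j"
    then show "l \<in> ?A" using Suc.prems(2) imax [of j] by auto
  qed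
  obtain s m where sm: "compact ?X" "coherent (\<lambda>x. x) ?X s m"
    "b\<^sub>0 \<in> ?X \<Longrightarrow> s b\<^sub>0 = e\<^sub>0 \<and> transports (m b\<^sub>0) (\<lambda>_. e\<^sub>0) (\<lambda>_. e\<^sub>0)"
    using Suc.hyps(1) [OF A' down] by blast
  let ?\<Psi> = "\<Phi> i \<circ> disc_embedding"
  note im = disc_embedding_image [OF n]
  have \<Psi>im: "?\<Psi> ` disc ?n = \<Phi> i ` closed_disc ?n" "?\<Psi> ` {z \<in> disc ?n. norm z < 1} = \<Phi> i ` open_disc ?n"
     "?\<Psi> ` {z \<in> disc ?n. norm z = 1} = \<Phi> i ` disc_boundary ?n"
    unfolding image_comp [symmetric] im by simp_all
  have c\<Psi>: "continuous_on (disc ?n) ?\<Psi>"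
    by (intro continuous_on_compose continuous_on_disc_embedding) (use im cells(3) [OF iI] in auto)
  have inj: "inj_on ?\<Psi> {z \<in> disc ?n. norm z < 1}"
    using cells(5) [OF iI] inj_disc_embedding unfolding im(2) [symmetric] inj_on_def by auto
  have \<Psi>B: "?\<Psi> ` disc ?n \<subseteq> B" using cells(4) [OF iI] \<Psi>im by simp
  have "\<Phi> i ` open_disc ?n \<inter> \<Phi> j ` open_disc (d j) = {}" if "j \<in> ?A" for j
    using disjoint_family_onD [OF cells(7) iI, of j] that Suc.prems(1) by auto
  then have disj: "?\<Psi> z \<notin> ?X" if "z \<in> disc ?n" "norm z < 1" for z
  proof -
    have "?\<Psi> z \<in> \<Phi> i ` open_disc ?n" unfolding \<Psi>im(2) [symmetric] using that by blast
    then show ?thesis using \<open>\<And>j. j \<in> ?A \<Longrightarrow> _\<close> by blast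
  qed
  have "{j \<in> I. d j < ?n} \<subseteq> ?A" using Suc.prems(2) i by auto
  then have bdX: "\<Phi> i ` disc_boundary ?n \<subseteq> ?X" using cells(6) [OF iI] by blast
  then have bd: "?\<Psi> z \<in> ?X" if "z \<in> disc ?n" "norm z = 1" for z
    using that unfolding \<Psi>im(3) [symmetric] by blast
  have "closed_disc ?n = open_disc ?n \<union> disc_boundary ?n"
    by (auto simp: closed_disc_def open_disc_def disc_boundary_def)
  then have "?\<Psi> ` disc ?n = \<Phi> i ` open_disc ?n \<union> \<Phi> i ` disc_boundary ?n"
    unfolding \<Psi>im by (simp add: image_Un)
  moreover have "(\<Union>j\<in>A. \<Phi> j ` open_disc (d j)) = ?X \<union> \<Phi> i ` open_disc ?n" using i(1) by blast
  moreover have absorb: "S \<union> (U \<union> V) = S \<union> U" if "V \<subseteq> S" for S U V :: "'b set"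
    using that by blast
  ultimately have XA: "?X \<union> ?\<Psi> ` disc ?n = (\<Union>j\<in>A. \<Phi> j ` open_disc (d j))"
    by (simp only: absorb [OF bdX])
  \<comment> \<open>If the new open cell contains \<open>b\<^sub>0\<close>, its preimage is
    prescribed, with value \<open>e\<^sub>0\<close> and trivial marking; otherwise the centre is
    used with any marked point above it.\<close>
  obtain z0 e \<mu> where z0: "z0 \<in> disc ?n" "norm z0 < 1" and e: "p e = ?\<Psi> z0" "marking \<mu> e"
    and z0b: "b\<^sub>0 \<in> \<Phi> i ` open_disc ?n \<Longrightarrow> ?\<Psi> z0 = b\<^sub>0 \<and> e = e\<^sub>0 \<and> \<mu> = (\<lambda>_. e\<^sub>0)"
  proof (cases "b\<^sub>0 \<in> \<Phi> i ` open_disc ?n")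
    case True
    then obtain z where "z \<in> disc ?n" "norm z < 1" "?\<Psi> z = b\<^sub>0"
      unfolding \<Psi>im(2) [symmetric] by auto
    then show thesis using e\<^sub>0 by (intro that [of z e\<^sub>0 "\<lambda>_. e\<^sub>0"]) (auto simp: marking_def)
  next
    case False
    have "?\<Psi> 0 \<in> B" using \<Psi>B zero_in_disc by blast
    then obtain \<mu> e where "marking \<mu> e" "p e = ?\<Psi> 0" using exists_marking [OF conn] by blast
    then show thesis using False by (intro that [of 0 e \<mu>]) auto
  qed
  obtain g M where g: "coherent ?\<Psi> (disc ?n) g M" "g z0 = e" "transports (M z0) (\<lambda>_. e) \<mu>"
    "\<And>z. \<lbrakk>z \<in> disc ?n; norm z = 1\<rbrakk> \<Longrightarrow> g z = s (?\<Psi> z) \<and> transports (M z) (\<lambda>_. g z) (m (?\<Psi> z))"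
    using coherent_disc_lift [OF n c\<Psi> \<Psi>B sm(2) bd z0 e] by blast
  have XB: "?X \<subseteq> B" unfolding cells(8) [symmetric] using Suc.prems(1) by blast
  obtain s' m' where s': "coherent (\<lambda>x. x) (?X \<union> ?\<Psi> ` disc ?n) s' m'"
    "\<And>x. x \<in> ?X \<Longrightarrow> s' x = s x \<and> m' x = m x"
    "\<And>z. z \<in> disc ?n \<Longrightarrow> s' (?\<Psi> z) = g z \<and> transports (M z) (\<lambda>_. g z) (m' (?\<Psi> z))"
    using coherent_attach_cell [OF cells(2) sm(1) XB sm(2) c\<Psi> \<Psi>B inj disj bd g(1) g(4)] by blast
  have "s' b\<^sub>0 = e\<^sub>0 \<and> transports (m' b\<^sub>0) (\<lambda>_. e\<^sub>0) (\<lambda>_. e\<^sub>0)" if "b\<^sub>0 \<in> (\<Union>j\<in>A. \<Phi> j ` open_disc (d j))"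
  proof (cases "b\<^sub>0 \<in> ?X")
    case True
    then show ?thesis using sm(3) s'(2) by auto
  next
    case False
    then have b: "?\<Psi> z0 = b\<^sub>0" "e = e\<^sub>0" "\<mu> = (\<lambda>_. e\<^sub>0)" using that z0b by auto
    have "transports (M z0) (\<lambda>_. e\<^sub>0) (m' b\<^sub>0)" "transports (M z0) (\<lambda>_. e\<^sub>0) (\<lambda>_. e\<^sub>0)" "s' b\<^sub>0 = e\<^sub>0"
      using s'(3) [OF z0(1)] g(2,3) unfolding b by simp_all
    then show ?thesis using transports_unique [of "M z0" "\<lambda>_. e\<^sub>0"] by simp
  qed
  moreover have "compact (?X \<union> ?\<Psi> ` disc ?n)"
    by (intro compact_Un sm(1) compact_continuous_image c\<Psi> compact_disc)
  ultimately show ?case using s'(1) unfolding XA by blast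
qed

text \<open>Coherence along a loop \<open>c\<close> says that \<open>s \<circ> c\<close> transports
  \<open>m b\<^sub>0\<close> to itself. As \<open>m b\<^sub>0\<close> is equivalent to the trivial
  marking, this is membership in \<open>Sg\<close>.\<close>

lemma exists_section:
  assumes B: "finite_2_complex B" "path_connected B"
  obtains s where "is_section E p B s" "s b\<^sub>0 = e\<^sub>0"
    "\<And>c. \<lbrakk>path_in B c; pathstart c = b\<^sub>0; pathfinish c = b\<^sub>0\<rbrakk> \<Longrightarrow> s \<circ> c \<in> Sg"
proof -
  obtain I d and \<Phi> :: "nat \<Rightarrow> (nat \<Rightarrow> real) \<Rightarrow> 'b"
    where CW: "finite_CW_structure B I d \<Phi>" "\<forall>i\<in>I. d i \<le> 2"
    using B by (auto simp: finite_2_complex_def)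
  have "(\<Union>i\<in>I. \<Phi> i ` open_disc (d i)) = B" using CW by (simp add: finite_CW_structure_def)
  then obtain s m where s: "coherent (\<lambda>x. x) B s m" "s b\<^sub>0 = e\<^sub>0" "transports (m b\<^sub>0) (\<lambda>_. e\<^sub>0) (\<lambda>_. e\<^sub>0)"
    using coherent_section_on_subcomplex [OF CW B(2), of I] b\<^sub>0 by auto
  note C = coherentD [OF s(1)]
  show thesis
  proof
    show "is_section E p B s" using C by (auto simp: is_section_def)
    fix c assume c: "path_in B c" "pathstart c = b\<^sub>0" "pathfinish c = b\<^sub>0"
    then have "transports (m b\<^sub>0) (s \<circ> c) (m b\<^sub>0)" using C(5) [OF c(1)] by (simp add: pathstart_def pathfinish_def)
    then have "transports (\<lambda>_. e\<^sub>0) (s \<circ> c) (\<lambda>_. e\<^sub>0)"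
      using transports_subst_left [OF transports_sym [OF s(3)]] transports_subst_right [OF _ s(3)] by blast
    then show "s \<circ> c \<in> Sg" by (rule transports_SgD)
  qed (rule s)
qed

end

section \<open>Consequences of the existence of a section\<close>

text \<open>A path \<open>g\<close> in \<open>E\<close> from \<open>e\<^sub>0\<close> to
  \<open>s b\<^sub>0\<close> has a loop as image. Following it by the reverse of the lift of this
  loop through \<open>s\<close> makes the image null, and homotopy lifting moves the result into the
  fibre.\<close>

lemma section_fibre_path:
  assumes fb: "fibre_bundle E p B F\<^sub>0" and s: "is_section E p B s"
    and E: "path_connected E" and e0: "e\<^sub>0 \<in> E" "p e\<^sub>0 = b\<^sub>0"
  obtains \<omega> where "path_in {x \<in> E. p x = b\<^sub>0} \<omega>" "pathstart \<omega> = e\<^sub>0" "pathfinish \<omega> = s b\<^sub>0"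
proof -
  have cp: "continuous_on E p" "p ` E \<subseteq> B" using fb by (auto simp: fibre_bundle_def)
  have s': "continuous_on B s" "s ` B \<subseteq> E" "\<And>b. b \<in> B \<Longrightarrow> p (s b) = b" using s by (auto simp: is_section_def)
  have b0: "b\<^sub>0 \<in> B" using e0 cp by auto
  then have "s b\<^sub>0 \<in> E" using s' by auto
  then obtain g where g: "path_in E g" "pathstart g = e\<^sub>0" "pathfinish g = s b\<^sub>0"
    using E e0(1) unfolding path_connected_def path_in_def by metis
  have pg: "path_in B (p \<circ> g)" "pathstart (p \<circ> g) = b\<^sub>0" "pathfinish (p \<circ> g) = b\<^sub>0"
    using path_in_compose [OF g(1) cp] g s'(3) [OF b0] e0 by (auto simp: pathstart_compose pathfinish_compose)
  have sg: "path_in E (s \<circ> (p \<circ> g))" "pathstart (s \<circ> (p \<circ> g)) = s b\<^sub>0" "pathfinish (s \<circ> (p \<circ> g)) = s b\<^sub>0"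
    using path_in_compose [OF pg(1) s'(1,2)] pg by (auto simp: pathstart_compose pathfinish_compose)
  let ?\<eta> = "g +++ reversepath (s \<circ> (p \<circ> g))"
  have \<eta>: "path_in E ?\<eta>" "pathstart ?\<eta> = e\<^sub>0" "pathfinish ?\<eta> = s b\<^sub>0" using g sg by auto
  have psg: "path_in B (p \<circ> (s \<circ> (p \<circ> g)))" by (rule path_in_compose [OF sg(1) cp])
  have psg_eq: "homotopic_paths B (p \<circ> g) (p \<circ> (s \<circ> (p \<circ> g)))"
    using pg(1) s'(3) by (intro homotopic_paths_pointwise_eq) (simp_all add: path_in_alt)
  have "homotopic_paths B (p \<circ> ?\<eta>) (\<lambda>_. b\<^sub>0)"
  proof -
    have "homotopic_paths B (reversepath (p \<circ> g)) (reversepath (p \<circ> (s \<circ> (p \<circ> g))))"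
      using psg_eq by (simp add: homotopic_paths_reversepath)
    then have "hrel B (reversepath (p \<circ> (s \<circ> (p \<circ> g)))) = hrel B (reversepath (p \<circ> g))"
      using hrel_cong by metis
    moreover have "pathstart (p \<circ> (s \<circ> (p \<circ> g))) = b\<^sub>0" "pathfinish (p \<circ> (s \<circ> (p \<circ> g))) = b\<^sub>0"
      using sg s'(3) [OF b0] by (simp_all add: pathstart_compose pathfinish_compose)
    ultimately show ?thesis
      unfolding path_compose_join path_compose_reversepath
      by (subst homotopic_paths_hrel_iff) (use pg psg b0 in \<open>simp_all add: hrel_simps\<close>)
  qed
  then obtain \<omega> where \<omega>: "homotopic_paths E ?\<eta> \<omega>" "\<And>t. t \<in> {0..1} \<Longrightarrow> p (\<omega> t) = b\<^sub>0"
    using homotopic_paths_lifting [OF fb \<eta>(1)] by blast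
  show thesis
  proof
    show "path_in {x \<in> E. p x = b\<^sub>0} \<omega>"
      using \<omega>(2) homotopic_imp_path_in [OF \<omega>(1)] by (auto simp: path_in_alt)
  qed (use \<omega>(1) \<eta> homotopic_paths_imp_pathstart homotopic_paths_imp_pathfinish in metis)+
qed

text \<open>The section need not send \<open>b\<^sub>0\<close> to \<open>e\<^sub>0\<close>, so the
  map induced by \<open>s\<close> is conjugated by \<open>\<omega>\<close>; as
  \<open>\<omega>\<close> lies in one fibre, the conjugation disappears under
  \<open>p\<close>.\<close>

lemma section_splits_pi1:
  assumes fb: "fibre_bundle E p B F\<^sub>0" and s: "is_section E p B s" and e0: "e\<^sub>0 \<in> E" "p e\<^sub>0 = b\<^sub>0"
    and \<omega>: "path_in {x \<in> E. p x = b\<^sub>0} \<omega>" "pathstart \<omega> = e\<^sub>0" "pathfinish \<omega> = s b\<^sub>0"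
  shows "\<exists>\<sigma>. splits_on_pi1 E e\<^sub>0 p B b\<^sub>0 \<sigma>"
proof -
  have cp: "continuous_on E p" "p ` E \<subseteq> B" using fb by (auto simp: fibre_bundle_def)
  have s': "continuous_on B s" "s ` B \<subseteq> E" "\<And>b. b \<in> B \<Longrightarrow> p (s b) = b" using s by (auto simp: is_section_def)
  have b0: "b\<^sub>0 \<in> B" using e0 cp by auto
  have \<omega>E: "path_in E \<omega>" using \<omega>(1) by (rule path_in_mono) auto
  define L where "L c = (\<omega> +++ (s \<circ> c)) +++ reversepath \<omega>" for c
  define \<sigma> where "\<sigma> a = {r. \<exists>c\<in>a. homotopic_paths E (L c) r}" for a
  have sc: "path_in E (s \<circ> c)" "pathstart (s \<circ> c) = s b\<^sub>0" "pathfinish (s \<circ> c) = s b\<^sub>0"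
    if "c \<in> loops_at B b\<^sub>0" for c
    using path_in_compose [OF _ s'(1,2), of c] that
    by (auto simp: loops_at_iff pathstart_compose pathfinish_compose)
  have L: "L c \<in> loops_at E e\<^sub>0" if "c \<in> loops_at B b\<^sub>0" for c
    using sc [OF that] \<omega> \<omega>E by (simp add: L_def loops_at_iff)
  have \<sigma>L: "\<sigma> (loop_class B c) = loop_class E (L c)" if c: "c \<in> loops_at B b\<^sub>0" for c
  proof -
    have "homotopic_paths E (L c) (L c')" if "homotopic_paths B c c'" for c'
    proof -
      have "homotopic_paths E (s \<circ> c) (s \<circ> c')"
        using that s' by (intro homotopic_paths_continuous_image) auto
      then show ?thesis
        unfolding L_def using sc [OF c] \<omega> \<omega>E by (intro homotopic_paths_join) (auto simp: path_in_def)
    qed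
    moreover have "homotopic_paths B c c" using c by (auto simp: loops_at_def)
    ultimately show ?thesis
      unfolding \<sigma>_def loop_class_def by (blast intro: homotopic_paths_trans)
  qed
  have "\<sigma> \<in> hom (fundamental_group B b\<^sub>0) (fundamental_group E e\<^sub>0)"
  proof (rule homI)
    fix a assume "a \<in> carrier (fundamental_group B b\<^sub>0)"
    then obtain c where c: "c \<in> loops_at B b\<^sub>0" "a = loop_class B c" by (auto simp: fundamental_group_def)
    then show "\<sigma> a \<in> carrier (fundamental_group E e\<^sub>0)" using \<sigma>L L by (simp add: fundamental_group_def)
    fix a' assume "a' \<in> carrier (fundamental_group B b\<^sub>0)"
    then obtain c' where c': "c' \<in> loops_at B b\<^sub>0" "a' = loop_class B c'" by (auto simp: fundamental_group_def)
    have "homotopic_paths E (L (c +++ c')) (L c +++ L c')"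
      unfolding L_def path_compose_join
      by (subst homotopic_paths_hrel_iff) (use sc [OF c(1)] sc [OF c'(1)] \<omega> \<omega>E in \<open>simp_all add: hrel_simps\<close>)
    then show "\<sigma> (a \<otimes>\<^bsub>fundamental_group B b\<^sub>0\<^esub> a') = \<sigma> a \<otimes>\<^bsub>fundamental_group E e\<^sub>0\<^esub> \<sigma> a'"
      using c c' L by (simp add: fundamental_group_mult \<sigma>L loops_at_join loop_class_eq_iff [of _ E e\<^sub>0])
  qed
  moreover have "induced_map B p (\<sigma> a) = a" if a: "a \<in> carrier (fundamental_group B b\<^sub>0)" for a
  proof -
    obtain c where c: "c \<in> loops_at B b\<^sub>0" "a = loop_class B c"
      using a by (auto simp: fundamental_group_def)
    then have c': "path_in B c" "pathstart c = b\<^sub>0" "pathfinish c = b\<^sub>0" by (auto simp: loops_at_iff)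
    have p\<omega>: "path_in B (p \<circ> \<omega>)" "pathstart (p \<circ> \<omega>) = b\<^sub>0" "pathfinish (p \<circ> \<omega>) = b\<^sub>0"
      using path_in_compose [OF \<omega>E cp] \<omega> e0 s'(3) [OF b0] by (auto simp: pathstart_compose pathfinish_compose)
    have psc: "path_in B (p \<circ> (s \<circ> c))" using path_in_compose [OF sc(1) [OF c(1)] cp] .
    have "homotopic_paths B (p \<circ> \<omega>) (\<lambda>_. b\<^sub>0)"
      using p\<omega>(1) \<omega>(1) by (intro homotopic_paths_pointwise_eq) (simp_all add: path_in_alt)
    then have h: "hrel B (p \<circ> \<omega>) = hrel B (\<lambda>_. b\<^sub>0)" "hrel B (reversepath (p \<circ> \<omega>)) = hrel B (\<lambda>_. b\<^sub>0)"
      using hrel_cong [OF homotopic_paths_reversepath_D, of B "p \<circ> \<omega>" "\<lambda>_. b\<^sub>0"]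
      by (simp_all add: hrel_cong reversepath_def [of "\<lambda>_. b\<^sub>0"])
    have "homotopic_paths B c (p \<circ> (s \<circ> c))"
      using c'(1) s'(3) by (intro homotopic_paths_pointwise_eq) (simp_all add: path_in_alt)
    then have h': "hrel B (p \<circ> (s \<circ> c)) = hrel B c" using hrel_cong by metis
    have e: "pathstart (p \<circ> (s \<circ> c)) = b\<^sub>0" "pathfinish (p \<circ> (s \<circ> c)) = b\<^sub>0"
      using sc [OF c(1)] s'(3) [OF b0] by (simp_all add: pathstart_compose pathfinish_compose)
    have "homotopic_paths B (p \<circ> L c) c"
      unfolding L_def path_compose_join path_compose_reversepath
      by (subst homotopic_paths_hrel_iff) (use p\<omega> psc c' h h' e b0 in \<open>simp_all add: hrel_simps\<close>)
    moreover have "p \<circ> L c \<in> loops_at B b\<^sub>0"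
      using loops_at_compose [OF cp L [OF c(1)]] e0 by simp
    ultimately show ?thesis
      using c(2) \<sigma>L [OF c(1)] induced_map_loop_class [OF cp L [OF c(1)]]
      by (simp add: loop_class_eq_iff [of _ B b\<^sub>0])
  qed
  ultimately show ?thesis by (auto simp: splits_on_pi1_def)
qed

text \<open>The homotopy of lifts gives, along the edge carrying \<open>f\<close>, a square in the
  fibre from \<open>f\<close> to the constant \<open>s b\<^sub>0\<close> with sides
  \<open>?l\<close> and \<open>?r\<close>. The other three edges of the null homotopy are mapped to
  \<open>e\<^sub>0\<close>, and following the tracks along them shows that \<open>?l\<close> and
  \<open>?r\<close> are homotopic. So \<open>f\<close> followed by \<open>?r\<close> is homotopic to
  \<open>?r\<close>, and \<open>f\<close> is null.\<close>

lemma section_fibre_loop_null: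
  fixes s :: "'b::topological_space \<Rightarrow> 'e::topological_space"
  assumes fb: "fibre_bundle E p B F\<^sub>0" and s: "is_section E p B s" and e0: "e\<^sub>0 \<in> E" "p e\<^sub>0 = b\<^sub>0"
    and \<omega>: "path_in {x \<in> E. p x = b\<^sub>0} \<omega>" "pathstart \<omega> = e\<^sub>0" "pathfinish \<omega> = s b\<^sub>0"
    and f: "path_in {x \<in> E. p x = b\<^sub>0} f" "pathstart f = e\<^sub>0" and null: "homotopic_paths E f (\<lambda>_. e\<^sub>0)"
  shows "homotopic_paths {x \<in> E. p x = b\<^sub>0} f (\<lambda>_. e\<^sub>0)"
proof -
  let ?F = "{x \<in> E. p x = b\<^sub>0}" and ?I = "{0..1::real}"
  let ?S = "?I \<times> ?I"
  have cp: "continuous_on E p" "p ` E \<subseteq> B" using fb by (auto simp: fibre_bundle_def)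
  have s': "continuous_on B s" "s ` B \<subseteq> E" "\<And>b. b \<in> B \<Longrightarrow> p (s b) = b" using s by (auto simp: is_section_def)
  have b0: "b\<^sub>0 \<in> B" using e0 cp by auto
  have f1: "pathfinish f = e\<^sub>0" using homotopic_paths_imp_pathfinish [OF null] by simp
  obtain h where h: "continuous_on ?S h" "h \<in> ?S \<rightarrow> E"
    and h0: "\<And>t. t \<in> ?I \<Longrightarrow> h (0, t) = f t" and h1: "\<And>t. t \<in> ?I \<Longrightarrow> h (1, t) = e\<^sub>0"
    and hends: "\<And>t. t \<in> ?I \<Longrightarrow> h (t, 0) = e\<^sub>0 \<and> h (t, 1) = e\<^sub>0"
    using null f(2) f1 unfolding homotopic_paths by (auto simp: pathstart_def pathfinish_def)
  define u where "u z = p (h z)" for z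
  have hE: "h z \<in> E" and uB: "u z \<in> B" if "z \<in> ?S" for z using h(2) cp(2) that by (auto simp: u_def)
  have cu: "continuous_on ?S u"
    unfolding u_def by (rule continuous_on_compose2 [OF cp(1) h(1)]) (use h(2) in auto)
  obtain T T' where T: "trivialisation E p F\<^sub>0 u ?S T T'"
    using fibre_bundle_trivial_over_rectangle [OF fb cu] uB by (auto simp: trivial_over_def image_subset_iff)
  note TD = trivialisationD [OF T] and Tc = trivialisation_continuous [OF T] and Tc' = trivialisation_continuous' [OF T]
  define H where "H z = T' (z, h z)" for z
  define k where "k z = T' (z, s (u z))" for z
  have su: "s (u z) \<in> E" "p (s (u z)) = u z" if "z \<in> ?S" for z using s' uB [OF that] by auto
  have csu: "continuous_on ?S (\<lambda>z. s (u z))"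
    by (rule continuous_on_compose2 [OF s'(1) cu]) (use uB in auto)
  have H: "H z \<in> F\<^sub>0" "T (z, H z) = h z" and k: "k z \<in> F\<^sub>0" "T (z, k z) = s (u z)" if "z \<in> ?S" for z
    using TD(6,7) [OF that hE [OF that]] TD(6,7) [OF that su(1) [OF that]] su(2) [OF that]
    by (auto simp: H_def k_def u_def)
  have cH: "continuous_on ?S H" unfolding H_def
    by (rule Tc') (use h hE in \<open>auto simp: u_def intro!: continuous_intros\<close>)
  have ck: "continuous_on ?S k" unfolding k_def
    by (rule Tc') (use csu su in \<open>auto intro!: continuous_intros\<close>)
  let ?z0 = "(0, 0) :: real \<times> real"
  have z0: "?z0 \<in> ?S" "h ?z0 = e\<^sub>0" "u ?z0 = b\<^sub>0" using hends [of 0] e0 by (auto simp: u_def)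
  define w where "w t = T' (?z0, \<omega> t)" for t
  have w: "continuous_on ?I w" "\<And>t. t \<in> ?I \<Longrightarrow> w t \<in> F\<^sub>0" "w 0 = H ?z0" "w 1 = k ?z0"
    unfolding w_def H_def k_def using \<omega> z0
    by (auto simp: path_in_alt pathstart_def pathfinish_def intro!: Tc' TD(6) continuous_intros)
  \<comment> \<open>Both coordinate maps contract to their values at the corner because the square
    is convex; these values are joined by the coordinate \<open>w\<close> of
    \<open>\<omega>\<close>.\<close>
  have "homotopic_with_canon (\<lambda>_. True) ?S F\<^sub>0 H k"
  proof -
    have conv: "homotopic_with_canon (\<lambda>_. True) ?S ?S (\<lambda>z. z) (\<lambda>_. ?z0)"
    proof (rule homotopic_with_linear)
      have "convex ?S" by (intro convex_Times) auto
      then show "closed_segment z ?z0 \<subseteq> ?S" if "z \<in> ?S" for z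
        by (rule closed_segment_subset [OF that z0(1)])
    qed (auto intro!: continuous_intros)
    have "homotopic_with_canon (\<lambda>_. True) ?S F\<^sub>0 (H \<circ> (\<lambda>z. z)) (H \<circ> (\<lambda>_. ?z0))"
      by (rule homotopic_with_compose_continuous_left [OF conv cH]) (use H in auto)
    moreover have "homotopic_with_canon (\<lambda>_. True) ?S F\<^sub>0 (k \<circ> (\<lambda>z. z)) (k \<circ> (\<lambda>_. ?z0))"
      by (rule homotopic_with_compose_continuous_left [OF conv ck]) (use k in auto)
    moreover have "homotopic_with_canon (\<lambda>_. True) ?S F\<^sub>0 (\<lambda>_. H ?z0) (\<lambda>_. k ?z0)"
      unfolding homotopic_with_def
    proof (intro exI [of _ "\<lambda>x. w (fst x)"] conjI allI ballI)
      have "continuous_on (?I \<times> ?S) (\<lambda>x. w (fst x))"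
        by (rule continuous_on_compose2 [OF w(1)]) (auto intro!: continuous_intros)
      then show "continuous_map (prod_topology (subtopology euclideanreal ?I) (top_of_set ?S)) (top_of_set F\<^sub>0) (\<lambda>x. w (fst x))"
        using w(2) by auto
    qed (use w in auto)
    ultimately show ?thesis
      by (simp add: comp_def) (meson homotopic_with_trans homotopic_with_symD)
  qed
  then obtain N where cN: "continuous_on (?I \<times> ?S) N" and N: "N \<in> ?I \<times> ?S \<rightarrow> F\<^sub>0"
    and N01: "\<And>z. N (0, z) = H z" "\<And>z. N (1, z) = k z"
    by (auto simp: homotopic_with_def)
  have NF: "N (t, z) \<in> F\<^sub>0" if "t \<in> ?I" "z \<in> ?S" for t z
    using N that by blast
  \<comment> \<open>The track of \<open>z\<close> in the fibre over \<open>u z\<close>, from the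
    null homotopy to the section.\<close>
  define Q where "Q z t = T (z, N (t, z))" for z t
  have cQ: "continuous_on A (\<lambda>x. Q (g x) (q x))"
    if "continuous_on A g" "continuous_on A q" "\<And>x. x \<in> A \<Longrightarrow> g x \<in> ?S" "\<And>x. x \<in> A \<Longrightarrow> q x \<in> ?I"
    for A :: "(real \<times> real) set" and g q
    unfolding Q_def
  proof (intro Tc that)
    show "continuous_on A (\<lambda>x. N (q x, g x))"
      by (rule continuous_on_compose2 [OF cN]) (intro continuous_intros that, intro image_subsetI SigmaI that)
    show "N (q x, g x) \<in> F\<^sub>0" if "x \<in> A" for x
      by (intro NF \<open>\<And>x. x \<in> A \<Longrightarrow> g x \<in> ?S\<close> \<open>\<And>x. x \<in> A \<Longrightarrow> q x \<in> ?I\<close> that)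
  qed
  have QF: "Q z t \<in> ?F" if "z \<in> ?S" "t \<in> ?I" "p (h z) = b\<^sub>0" for z t
    using TD(3,4) [OF that(1) NF [OF that(2,1)]] that(3) by (simp add: Q_def u_def)
  have Q0: "Q z 0 = h z" and Q1: "Q z 1 = s (u z)" if "z \<in> ?S" for z
    using H k that by (simp_all add: Q_def N01)
  have fb0: "p (f t) = b\<^sub>0" if "t \<in> ?I" for t using f(1) that by (simp add: path_in_alt)
  have ub: "p (h (0, t)) = b\<^sub>0" "u (0, t) = b\<^sub>0" if "t \<in> ?I" for t
    using h0 [OF that] fb0 [OF that] by (auto simp: u_def)
  let ?l = "Q (0, 0)" and ?r = "Q (0, 1)" and ?G = "\<lambda>x. Q (0, fst x) (snd x)"
  have G: "continuous_on ?S ?G" "?G ` ?S \<subseteq> ?F"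
  proof -
    show "continuous_on ?S ?G" by (intro cQ continuous_intros) auto
    show "?G ` ?S \<subseteq> ?F"
    proof (rule image_subsetI)
      fix x assume "x \<in> ?S"
      then show "?G x \<in> ?F" by (intro QF ub(1)) auto
    qed
  qed
  have top: "Q (0, t) 1 = s b\<^sub>0" and bot: "Q (0, t) 0 = f t" if "t \<in> ?I" for t
    using Q0 [of "(0, t)"] Q1 [of "(0, t)"] that ub(2) [OF that] h0 [OF that] by auto
  have "homotopic_paths ?F ((\<lambda>t. Q (0, t) 0) +++ ?r) (?l +++ (\<lambda>t. Q (0, t) 1))"
    using square_homotopy(1) [OF G] by simp
  then have sq: "hrel ?F ((\<lambda>t. Q (0, t) 0) +++ ?r) = hrel ?F (?l +++ (\<lambda>t. Q (0, t) 1))"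
    by (rule hrel_cong)
  have "homotopic_paths ?F f (\<lambda>t. Q (0, t) 0)"
    using f(1) bot by (intro homotopic_paths_pointwise_eq) simp_all
  note hf = hrel_cong [OF this] homotopic_imp_path_in [OF this]
  have sF: "s b\<^sub>0 \<in> ?F" using s' b0 by auto
  have "homotopic_paths ?F (\<lambda>_. s b\<^sub>0) (\<lambda>t. Q (0, t) 1)"
    using sF top by (intro homotopic_paths_pointwise_eq) simp_all
  note hs = hrel_cong [OF this] homotopic_imp_path_in [OF this]
  \<comment> \<open>\<open>\<gamma>\<close> runs along the three sides of the square that \<open>h\<close> maps to \<open>e\<^sub>0\<close>\<close>
  define cl where "cl x = max 0 (min 1 x)" for x :: real
  define \<gamma> where "\<gamma> t = (cl (min (3 * t) (3 - 3 * t)), cl (3 * t - 1))" for t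
  have \<gamma>S: "\<gamma> t \<in> ?S" for t by (auto simp: \<gamma>_def cl_def)
  have \<gamma>side: "h (\<gamma> t) = e\<^sub>0" if "t \<in> ?I" for t
  proof -
    have "snd (\<gamma> t) = 0 \<or> fst (\<gamma> t) = 1 \<or> snd (\<gamma> t) = 1"
      using that by (auto simp: \<gamma>_def cl_def min_def max_def)
    then show ?thesis using \<gamma>S [of t] hends h1 by (cases "\<gamma> t") auto
  qed
  have \<gamma>u: "u (\<gamma> t) = b\<^sub>0" "p (h (\<gamma> t)) = b\<^sub>0" if "t \<in> ?I" for t using \<gamma>side [OF that] e0 by (simp_all add: u_def)
  have "homotopic_paths ?F ?l ?r"
    unfolding homotopic_paths
  proof (intro exI [of _ "\<lambda>x. Q (\<gamma> (fst x)) (snd x)"] conjI ballI)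
    show "continuous_on ?S (\<lambda>x. Q (\<gamma> (fst x)) (snd x))"
      by (intro cQ \<gamma>S, unfold \<gamma>_def cl_def) (auto intro!: continuous_intros)
    show "(\<lambda>x. Q (\<gamma> (fst x)) (snd x)) \<in> ?S \<rightarrow> ?F"
    proof
      fix x assume "x \<in> ?S"
      then show "Q (\<gamma> (fst x)) (snd x) \<in> ?F" by (intro QF \<gamma>S \<gamma>u(2)) auto
    qed
    fix t assume t: "t \<in> ?I"
    show "Q (\<gamma> (fst (0, t))) (snd (0, t)) = ?l t" "Q (\<gamma> (fst (1, t))) (snd (1, t)) = ?r t"
      by (simp_all add: \<gamma>_def cl_def)
    show "pathstart ((\<lambda>x. Q (\<gamma> (fst x)) (snd x)) \<circ> Pair t) = pathstart ?l"
      using Q0 [OF \<gamma>S] Q0 [OF z0(1)] \<gamma>side [OF t] z0 by (simp add: pathstart_def)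
    show "pathfinish ((\<lambda>x. Q (\<gamma> (fst x)) (snd x)) \<circ> Pair t) = pathfinish ?l"
      using Q1 [OF \<gamma>S] Q1 [OF z0(1)] \<gamma>u [OF t] z0 by (simp add: pathfinish_def)
  qed
  note hl = hrel_cong [OF this] homotopic_imp_path_in [OF this]
  have ends: "pathstart ?r = e\<^sub>0" "pathfinish ?l = s b\<^sub>0" "pathfinish ?r = s b\<^sub>0"
    "pathfinish (\<lambda>t. Q (0, t) 0) = e\<^sub>0" "pathstart (\<lambda>t. Q (0, t) 1) = s b\<^sub>0"
    using bot [of 1] top [of 0] top [of 1] f1 Q0 [of "(0,1)"] hends [of 0]
    by (auto simp: pathstart_def pathfinish_def)
  have "hrel ?F f O hrel ?F ?r = hrel ?F ?r"
    using sq hf hs(1) [symmetric] hs(2) hl ends sF by (simp add: hrel_simps)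
  then have "(hrel ?F f O hrel ?F ?r) O hrel ?F (reversepath ?r) = hrel ?F ?r O hrel ?F (reversepath ?r)"
    by simp
  then have "hrel ?F f = hrel ?F (\<lambda>_. e\<^sub>0)"
    using hl f f1 ends by (simp add: hrel_simps)
  then show ?thesis
    using f(1) e0 by (simp add: homotopic_paths_hrel_iff)
qed

lemma section_fibre_mono:
  fixes s :: "'b::topological_space \<Rightarrow> 'e::topological_space"
  assumes fb: "fibre_bundle E p B F\<^sub>0" and s: "is_section E p B s" and e0: "e\<^sub>0 \<in> E" "p e\<^sub>0 = b\<^sub>0"
    and \<omega>: "path_in {x \<in> E. p x = b\<^sub>0} \<omega>" "pathstart \<omega> = e\<^sub>0" "pathfinish \<omega> = s b\<^sub>0"
  shows "induced_map E (\<lambda>x. x) \<in> mon (fundamental_group {x \<in> E. p x = b\<^sub>0} e\<^sub>0) (fundamental_group E e\<^sub>0)"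
proof -
  let ?F = "{x \<in> E. p x = b\<^sub>0}"
  have incl: "continuous_on ?F (\<lambda>x. x)" "(\<lambda>x. x) ` ?F \<subseteq> E" by auto
  have comp: "(\<lambda>x. x) \<circ> g = g" for g :: "real \<Rightarrow> 'e" by (simp add: comp_def)
  have "inj_on (induced_map E (\<lambda>x. x)) (carrier (fundamental_group ?F e\<^sub>0))"
  proof (rule inj_onI)
    fix a a' assume "a \<in> carrier (fundamental_group ?F e\<^sub>0)" "a' \<in> carrier (fundamental_group ?F e\<^sub>0)"
      and eq: "induced_map E (\<lambda>x. x) a = induced_map E (\<lambda>x. x) a'"
    then obtain f f' where f: "f \<in> loops_at ?F e\<^sub>0" "a = loop_class ?F f"
      and f': "f' \<in> loops_at ?F e\<^sub>0" "a' = loop_class ?F f'"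
      by (auto simp: fundamental_group_def)
    note l = f(1) [unfolded loops_at_iff] f'(1) [unfolded loops_at_iff]
    have lE: "path_in E f" "path_in E f'" using l path_in_mono [of ?F _ E] by auto
    have "loop_class E f = loop_class E f'"
      using eq f f' induced_map_loop_class [OF incl f(1)] induced_map_loop_class [OF incl f'(1)] comp by metis
    then have "homotopic_paths E f f'"
      using l lE loop_class_eq_iff [of f E e\<^sub>0 f'] by (simp add: loops_at_iff)
    then have hE: "hrel E f = hrel E f'" by (rule hrel_cong)
    have "homotopic_paths E (f +++ reversepath f') (\<lambda>_. e\<^sub>0)"
      by (subst homotopic_paths_hrel_iff) (use l lE hE e0 in \<open>simp_all add: hrel_simps\<close>)
    then have "homotopic_paths ?F (f +++ reversepath f') (\<lambda>_. e\<^sub>0)"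
      using l by (intro section_fibre_loop_null [OF fb s e0 \<omega>]) auto
    then have "hrel ?F (f +++ reversepath f') = hrel ?F (\<lambda>_. e\<^sub>0)" by (rule hrel_cong)
    then have "hrel ?F (f +++ reversepath f') O hrel ?F f' = hrel ?F (\<lambda>_. e\<^sub>0) O hrel ?F f'" by simp
    then have "hrel ?F f = hrel ?F f'" using l by (simp add: hrel_simps)
    then show "a = a'"
      using f f' l by (simp add: loop_class_eq_iff [OF f(1)] homotopic_paths_hrel_iff)
  qed
  then show ?thesis using induced_map_hom [OF incl] by (simp add: mon_def)
qed

section \<open>Realising a splitting by a section\<close>

text \<open>The key is that \<open>p\<close> recovers \<open>a\<close> from any loop representing
  \<open>\<sigma> a\<close>: this gives surjectivity onto loops of \<open>B\<close>, and it forces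
  \<open>a\<close>, hence \<open>\<sigma> a\<close>, to be trivial when the projected loop is
  null.\<close>

lemma split_bundle_of_splitting:
  assumes fb: "fibre_bundle E p B F\<^sub>0" and e0: "e\<^sub>0 \<in> E" "p e\<^sub>0 = b\<^sub>0" and b0: "b\<^sub>0 \<in> B"
    and mono: "induced_map E (\<lambda>x. x) \<in> mon (fundamental_group {x \<in> E. p x = b\<^sub>0} e\<^sub>0) (fundamental_group E e\<^sub>0)"
    and \<sigma>: "splits_on_pi1 E e\<^sub>0 p B b\<^sub>0 \<sigma>"
  shows "split_bundle E p B F\<^sub>0 e\<^sub>0 b\<^sub>0
    {g \<in> loops_at E e\<^sub>0. loop_class E g \<in> \<sigma> ` carrier (fundamental_group B b\<^sub>0)}"
    (is "split_bundle E p B F\<^sub>0 e\<^sub>0 b\<^sub>0 ?Sg")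
proof
  let ?F = "{x \<in> E. p x = b\<^sub>0}" and ?PB = "fundamental_group B b\<^sub>0" and ?PE = "fundamental_group E e\<^sub>0"
  interpret PB: group ?PB using b0 by (rule group_fundamental_group)
  interpret PE: group ?PE using e0(1) by (rule group_fundamental_group)
  have hom: "\<sigma> \<in> hom ?PB ?PE" and sec: "\<And>a. a \<in> carrier ?PB \<Longrightarrow> induced_map B p (\<sigma> a) = a"
    using \<sigma> by (auto simp: splits_on_pi1_def)
  have \<sigma>1: "\<sigma> (loop_class B (\<lambda>_. b\<^sub>0)) = loop_class E (\<lambda>_. e\<^sub>0)"
    using hom_one [OF hom PB.is_group PE.is_group] by (simp add: fundamental_group_def)
  have cp: "continuous_on E p" "p ` E \<subseteq> B" using fb by (auto simp: fibre_bundle_def)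
  have carrE: "loop_class E g \<in> carrier ?PE" if "g \<in> loops_at E e\<^sub>0" for g
    using that by (simp add: fundamental_group_def)
  have carrB: "loop_class B g \<in> carrier ?PB" if "g \<in> loops_at B b\<^sub>0" for g
    using that by (simp add: fundamental_group_def)
  have pl: "p \<circ> g \<in> loops_at B b\<^sub>0" if "g \<in> loops_at E e\<^sub>0" for g
    using loops_at_compose [OF cp that] e0 by simp
  have proj: "loop_class B (p \<circ> g) = a" if "g \<in> loops_at E e\<^sub>0" "loop_class E g = \<sigma> a" "a \<in> carrier ?PB" for g a
    using sec [OF that(3)] induced_map_loop_class [OF cp that(1)] that(2) by simp
  show "fibre_bundle E p B F\<^sub>0" "e\<^sub>0 \<in> E" "p e\<^sub>0 = b\<^sub>0" "b\<^sub>0 \<in> B" by fact+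
  show "path_in E g \<and> pathstart g = e\<^sub>0 \<and> pathfinish g = e\<^sub>0" if "g \<in> ?Sg" for g
    using that by (simp add: loops_at_iff)
  show "h \<in> ?Sg" if g: "g \<in> ?Sg" and gh: "homotopic_paths E g h" for g h
  proof -
    have "h \<in> loops_at E e\<^sub>0"
      using g homotopic_imp_path_in [OF gh] homotopic_paths_imp_pathstart [OF gh] homotopic_paths_imp_pathfinish [OF gh]
      by (simp add: loops_at_iff)
    moreover have "loop_class E g = loop_class E h" using g gh loop_class_eq_iff [of g E e\<^sub>0 h] by simp
    ultimately show ?thesis using g by simp
  qed
  show "(\<lambda>_. e\<^sub>0) \<in> ?Sg"
    using loops_at_const [OF e0(1)] \<sigma>1 carrB [OF loops_at_const [OF b0]] by (metis (mono_tags, lifting) image_eqI mem_Collect_eq)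
  show "g +++ h \<in> ?Sg" if g: "g \<in> ?Sg" and h: "h \<in> ?Sg" for g h
  proof -
    obtain a a' where a: "a \<in> carrier ?PB" "loop_class E g = \<sigma> a" "a' \<in> carrier ?PB" "loop_class E h = \<sigma> a'"
      using g h by auto
    have "loop_class E (g +++ h) = \<sigma> (a \<otimes>\<^bsub>?PB\<^esub> a')"
      using g h a hom_mult [OF hom] by (simp flip: fundamental_group_mult)
    then show ?thesis using g h a by (auto simp: loops_at_join)
  qed
  show "reversepath g \<in> ?Sg" if g: "g \<in> ?Sg" for g
  proof -
    have gl: "g \<in> loops_at E e\<^sub>0" using g by simp
    obtain a where a: "a \<in> carrier ?PB" "loop_class E g = \<sigma> a" using g by auto
    obtain c where c: "c \<in> loops_at B b\<^sub>0" "a = loop_class B c" using a(1) by (auto simp: fundamental_group_def)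
    have r: "reversepath g \<in> loops_at E e\<^sub>0" "reversepath c \<in> loops_at B b\<^sub>0"
      using gl c(1) by (simp_all add: loops_at_reversepath)
    have "loop_class B (reversepath c) \<otimes>\<^bsub>?PB\<^esub> a = loop_class B (\<lambda>_. b\<^sub>0)"
      using c r by (simp add: fundamental_group_mult loop_class_eq_iff [OF loops_at_join [OF r(2) c(1)]] homotopic_reversepath_join)
    then have "\<sigma> (loop_class B (reversepath c)) \<otimes>\<^bsub>?PE\<^esub> \<sigma> a = loop_class E (\<lambda>_. e\<^sub>0)"
      using hom_mult [OF hom carrB [OF r(2)] a(1)] \<sigma>1 by simp
    moreover have "loop_class E (reversepath g) \<otimes>\<^bsub>?PE\<^esub> \<sigma> a = loop_class E (\<lambda>_. e\<^sub>0)"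
      unfolding a(2) [symmetric]
      by (simp add: fundamental_group_mult [OF r(1) gl] loop_class_eq_iff [OF loops_at_join [OF r(1) gl]] homotopic_reversepath_join [OF gl])
    ultimately have "loop_class E (reversepath g) = \<sigma> (loop_class B (reversepath c))"
      \<comment> \<open>Both classes are left inverses of \<open>\<sigma> a\<close>, so they
        coincide.\<close>
      using PE.right_cancel carrE [OF r(1)] carrE [OF gl] a(2) hom_in_carrier [OF hom carrB [OF r(2)]] by metis
    then show ?thesis using r carrB by auto
  qed
  show "\<exists>g\<in>?Sg. homotopic_paths B (p \<circ> g) c"
    if "path_in B c" "pathstart c = b\<^sub>0" "pathfinish c = b\<^sub>0" for c
  proof -
    have c: "c \<in> loops_at B b\<^sub>0" using that by (simp add: loops_at_iff)
    have "\<sigma> (loop_class B c) \<in> carrier ?PE" using hom_in_carrier [OF hom carrB [OF c]] .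
    then obtain g where g: "g \<in> loops_at E e\<^sub>0" "\<sigma> (loop_class B c) = loop_class E g"
      by (auto simp: fundamental_group_def)
    then have "loop_class B (p \<circ> g) = loop_class B c" using proj [OF g(1)] carrB [OF c] by metis
    then have "homotopic_paths B (p \<circ> g) c" by (simp add: loop_class_eq_iff [OF pl [OF g(1)]])
    then show ?thesis using g carrB [OF c] by (metis (mono_tags, lifting) image_eqI mem_Collect_eq)
  qed
  show "homotopic_paths E g (\<lambda>_. e\<^sub>0)" if g: "g \<in> ?Sg" and null: "homotopic_paths B (p \<circ> g) (\<lambda>_. b\<^sub>0)" for g
  proof -
    have gl: "g \<in> loops_at E e\<^sub>0" using g by simp
    obtain a where a: "a \<in> carrier ?PB" "loop_class E g = \<sigma> a" using g by auto
    have "a = loop_class B (\<lambda>_. b\<^sub>0)"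
      using proj [OF gl a(2,1)] null loop_class_eq_iff [OF pl [OF gl]] by metis
    then have "loop_class E g = loop_class E (\<lambda>_. e\<^sub>0)" using a(2) \<sigma>1 by simp
    then show ?thesis by (simp add: loop_class_eq_iff [OF gl])
  qed
  show "homotopic_paths ?F f (\<lambda>_. e\<^sub>0)"
    if "path_in ?F f" "pathstart f = e\<^sub>0" "pathfinish f = e\<^sub>0" "homotopic_paths E f (\<lambda>_. e\<^sub>0)" for f
  proof -
    have f: "f \<in> loops_at ?F e\<^sub>0" using that by (simp add: loops_at_iff)
    have c: "(\<lambda>_. e\<^sub>0) \<in> loops_at ?F e\<^sub>0" using e0 by (intro loops_at_const) simp
    have incl: "continuous_on ?F (\<lambda>x. x)" "(\<lambda>x. x) ` ?F \<subseteq> E" by auto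
    have "f \<in> loops_at E e\<^sub>0" using loops_at_compose [OF incl f] by (simp add: comp_def)
    then have "loop_class E f = loop_class E (\<lambda>_. e\<^sub>0)" using that(4) by (simp add: loop_class_eq_iff)
    then have eq: "induced_map E (\<lambda>x. x) (loop_class ?F f) = induced_map E (\<lambda>x. x) (loop_class ?F (\<lambda>_. e\<^sub>0))"
      by (simp add: induced_map_loop_class [OF incl f] induced_map_loop_class [OF incl c] comp_def)
    have "inj_on (induced_map E (\<lambda>x. x)) (loop_class ?F ` loops_at ?F e\<^sub>0)"
      using mono by (simp add: mon_def fundamental_group_def)
    then have "loop_class ?F f = loop_class ?F (\<lambda>_. e\<^sub>0)"
      using eq by (rule inj_onD) (use f c in auto)
    then show ?thesis by (simp add: loop_class_eq_iff [OF f])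
  qed
qed

theorem theorem2p1:
  fixes p :: "'e::topological_space \<Rightarrow> 'b::topological_space"
    and E :: "'e set" and B :: "'b set" and F\<^sub>0 :: "'f::topological_space set"
    and e\<^sub>0 :: 'e and b\<^sub>0 :: 'b and F :: "'e set"
  assumes "fibre_bundle E p B F\<^sub>0"
    and "finite_2_complex B"
    and "path_connected B"
    and "b\<^sub>0 \<in> B" and "e\<^sub>0 \<in> E" and "p e\<^sub>0 = b\<^sub>0"
    and "F = {x \<in> E. p x = b\<^sub>0}"
  shows "(path_connected E \<longrightarrow>
           ((\<exists>s. is_section E p B s) \<longleftrightarrow>
              induced_map E (\<lambda>x. x) \<in> mon (fundamental_group F e\<^sub>0) (fundamental_group E e\<^sub>0) \<and>
              (\<exists>\<sigma>. splits_on_pi1 E e\<^sub>0 p B b\<^sub>0 \<sigma>))) \<and>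
         (induced_map E (\<lambda>x. x) \<in> mon (fundamental_group F e\<^sub>0) (fundamental_group E e\<^sub>0) \<longrightarrow>
           (\<forall>\<sigma>. splits_on_pi1 E e\<^sub>0 p B b\<^sub>0 \<sigma> \<longrightarrow>
              (\<exists>s. is_section E p B s \<and> s b\<^sub>0 = e\<^sub>0 \<and>
                   (\<forall>a\<in>carrier (fundamental_group B b\<^sub>0). induced_map E s a = \<sigma> a))))"
proof -
  note fb = assms(1) and e0 = assms(5,6)
  have realise: "\<exists>s. is_section E p B s \<and> s b\<^sub>0 = e\<^sub>0 \<and>
      (\<forall>a\<in>carrier (fundamental_group B b\<^sub>0). induced_map E s a = \<sigma> a)"
    if mono: "induced_map E (\<lambda>x. x) \<in> mon (fundamental_group F e\<^sub>0) (fundamental_group E e\<^sub>0)"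
      and \<sigma>: "splits_on_pi1 E e\<^sub>0 p B b\<^sub>0 \<sigma>" for \<sigma>
  proof -
    let ?Sg = "{g \<in> loops_at E e\<^sub>0. loop_class E g \<in> \<sigma> ` carrier (fundamental_group B b\<^sub>0)}"
    interpret split_bundle E p B F\<^sub>0 e\<^sub>0 b\<^sub>0 ?Sg
      by (rule split_bundle_of_splitting [OF fb e0 assms(4) mono [unfolded assms(7)] \<sigma>])
    obtain s where s: "is_section E p B s" "s b\<^sub>0 = e\<^sub>0"
      and sc: "\<And>c. \<lbrakk>path_in B c; pathstart c = b\<^sub>0; pathfinish c = b\<^sub>0\<rbrakk> \<Longrightarrow> s \<circ> c \<in> ?Sg"
      using exists_section [OF assms(2,3)] by blast
    have s': "continuous_on B s" "s ` B \<subseteq> E" "\<And>b. b \<in> B \<Longrightarrow> p (s b) = b" using s(1) by (auto simp: is_section_def)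
    have "induced_map E s a = \<sigma> a" if a: "a \<in> carrier (fundamental_group B b\<^sub>0)" for a
    proof -
      obtain c where c: "c \<in> loops_at B b\<^sub>0" "a = loop_class B c"
        using a by (auto simp: fundamental_group_def)
      then have cp: "path_in B c" by (simp add: loops_at_iff)
      have "s \<circ> c \<in> ?Sg" using sc c(1) by (simp add: loops_at_iff)
      then obtain a' where a': "a' \<in> carrier (fundamental_group B b\<^sub>0)" "loop_class E (s \<circ> c) = \<sigma> a'"
        and scl: "s \<circ> c \<in> loops_at E e\<^sub>0" by auto
      have pE: "continuous_on E p" "p ` E \<subseteq> B" using fb by (auto simp: fibre_bundle_def)
      \<comment> \<open>Membership in \<open>?Sg\<close> only gives the value of
        \<open>\<sigma>\<close> at some \<open>a'\<close>; projecting to \<open>B\<close> identifies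
        \<open>a'\<close> with the class of \<open>c\<close>.\<close>
      have "a' = loop_class B (p \<circ> (s \<circ> c))"
        using induced_map_loop_class [OF pE scl] a' \<sigma> by (simp add: splits_on_pi1_def)
      moreover have "homotopic_paths B c (p \<circ> (s \<circ> c))"
        using cp s'(3) by (intro homotopic_paths_pointwise_eq) (simp_all add: path_in_alt)
      ultimately have "a' = a" using c loop_class_eq_iff [OF c(1)] by metis
      then show ?thesis using a'(2) induced_map_loop_class [OF s'(1,2) c(1)] c(2) by simp
    qed
    then show ?thesis using s by blast
  qed
  have forward: "induced_map E (\<lambda>x. x) \<in> mon (fundamental_group F e\<^sub>0) (fundamental_group E e\<^sub>0) \<and>
      (\<exists>\<sigma>. splits_on_pi1 E e\<^sub>0 p B b\<^sub>0 \<sigma>)"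
    if E: "path_connected E" and s: "is_section E p B s" for s
  proof -
    obtain \<omega> where \<omega>: "path_in {x \<in> E. p x = b\<^sub>0} \<omega>" "pathstart \<omega> = e\<^sub>0" "pathfinish \<omega> = s b\<^sub>0"
      using section_fibre_path [OF fb s E e0] by blast
    show ?thesis
      using section_fibre_mono [OF fb s e0 \<omega>] section_splits_pi1 [OF fb s e0 \<omega>] assms(7) by simp
  qed
  show ?thesis
  proof (rule conjI; intro impI allI)
    assume E: "path_connected E"
    show "(\<exists>s. is_section E p B s) \<longleftrightarrow>
        induced_map E (\<lambda>x. x) \<in> mon (fundamental_group F e\<^sub>0) (fundamental_group E e\<^sub>0) \<and>
        (\<exists>\<sigma>. splits_on_pi1 E e\<^sub>0 p B b\<^sub>0 \<sigma>)"
    proof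
      assume "\<exists>s. is_section E p B s"
      then show "induced_map E (\<lambda>x. x) \<in> mon (fundamental_group F e\<^sub>0) (fundamental_group E e\<^sub>0) \<and>
        (\<exists>\<sigma>. splits_on_pi1 E e\<^sub>0 p B b\<^sub>0 \<sigma>)"
        by (elim exE) (rule forward [OF E])
    next
      assume r: "induced_map E (\<lambda>x. x) \<in> mon (fundamental_group F e\<^sub>0) (fundamental_group E e\<^sub>0) \<and>
        (\<exists>\<sigma>. splits_on_pi1 E e\<^sub>0 p B b\<^sub>0 \<sigma>)"
      then obtain \<sigma> where "splits_on_pi1 E e\<^sub>0 p B b\<^sub>0 \<sigma>" by (elim conjE exE)
      from realise [OF conjunct1 [OF r] this] show "\<exists>s. is_section E p B s"
        by (elim exE conjE) (rule exI)
    qed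
  qed (rule realise)
qed

end
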